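(* Let $0<d^-\leqslant d^+$ be fixed constants. Let $d:S_n\to[0,\infty)$ be a multiplicative function with $d_j:=\hat d(j)$ satisfying $0<d^-\leqslant d_j\leqslant d^+$ for all $j$, and let $f:S_n\to\mathbb C$ be a multiplicative function with $|f(\sigma)|\leqslant 1$ for all $\sigma\in S_n$. Put $p_m=\frac{1}{m!}\sum_{\sigma\in S_m}d(\sigma)$ ($p_0=1$) and $$\Delta_n:=\left|M_n^d(f)-\exp\Big\{\sum_{k=1}^n d_k\frac{\hat f(k)-1}{k}\Big\}\right|.$$ Then there is a constant $c=c(d^-,d^+)>0$ depending only on $d^-,d^+$ such that: if $d^-<1$, $$\Delta_n\leqslant c\left(\Big(\sum_{j=0}^n p_j\Big)^{-1}\sum_{k=1}^n|\hat f(k)-1|p_{n-k}+\frac{1}{n^{d^-}}\sum_{k=1}^n|\hat f(k)-1|k^{d^--1}+\frac1n\sum_{k=1}^n|\hat f(k)-1|\right),$$ and if $d^-\geqslant 1$, $$\Delta_n\leqslant c\left(\Big(\sum_{j=0}^n p_j\Big)^{-1}\sum_{k=1}^n|\hat f(k)-1|p_{n-k}+\frac1n\sum_{k=1}^n|\hat f(k)-1|\Big(1+\log\frac nk\Big)\right).$$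
   Context: $S_n$ is the symmetric group; every $\sigma\in S_n$ decomposes uniquely (up to order) as a product of disjoint cycles $\sigma=\kappa_1\cdots\kappa_{\omega(\sigma)}$. A function $f:S_n\to\mathbb C$ is multiplicative if $f(\sigma)=f(\kappa_1)\cdots f(\kappa_{\omega(\sigma)})$ and $f(\kappa)$ depends only on the length $|\kappa|$ of the cycle; $\hat f(j)$ denotes the value of $f$ on cycles of length $j$. For a nonnegative multiplicative $d\not\equiv0$, $\nu_{n,d}(\{\sigma\})=d(\sigma)/\sum_{w\in S_n}d(w)$, and $M_n^d(f)=\sum_{\sigma\in S_n}f(\sigma)\nu_{n,d}(\sigma)$. *)

theory Defs
  imports Complex_Main "HOL-Combinatorics.Combinatorics"
begin

text \<open>
  A function \<open>f\<close> on permutations takes the ground set \<open>A\<close> as an explicit argument: \<open>f A \<sigma>\<close> is the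
  value at the permutation \<open>\<sigma>\<close> of \<open>A\<close>. In the rule \<open>f(\<sigma>) = f(\<kappa>\<^sub>1) \<cdots> f(\<kappa>\<^sub>w)\<close> a cycle \<open>\<kappa>\<^sub>i\<close> is a
  permutation of its own orbit, so that a fixed point is a cycle of length one; as a bare function
  it would be the identity, whatever the ground set.

  \<open>S\<^sub>n\<close> is the set of permutations of \<open>{1..n}\<close>. The subsets of \<open>{1..n}\<close> serve as ground sets for the
  cycles of its elements, and the sets \<open>{1..m}\<close> with \<open>m \<le> n\<close> give the smaller groups \<open>S\<^sub>m\<close>.
\<close>

definition multiplicative :: "nat \<Rightarrow> (nat set \<Rightarrow> (nat \<Rightarrow> nat) \<Rightarrow> 'a::comm_monoid_mult) \<Rightarrow> bool" where
  "multiplicative n f \<longleftrightarrow>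
     (\<forall>A \<sigma>. A \<subseteq> {1..n} \<longrightarrow> \<sigma> permutes A \<longrightarrow>
        f A \<sigma> = (\<Prod>C\<in>orbit \<sigma> ` A. f C (perm_restrict \<sigma> C))) \<and>
     (\<forall>C C' \<kappa> \<kappa>'. C \<subseteq> {1..n} \<longrightarrow> C' \<subseteq> {1..n} \<longrightarrow>
        \<kappa> permutes C \<longrightarrow> cyclic_on \<kappa> C \<longrightarrow> \<kappa>' permutes C' \<longrightarrow> cyclic_on \<kappa>' C' \<longrightarrow>
        card C = card C' \<longrightarrow> f C \<kappa> = f C' \<kappa>')"

text \<open>The value on cycles of length \<open>j\<close>, read off at the cycle \<open>(1 2 \<dots> j)\<close>;
  see \<open>hat_eq\<close> below for independence of the cycle.\<close>

definition hat :: "(nat set \<Rightarrow> (nat \<Rightarrow> nat) \<Rightarrow> 'a) \<Rightarrow> nat \<Rightarrow> 'a" where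
  "hat f j = f {1..j} (cycle_of_list [1..<Suc j])"

definition nu :: "nat \<Rightarrow> (nat set \<Rightarrow> (nat \<Rightarrow> nat) \<Rightarrow> real) \<Rightarrow> (nat \<Rightarrow> nat) \<Rightarrow> real" where
  "nu n d \<sigma> = d {1..n} \<sigma> / (\<Sum>w | w permutes {1..n}. d {1..n} w)"

definition mean_value ::
    "nat \<Rightarrow> (nat set \<Rightarrow> (nat \<Rightarrow> nat) \<Rightarrow> real) \<Rightarrow> (nat set \<Rightarrow> (nat \<Rightarrow> nat) \<Rightarrow> complex) \<Rightarrow> complex" where
  "mean_value n d f = (\<Sum>\<sigma> | \<sigma> permutes {1..n}. f {1..n} \<sigma> * of_real (nu n d \<sigma>))"

definition p :: "(nat set \<Rightarrow> (nat \<Rightarrow> nat) \<Rightarrow> real) \<Rightarrow> nat \<Rightarrow> real" where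
  "p d m = 1 / fact m * (\<Sum>\<sigma> | \<sigma> permutes {1..m}. d {1..m} \<sigma>)"

definition Delta ::
    "nat \<Rightarrow> (nat set \<Rightarrow> (nat \<Rightarrow> nat) \<Rightarrow> real) \<Rightarrow> (nat set \<Rightarrow> (nat \<Rightarrow> nat) \<Rightarrow> complex) \<Rightarrow> real" where
  "Delta n d f =
     norm (mean_value n d f - exp (\<Sum>k=1..n. of_real (hat d k) * (hat f k - 1) / of_nat k))"

lemma p_0:
  assumes "multiplicative n d"
  shows "p d 0 = 1"
proof -
  have "d {} id = (\<Prod>C\<in>orbit id ` {}. d C (perm_restrict id C))"
    using assms[unfolded multiplicative_def, THEN conjunct1, rule_format, of "{}" id]
    by (simp only: empty_subsetI permutes_id)
  then have "d {} id = 1"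
    by (simp only: image_empty prod.empty)
  then show ?thesis
    by (simp add: p_def)
qed

lemma cyclic_on_cycle_of_list:
  assumes "distinct cs" "cs \<noteq> []"
  shows "cyclic_on (cycle_of_list cs) (set cs)"
proof -
  let ?c = "cycle_of_list cs"
  have nth: "(?c ^^ k) (hd cs) = cs ! (k mod length cs)" for k
  proof -
    have "(?c ^^ k) (hd cs) = hd (map (?c ^^ k) cs)"
      using assms(2) by (rule hd_map[symmetric])
    also have "\<dots> = hd (rotate k cs)"
      by (simp only: cyclic_rotation[OF assms(1)])
    finally show ?thesis
      using hd_rotate_conv_nth[OF assms(2)] by simp
  qed
  have "orbit ?c (hd cs) = set cs"
  proof
    show "orbit ?c (hd cs) \<subseteq> set cs"
      unfolding orbit_altdef nth using assms(2) by auto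
    show "set cs \<subseteq> orbit ?c (hd cs)"
    proof
      fix x assume "x \<in> set cs"
      then obtain i where "i < length cs" "x = cs ! i"
        by (auto simp: in_set_conv_nth)
      then have "x = (?c ^^ (i + length cs)) (hd cs)" "0 < i + length cs"
        unfolding nth by auto
      then show "x \<in> orbit ?c (hd cs)"
        unfolding orbit_altdef by blast
    qed
  qed
  then show ?thesis
    unfolding cyclic_on_def using hd_in_set[OF assms(2)] by metis
qed

lemma hat_eq:
  assumes "multiplicative n f" "C \<subseteq> {1..n}" "\<kappa> permutes C" "cyclic_on \<kappa> C"
  shows "f C \<kappa> = hat f (card C)"
proof -
  let ?cs = "[1..<Suc (card C)]"
  have set: "set ?cs = {1..card C}"
    by auto
  have "card C \<le> n"
    using card_mono[OF _ assms(2)] by simp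
  moreover have "C \<noteq> {}"
    using assms(4) by (auto simp: cyclic_on_def)
  then have "?cs \<noteq> []"
    using finite_subset[OF assms(2)] by (simp add: Suc_le_eq card_gt_0_iff)
  then have "cyclic_on (cycle_of_list ?cs) {1..card C}"
    using cyclic_on_cycle_of_list[of ?cs, unfolded set] distinct_upt by blast
  moreover have "cycle_of_list ?cs permutes {1..card C}"
    by (rule cycle_permutes[of ?cs, unfolded set])
  moreover have "{1..card C} \<subseteq> {1..n}" "card C = card {1..card C}"
    using \<open>card C \<le> n\<close> by auto
  ultimately show ?thesis
    using assms(2-4) assms(1)[unfolded multiplicative_def, THEN conjunct2, rule_format,
      of C "{1..card C}" \<kappa> "cycle_of_list ?cs"]
    by (simp only: hat_def)
qed

text \<open>Values on cycles can be prescribed arbitrarily.\<close>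

lemma multiplicative_prod_orbits:
  "multiplicative n (\<lambda>A \<sigma>. \<Prod>C\<in>orbit \<sigma> ` A. g (card C))"
proof -
  have cyc: "orbit \<kappa> ` C = {C}" if "cyclic_on \<kappa> C" for \<kappa> :: "nat \<Rightarrow> nat" and C
    using that by (auto simp: cyclic_on_alldef)
  have restr: "cyclic_on (perm_restrict \<sigma> C) C"
    if "C \<in> orbit \<sigma> ` A" "A \<subseteq> {1..n}" "\<sigma> permutes A" for A \<sigma> C
  proof -
    have "cyclic_on \<sigma> C"
      using that cyclic_on_orbit[of \<sigma> A] finite_subset[OF that(2)] by auto
    then show ?thesis
      using cyclic_cong[of C "perm_restrict \<sigma> C" \<sigma>] by (simp add: perm_restrict_simps)
  qed
  have "(\<Prod>C\<in>orbit \<sigma> ` A. g (card C)) =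
      (\<Prod>C\<in>orbit \<sigma> ` A. \<Prod>C'\<in>orbit (perm_restrict \<sigma> C) ` C. g (card C'))"
    if "A \<subseteq> {1..n}" "\<sigma> permutes A" for A \<sigma>
    by (rule prod.cong[OF refl]) (simp add: cyc[OF restr[OF _ that]])
  then show ?thesis
    unfolding multiplicative_def by (simp add: cyc)
qed

end

theory Submission
  imports Defs "HOL-Complex_Analysis.Complex_Analysis"
begin

text \<open>
  Write \<open>d\<^sub>k\<close>, \<open>f\<^sub>k\<close> for the values on cycles, \<open>F\<^sub>m\<close> for the mean of \<open>d f\<close> over \<open>S\<^sub>m\<close> and
  \<open>P(z) = \<Sum> p\<^sub>m z\<^sup>m = exp (\<Sum> d\<^sub>k z\<^sup>k / k)\<close>. Removing the cycle through a given point gives the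
  renewal recursions \<open>m p\<^sub>m = \<Sum> d\<^sub>k p\<^sub>m\<^sub>-\<^sub>k\<close> and \<open>m F\<^sub>m = \<Sum> d\<^sub>k F\<^sub>m\<^sub>-\<^sub>k + S\<^sub>m\<close> with
  \<open>S\<^sub>m = \<Sum> d\<^sub>k (f\<^sub>k - 1) F\<^sub>m\<^sub>-\<^sub>k\<close>. By superposition it suffices to compare, for a single source at \<open>j\<close>,
  the solution \<open>U\<^sub>n\<close> of \<open>m U\<^sub>m = \<Sum> d\<^sub>k U\<^sub>m\<^sub>-\<^sub>k + [m = j]\<close> with \<open>T p\<^sub>n\<close>, where
  \<open>T = \<integral>\<^sub>0\<^sup>x u\<^sup>j\<^sup>-\<^sup>1 / P(u) du\<close> for some \<open>x\<close> with \<open>1 - x\<close> of order \<open>1 / n\<close>.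

  The numbers \<open>V\<^sub>n = T p\<^sub>n - U\<^sub>n\<close> are the coefficients of \<open>V(z) = P(z) \<integral>\<^sub>z\<^sup>x u\<^sup>j\<^sup>-\<^sup>1 / P(u) du\<close>. Put
  \<open>\<delta> = min 1 d\<^sup>-\<close> and \<open>W(z) = P(z) (1 - z)\<^sup>\<delta>\<close>. Since \<open>log W\<close> has nonnegative coefficients,
  \<open>|W(r w) / W(s w)| \<le> W(r) / W(s)\<close> along each ray, which bounds \<open>V(z) / (1 - z)\<close> on circles; Bessel's
  inequality then bounds the partial sums of \<open>V\<^sub>n\<close>. Writing \<open>d\<^sub>k = \<delta> + e\<^sub>k\<close> turns the recursion for \<open>V\<^sub>n\<close>
  into one with the nonnegative coefficients \<open>e\<^sub>k\<close> and with the partial sums as sources. It is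
  majorised by positive solutions and yields \<open>n |V\<^sub>n| \<le> [n = j] + C W(1 - 1/n) / (j W(1 - 1/j))\<close>.
\<close>

section \<open>Multiplicative functions and cycles\<close>

text \<open>The obstacle is cancellation: \<open>T p\<^sub>n\<close> and \<open>U\<^sub>n\<close>
  have the same order, and majorising the recursion for their difference with all of
  \<open>d\<^sub>k\<close> only returns that order. Majorising with \<open>e\<^sub>k\<close> alone
  returns W(1 - 1/n) / n instead, which is smaller by a factor (n/j)^\<delta>. The price is that the
  removed part \<delta> acts on the partial sums of \<open>V\<^sub>n\<close>, so these must be known
  to be small beforehand. Circle estimates control them only in mean square, but the recursion turns
  this into pointwise decay of order s^(-1/2) relative to W, and that is summable where it is used.
  The exponential appears because the sum of \<open>S\<^sub>j\<close> u^(j-1) over all j is P(u)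
  times the derivative of exp(L(u)), where L(u) is the sum of
  \<open>d\<^sub>k (f\<^sub>k - 1)\<close> u^k / k. Hence the \<open>S\<^sub>j T\<close> add up to
  exp(L(x)) - 1, apart from the terms with j > n. The two shapes of the theorem come from the sum of
  j^(\<delta> - 2) over k < j \<le> n: it is of order k^(\<delta> - 1) for \<delta> < 1, but a
  logarithm for \<delta> = 1.\<close>

definition cyc_perms :: "'a set \<Rightarrow> ('a \<Rightarrow> 'a) set" where
  "cyc_perms C = {c. c permutes C \<and> cyclic_on c C}"

lemma comp_disjoint_apply:
  assumes "c permutes C" "t permutes (A - C)"
  shows "y \<in> C \<Longrightarrow> (c \<circ> t) y = c y" "y \<notin> C \<Longrightarrow> (c \<circ> t) y = t y"
proof -
  show "(c \<circ> t) y = c y" if "y \<in> C"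
    using that assms(2) by (simp add: permutes_not_in)
  show "(c \<circ> t) y = t y" if "y \<notin> C"
  proof -
    have "t y \<notin> C"
      using that assms(2) by (metis DiffD2 permutes_in_image permutes_not_in)
    then show ?thesis using assms(1) by (simp add: permutes_not_in)
  qed
qed

lemma comp_disjoint_permutes:
  assumes "c permutes C" "t permutes (A - C)" "C \<subseteq> A"
  shows "(c \<circ> t) permutes A"
  by (meson Diff_subset assms permutes_compose permutes_subset)

lemma perm_restrict_orbit_permutes:
  assumes "finite A" and s: "\<sigma> permutes A" and "x \<in> A"
  shows "perm_restrict \<sigma> (orbit \<sigma> x) permutes orbit \<sigma> x"
proof (rule bij_imp_permutes)
  have "finite (orbit \<sigma> x)"
    using permutes_orbit_subset[OF s assms(3)] assms(1) by (rule finite_subset)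
  then have "\<sigma> ` orbit \<sigma> x = orbit \<sigma> x"
    using permutes_inj_on[OF s] by (intro endo_inj_surj) (auto intro: orbit.step)
  then have "bij_betw \<sigma> (orbit \<sigma> x) (orbit \<sigma> x)"
    using permutes_inj_on[OF s] by (simp add: bij_betw_def)
  then show "bij_betw (perm_restrict \<sigma> (orbit \<sigma> x)) (orbit \<sigma> x) (orbit \<sigma> x)"
    by (subst bij_betw_cong[where g = \<sigma>]) (simp_all add: perm_restrict_simps)
qed (simp add: perm_restrict_simps)

text \<open>A permutation is recovered from the orbit \<open>C\<close> of \<open>x\<close> and its
  restrictions to \<open>C\<close> and to \<open>A - C\<close>, which compose because their supports
  are disjoint. This turns a sum over permutations into one over cycles through
  \<open>x\<close>.\<close>

lemma sum_permutes_by_cycle: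
  fixes h :: "('a \<Rightarrow> 'a) \<Rightarrow> 'b::comm_monoid_add"
  assumes "finite A" "x \<in> A"
  shows "(\<Sum>\<sigma> | \<sigma> permutes A. h \<sigma>) =
    (\<Sum>C | x \<in> C \<and> C \<subseteq> A. \<Sum>c\<in>cyc_perms C. \<Sum>t | t permutes (A - C). h (c \<circ> t))"
proof -
  have fin: "finite {C. x \<in> C \<and> C \<subseteq> A}"
    using assms(1) by simp
  have fin2: "finite (cyc_perms C)" if "C \<subseteq> A" for C
    unfolding cyc_perms_def using finite_permutations[OF finite_subset[OF that assms(1)]] by simp
  have fin3: "finite {t. t permutes (A - C)}" for C
    using assms(1) by (simp add: finite_permutations)
  let ?I = "SIGMA C:{C. x \<in> C \<and> C \<subseteq> A}. SIGMA c:cyc_perms C. {t. t permutes (A - C)}"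
  have "(\<Sum>C | x \<in> C \<and> C \<subseteq> A. \<Sum>c\<in>cyc_perms C. \<Sum>t | t permutes (A - C). h (c \<circ> t))
     = (\<Sum>(C, c, t)\<in>?I. h (c \<circ> t))"
    by (subst sum.Sigma[symmetric]) (auto simp: fin fin2 fin3 sum.Sigma finite_SigmaI)
  also have "\<dots> = (\<Sum>\<sigma> | \<sigma> permutes A. h \<sigma>)"
  proof (rule sum.reindex_bij_witness[where
        i = "\<lambda>\<sigma>. (orbit \<sigma> x, perm_restrict \<sigma> (orbit \<sigma> x), perm_restrict \<sigma> (A - orbit \<sigma> x))" and
        j = "\<lambda>(C, c, t). c \<circ> t"], goal_cases)
    case (1 b)
    then obtain C c t where b: "b = (C, c, t)" "x \<in> C" "C \<subseteq> A" "c permutes C"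
      "cyclic_on c C" "t permutes (A - C)"
      by (auto simp: cyc_perms_def)
    let ?s = "c \<circ> t"
    note ap = comp_disjoint_apply[OF b(4,6)]
    have cyc: "cyclic_on ?s C"
      using cyclic_cong[of C ?s c] ap b(5) by simp
    then have orb: "orbit ?s x = C"
      using b(2) by (simp add: cyclic_on_alldef)
    have "perm_restrict ?s C = c"
    proof
      fix y show "perm_restrict ?s C y = c y"
        using ap[of y] b(4) by (cases "y \<in> C") (auto simp: perm_restrict_def permutes_not_in)
    qed
    moreover have "perm_restrict ?s (A - C) = t"
    proof
      fix y show "perm_restrict ?s (A - C) y = t y"
        using ap[of y] b(6) by (cases "y \<in> A - C") (auto simp: perm_restrict_def permutes_not_in)
    qed
    ultimately show ?case by (simp only: b(1) orb split_conv)
  next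
    case (2 b)
    then show ?case by (auto simp: cyc_perms_def intro: comp_disjoint_permutes)
  next
    case (3 \<sigma>)
    then have s: "\<sigma> permutes A" by simp
    let ?C = "orbit \<sigma> x"
    have cyc: "cyclic_on \<sigma> ?C" using cyclic_on_orbit[OF s assms(1)] .
    have sub: "?C \<subseteq> A" using permutes_orbit_subset[OF s assms(2)] .
    have p1: "perm_restrict \<sigma> ?C permutes ?C"
      using perm_restrict_orbit_permutes[OF assms(1) s assms(2)] .
    have p2: "perm_restrict \<sigma> (A - ?C) permutes (A - ?C)"
      using perm_restrict_diff_cyclic[OF s cyc] .
    have "perm_restrict \<sigma> ?C \<circ> perm_restrict \<sigma> (A - ?C) = perm_restrict \<sigma> (?C \<union> (A - ?C))"
      by (rule perm_restrict_union[OF p1 p2]) blast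
    also have "?C \<union> (A - ?C) = A" using sub by blast
    also have "perm_restrict \<sigma> A = \<sigma>" using s by (rule perm_restrict_id)
    finally show ?case by (simp only: split_conv)
  next
    case (4 \<sigma>)
    then have s: "\<sigma> permutes A" by simp
    let ?C = "orbit \<sigma> x"
    have cyc: "cyclic_on \<sigma> ?C" using cyclic_on_orbit[OF s assms(1)] .
    have sub: "?C \<subseteq> A" using permutes_orbit_subset[OF s assms(2)] .
    have p1: "perm_restrict \<sigma> ?C permutes ?C"
      using perm_restrict_orbit_permutes[OF assms(1) s assms(2)] .
    have "x \<in> ?C"
      using s assms(1) by (metis permutation_permutes permutation_self_in_orbit)
    then show ?case
      using sub p1 perm_restrict_diff_cyclic[OF s cyc] cyc
      by (simp add: cyc_perms_def cyclic_on_perm_restrict)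
  next
    case (5 b)
    then show ?case by auto
  qed
  finally show ?thesis by simp
qed

lemma sum_subsets_containing:
  fixes v :: "nat \<Rightarrow> 'b::comm_semiring_1"
  assumes "finite A" "x \<in> A"
  shows "(\<Sum>C | x \<in> C \<and> C \<subseteq> A. v (card C))
    = (\<Sum>k=1..card A. of_nat ((card A - 1) choose (k - 1)) * v k)"
proof -
  let ?S = "{C. x \<in> C \<and> C \<subseteq> A}"
  have fin: "finite ?S" using assms(1) by simp
  have sub: "card ` ?S \<subseteq> {1..card A}"
  proof safe
    fix C assume C: "x \<in> C" "C \<subseteq> A"
    then have "finite C" using assms(1) finite_subset by blast
    then have "card C > 0" using C(1) by (auto simp: card_gt_0_iff)
    then show "card C \<in> {1..card A}" using card_mono[OF assms(1) C(2)] by simp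
  qed
  have num: "card {C \<in> ?S. card C = k} = (card A - 1) choose (k - 1)" if "k \<in> {1..card A}" for k
  proof -
    have "bij_betw (insert x) {B. B \<subseteq> A - {x} \<and> card B = k - 1} {C \<in> ?S. card C = k}"
    proof (rule bij_betw_byWitness[where f' = "\<lambda>C. C - {x}"], goal_cases)
      case 3
      have "card (insert x B) = k" if "B \<subseteq> A - {x}" "card B = k - 1" for B
        using that \<open>k \<in> _\<close> assms(1) finite_subset[OF that(1)] by (subst card_insert_disjoint) auto
      then show ?case using assms(2) by auto
    next
      case 4
      show ?case using assms(2) by auto
    qed auto
    then have "card {C \<in> ?S. card C = k} = card {B. B \<subseteq> A - {x} \<and> card B = k - 1}"
      by (simp add: bij_betw_same_card)
    also have "\<dots> = (card A - 1) choose (k - 1)"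
      using n_subsets[of "A - {x}" "k - 1"] assms by simp
    finally show ?thesis .
  qed
  have "(\<Sum>C\<in>?S. v (card C)) = (\<Sum>k=1..card A. \<Sum>C | C \<in> ?S \<and> card C = k. v (card C))"
    by (rule sum.group[symmetric]) (use fin sub in auto)
  also have "\<dots> = (\<Sum>k=1..card A. of_nat ((card A - 1) choose (k - 1)) * v k)"
    by (rule sum.cong[OF refl]) (use num in simp)
  finally show ?thesis .
qed

lemma binomial_fact_shift:
  assumes "1 \<le> k" "k \<le> n"
  shows "((n - 1) choose (k - 1)) * fact (k - 1) * fact (n - k) = (fact (n - 1) :: nat)"
  using binomial_fact_lemma[of "k - 1" "n - 1"] assms by (simp add: algebra_simps)

text \<open>Instead of enumerating cycles, classify all \<open>|A|!\<close> permutations of \<open>A\<close> by the cycle of \<open>x\<close> and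
  solve for the only unknown term \<open>C = A\<close>.\<close>

lemma card_cyc_perms:
  assumes "finite A" "A \<noteq> {}"
  shows "card (cyc_perms A) = fact (card A - 1)"
  using assms
proof (induction "card A" arbitrary: A rule: less_induct)
  case less
  obtain x where x: "x \<in> A" using less.prems by blast
  let ?n = "card A"
  have n: "?n > 0" using less.prems by (simp add: card_gt_0_iff)
  let ?S = "{C. x \<in> C \<and> C \<subseteq> A}"
  have finS: "finite ?S" using less.prems by simp
  have AS: "A \<in> ?S" using x by simp
  have "fact ?n = (\<Sum>\<sigma> | \<sigma> permutes A. (1::nat))"
    using card_permutations[OF refl less.prems(1)] by simp
  also have "\<dots> = (\<Sum>C\<in>?S. card (cyc_perms C) * fact (?n - card C))"
    unfolding sum_permutes_by_cycle[OF less.prems(1) x]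
  proof (rule sum.cong[OF refl])
    fix C assume C: "C \<in> ?S"
    then have "finite C" using less.prems finite_subset by blast
    then have "card (A - C) = ?n - card C" using C by (simp add: card_Diff_subset)
    then have "card {t. t permutes (A - C)} = fact (?n - card C)"
      using less.prems by (simp add: card_permutations)
    then show "(\<Sum>c\<in>cyc_perms C. \<Sum>t | t permutes (A - C). 1) = card (cyc_perms C) * fact (?n - card C)"
      by simp
  qed
  also have "\<dots> = card (cyc_perms A) + (\<Sum>C\<in>?S - {A}. card (cyc_perms C) * fact (?n - card C))"
    using sum.remove[OF finS AS, of "\<lambda>C. card (cyc_perms C) * fact (?n - card C)"] by simp
  also have "(\<Sum>C\<in>?S - {A}. card (cyc_perms C) * fact (?n - card C))
    = (\<Sum>C\<in>?S - {A}. fact (card C - 1) * fact (?n - card C))"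
  proof (rule sum.cong[OF refl])
    fix C assume "C \<in> ?S - {A}"
    then have C: "C \<subset> A" "x \<in> C" by auto
    then have "card C < ?n" "finite C" using less.prems psubset_card_mono finite_subset by auto
    then show "card (cyc_perms C) * fact (?n - card C) = fact (card C - 1) * fact (?n - card C)"
      using less.hyps C by auto
  qed
  finally have 1: "fact ?n = card (cyc_perms A) + (\<Sum>C\<in>?S - {A}. fact (card C - 1) * fact (?n - card C))" .
  have "(\<Sum>C\<in>?S. fact (card C - 1) * fact (?n - card C)) =
      (\<Sum>k=1..?n. ((?n - 1) choose (k - 1)) * (fact (k - 1) * fact (?n - k)))"
    using sum_subsets_containing[OF less.prems(1) x, of "\<lambda>c. fact (c - 1) * fact (?n - c) :: nat"] by simp
  also have "\<dots> = (\<Sum>k=1..?n. fact (?n - 1))"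
    by (rule sum.cong[OF refl], subst mult.assoc[symmetric], rule binomial_fact_shift) auto
  also have "\<dots> = fact ?n" using n by (simp add: fact_reduce)
  finally have 2: "(\<Sum>C\<in>?S. fact (card C - 1) * fact (?n - card C)) = (fact ?n :: nat)" .
  have "(\<Sum>C\<in>?S. fact (card C - 1) * fact (?n - card C)) =
    (fact (?n - 1) :: nat) + (\<Sum>C\<in>?S - {A}. fact (card C - 1) * fact (?n - card C))"
    using sum.remove[OF finS AS, of "\<lambda>C. fact (card C - 1) * fact (?n - card C)"] by simp
  with 1 2 show ?case by simp
qed

text \<open>The orbits of \<open>c \<circ> t\<close> are \<open>C\<close> itself and the orbits of
  \<open>t\<close> on \<open>A - C\<close>, so the product over orbits loses exactly one
  factor.\<close>

lemma multiplicative_comp_cycle: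
  assumes g: "multiplicative n g" and A: "A \<subseteq> {1..n}" "C \<subseteq> A"
    and c: "c permutes C" "cyclic_on c C" and t: "t permutes (A - C)"
  shows "g A (c \<circ> t) = hat g (card C) * g (A - C) t"
proof -
  let ?s = "c \<circ> t"
  have finA: "finite A" using A(1) finite_subset by blast
  note ap = comp_disjoint_apply[OF c(1) t]
  have orb1: "orbit ?s y = C" if "y \<in> C" for y
    using that cyclic_cong[of C ?s c] ap c(2) by (simp add: cyclic_on_alldef)
  have C0: "C \<noteq> {}" using c(2) by (auto simp: cyclic_on_def)
  have sub: "orbit t y \<subseteq> A - C" if "y \<in> A - C" for y
    using permutes_orbit_subset[OF t that] .
  have orb2: "orbit ?s y = orbit t y" if "y \<in> A - C" for y
  proof -
    have "cyclic_on t (orbit t y)"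
      using cyclic_on_orbit[OF t] finA by simp
    moreover have "\<And>z. z \<in> orbit t y \<Longrightarrow> ?s z = t z"
      using sub[OF that] ap by blast
    ultimately have "cyclic_on ?s (orbit t y)"
      using cyclic_cong by metis
    moreover have "y \<in> orbit t y"
      using t finA by (metis finite_Diff permutation_permutes permutation_self_in_orbit)
    ultimately show ?thesis by (simp add: cyclic_on_alldef)
  qed
  have img: "orbit ?s ` A = insert C (orbit t ` (A - C))"
  proof -
    have "orbit ?s ` A = orbit ?s ` C \<union> orbit ?s ` (A - C)"
      using A(2) by blast
    also have "orbit ?s ` C = {C}" using orb1 C0 by auto
    also have "orbit ?s ` (A - C) = orbit t ` (A - C)" using orb2 by auto
    finally show ?thesis by (simp only: insert_is_Un[symmetric])
  qed
  have notin: "C \<notin> orbit t ` (A - C)" using sub C0 by blast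
  have "g A ?s = (\<Prod>D\<in>orbit ?s ` A. g D (perm_restrict ?s D))"
    using g A comp_disjoint_permutes[OF c(1) t A(2)] by (simp add: multiplicative_def)
  also have "\<dots> = g C (perm_restrict ?s C) *
      (\<Prod>D\<in>orbit t ` (A - C). g D (perm_restrict ?s D))"
    unfolding img using finA notin by (subst prod.insert) auto
  also have "perm_restrict ?s C = c"
  proof
    fix y show "perm_restrict ?s C y = c y"
      using ap[of y] c(1) by (cases "y \<in> C") (auto simp: perm_restrict_def permutes_not_in)
  qed
  also have "g C c = hat g (card C)"
    using A by (intro hat_eq[OF g _ c]) blast
  also have "(\<Prod>D\<in>orbit t ` (A - C). g D (perm_restrict ?s D)) =
      (\<Prod>D\<in>orbit t ` (A - C). g D (perm_restrict t D))"
  proof (rule prod.cong[OF refl])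
    fix D assume "D \<in> orbit t ` (A - C)"
    then have "D \<subseteq> A - C" using sub by blast
    then have "perm_restrict ?s D = perm_restrict t D"
      using ap by (auto simp: perm_restrict_def fun_eq_iff)
    then show "g D (perm_restrict ?s D) = g D (perm_restrict t D)" by simp
  qed
  also have "\<dots> = g (A - C) t"
    using g A t unfolding multiplicative_def by (metis Diff_subset subset_trans)
  finally show ?thesis .
qed

text \<open>General ground sets are needed because removing a cycle leaves \<open>A - C\<close>,
  which is rarely an initial segment. That only the cardinality matters is the second claim of
  \<open>perm_mean_rec\<close>.\<close>

definition perm_mean :: "(nat set \<Rightarrow> (nat \<Rightarrow> nat) \<Rightarrow> 'a::field_char_0) \<Rightarrow> nat set \<Rightarrow> 'a" where
  "perm_mean g A = (\<Sum>\<sigma> | \<sigma> permutes A. g A \<sigma>) / fact (card A)"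

text \<open>Cycles of length k through a fixed point, together with the permutations of the rest,
  number (card A - 1)! for every k, so no binomials survive. The recursion for \<open>A\<close>
  needs the invariance only for proper subsets, and its right side depends on \<open>card A\<close>
  alone; this makes the induction for the second claim work.\<close>

lemma perm_mean_rec:
  fixes g :: "nat set \<Rightarrow> (nat \<Rightarrow> nat) \<Rightarrow> 'a::field_char_0"
  assumes g: "multiplicative n g" and A: "A \<subseteq> {1..n}" "A \<noteq> {}"
  shows "of_nat (card A) * perm_mean g A =
    (\<Sum>k=1..card A. hat g k * perm_mean g {1..card A - k})"
    and "perm_mean g A = perm_mean g {1..card A}"
proof -
  have main: "of_nat (card A) * perm_mean g A =
      (\<Sum>k=1..card A. hat g k * perm_mean g {1..card A - k})"
    if A: "A \<subseteq> {1..n}" "A \<noteq> {}"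
      and IH: "\<And>B. B \<subset> A \<Longrightarrow> perm_mean g B = perm_mean g {1..card B}" for A
  proof -
    obtain x where x: "x \<in> A" using A by blast
    have finA: "finite A" using A(1) finite_subset by blast
    let ?N = "card A"
    have N: "?N > 0" using finA A by (simp add: card_gt_0_iff)
    have "(\<Sum>\<sigma> | \<sigma> permutes A. g A \<sigma>) =
        (\<Sum>C | x \<in> C \<and> C \<subseteq> A. fact (card C - 1) * hat g (card C) *
           (fact (?N - card C) * perm_mean g {1..?N - card C}))"
      unfolding sum_permutes_by_cycle[OF finA x]
    proof (rule sum.cong[OF refl])
      fix C assume "C \<in> {C. x \<in> C \<and> C \<subseteq> A}"
      then have C: "x \<in> C" "C \<subseteq> A" by auto
      have finC: "finite C" using C finA finite_subset by blast
      have cardD: "card (A - C) = ?N - card C"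
        using finC C by (simp add: card_Diff_subset)
      have "(\<Sum>c\<in>cyc_perms C. \<Sum>t | t permutes (A - C). g A (c \<circ> t)) =
        (\<Sum>c\<in>cyc_perms C. \<Sum>t | t permutes (A - C). hat g (card C) * g (A - C) t)"
        by (intro sum.cong refl multiplicative_comp_cycle[OF g A(1) C(2)]) (auto simp: cyc_perms_def)
      also have "\<dots> = of_nat (card (cyc_perms C)) * hat g (card C) *
          (\<Sum>t | t permutes (A - C). g (A - C) t)"
        by (simp add: sum_distrib_left mult.assoc)
      also have "card (cyc_perms C) = fact (card C - 1)"
        using C finC by (intro card_cyc_perms) auto
      also have "(\<Sum>t | t permutes (A - C). g (A - C) t) = fact (?N - card C) * perm_mean g (A - C)"
        by (simp add: perm_mean_def cardD)
      also have "perm_mean g (A - C) = perm_mean g {1..?N - card C}"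
        using IH[of "A - C"] C by (auto simp: cardD)
      finally show "(\<Sum>c\<in>cyc_perms C. \<Sum>t | t permutes (A - C). g A (c \<circ> t)) =
          fact (card C - 1) * hat g (card C) *
           (fact (?N - card C) * perm_mean g {1..?N - card C})"
        by (simp only: of_nat_fact)
    qed
    also have "\<dots> = (\<Sum>k=1..?N. of_nat ((?N - 1) choose (k - 1)) * (fact (k - 1) * hat g k *
           (fact (?N - k) * perm_mean g {1..?N - k})))"
      using sum_subsets_containing[OF finA x, of "\<lambda>k. fact (k - 1) * hat g k *
           (fact (?N - k) * perm_mean g {1..?N - k})"] by simp
    also have "\<dots> = (\<Sum>k=1..?N. fact (?N - 1) * (hat g k * perm_mean g {1..?N - k}))"
    proof (rule sum.cong[OF refl])
      fix k assume k: "k \<in> {1..?N}"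
      have "of_nat ((?N - 1) choose (k - 1)) * (fact (k - 1) * fact (?N - k)) = (fact (?N - 1) :: 'a)"
        using arg_cong[OF binomial_fact_shift[of k ?N], of "of_nat :: nat \<Rightarrow> 'a"] k
        by (simp add: mult.assoc)
      then show "of_nat ((?N - 1) choose (k - 1)) * (fact (k - 1) * hat g k *
           (fact (?N - k) * perm_mean g {1..?N - k})) =
           fact (?N - 1) * (hat g k * perm_mean g {1..?N - k})"
        by (simp add: mult_ac)
    qed
    finally have "(\<Sum>\<sigma> | \<sigma> permutes A. g A \<sigma>) =
       fact (?N - 1) * (\<Sum>k=1..?N. hat g k * perm_mean g {1..?N - k})"
      by (simp add: sum_distrib_left)
    moreover have "(fact ?N :: 'a) = of_nat ?N * fact (?N - 1)"
      using N by (simp add: fact_reduce)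
    ultimately show ?thesis
      using N by (simp add: perm_mean_def)
  qed
  have inv: "perm_mean g A = perm_mean g {1..card A}" if "A \<subseteq> {1..n}" for A
    using that
  proof (induction "card A" arbitrary: A rule: less_induct)
    case less
    have finA: "finite A" using less.prems finite_subset by blast
    show ?case
    proof (cases "A = {}")
      case False
      have N: "card A > 0" using finA False by (simp add: card_gt_0_iff)
      have le: "card A \<le> n" using card_mono[OF _ less.prems] by simp
      have 1: "perm_mean g B = perm_mean g {1..card B}" if "B \<subset> A" for B
        using less.hyps[of B] that less.prems finA psubset_card_mono by blast
      have 2: "perm_mean g B = perm_mean g {1..card B}" if "B \<subset> {1..card A}" for B
      proof -
        have "B \<subseteq> {1..n}" using that le by auto
        moreover have "card B < card A" using psubset_card_mono[OF _ that] by simp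
        ultimately show ?thesis using less.hyps by blast
      qed
      have "of_nat (card A) * perm_mean g A = of_nat (card A) * perm_mean g {1..card A}"
        using main[OF less.prems False 1] main[of "{1..card A}", OF _ _ 2] le N by auto
      then show ?thesis using N by simp
    qed simp
  qed
  show "perm_mean g A = perm_mean g {1..card A}"
    using inv A(1) .
  show "of_nat (card A) * perm_mean g A =
    (\<Sum>k=1..card A. hat g k * perm_mean g {1..card A - k})"
    by (rule main[OF A inv]) (use A(1) in auto)
qed

section \<open>Renewal recursions and power series\<close>

text \<open>The source at 0 serves as the initial value. Thus \<open>unit_at 0\<close> produces the
  coefficients of the exponential of the series with terms b_k z^k / k, while
  \<open>unit_at j\<close> with j > 0 starts from zero and is fed once, at step j.\<close>

fun renewal :: "(nat \<Rightarrow> 'a::real_normed_field) \<Rightarrow> (nat \<Rightarrow> 'a) \<Rightarrow> nat \<Rightarrow> 'a" where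
  "renewal b s n = (if n = 0 then s 0 else ((\<Sum>k=1..n. b k * renewal b s (n - k)) + s n) / of_nat n)"

declare renewal.simps [simp del]

lemma renewal_0 [simp]: "renewal b s 0 = s 0"
  by (simp add: renewal.simps)

lemma renewal_rec:
  "n > 0 \<Longrightarrow> of_nat n * renewal b s n = (\<Sum>k=1..n. b k * renewal b s (n - k)) + s n"
  by (subst renewal.simps) simp

lemma renewal_eqI:
  assumes "y 0 = s 0"
    and "\<And>n. 0 < n \<Longrightarrow> n \<le> N \<Longrightarrow> of_nat n * y n = (\<Sum>k=1..n. b k * y (n - k)) + s n"
  shows "m \<le> N \<Longrightarrow> y m = renewal b s m"
proof (induction m rule: less_induct)
  case (less m)
  show ?case
  proof (cases "m = 0")
    case False
    have "(\<Sum>k=1..m. b k * y (m - k)) = (\<Sum>k=1..m. b k * renewal b s (m - k))"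
      by (rule sum.cong[OF refl]) (use less in auto)
    then have "of_nat m * y m = of_nat m * renewal b s m"
      using assms(2)[of m] renewal_rec[of m b s] False less.prems by simp
    then show ?thesis using False by simp
  qed (use assms in simp)
qed

lemma renewal_cong:
  assumes "\<And>k. 1 \<le> k \<Longrightarrow> k \<le> n \<Longrightarrow> b k = b' k" "\<And>k. k \<le> n \<Longrightarrow> s k = s' k"
  shows "renewal b s n = renewal b' s' n"
  by (rule renewal_eqI[of _ _ n]) (use assms in \<open>auto simp: renewal_rec\<close>)

lemma renewal_of_real:
  "renewal (\<lambda>k. of_real (b k)) (\<lambda>k. of_real (s k)) n = (of_real (renewal b s n) :: 'a::real_normed_field)"
proof (rule sym, rule renewal_eqI[of _ _ n])
  fix m :: nat assume "0 < m"
  then show "of_nat m * (of_real (renewal b s m) :: 'a) =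
      (\<Sum>k=1..m. of_real (b k) * of_real (renewal b s (m - k))) + of_real (s m)"
    using arg_cong[OF renewal_rec[of m b s], of "of_real :: real \<Rightarrow> 'a"] by simp
qed auto

text \<open>Majorant principle, by induction with the triangle inequality. It bounds the complex
  means by those of \<open>d\<close> and passes from \<open>V\<close> to positive solutions.\<close>

lemma norm_renewal_le:
  assumes "\<And>k. 1 \<le> k \<Longrightarrow> k \<le> n \<Longrightarrow> norm (b k) \<le> b' k" "\<And>k. k \<le> n \<Longrightarrow> norm (s k) \<le> s' k"
  shows "norm (renewal b s n) \<le> renewal b' s' n"
proof -
  have "norm (renewal b s m) \<le> renewal b' s' m" if "m \<le> n" for m
    using that
  proof (induction m rule: less_induct)
    case (less m)
    show ?case
    proof (cases "m = 0")
      case False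
      have "norm (of_nat m * renewal b s m) \<le>
          (\<Sum>k=1..m. norm (b k * renewal b s (m - k))) + norm (s m)"
        unfolding renewal_rec[OF False[unfolded neq0_conv]]
        by (rule order.trans[OF norm_triangle_ineq]) (intro add_mono norm_sum order.refl)
      also have "\<dots> \<le> (\<Sum>k=1..m. b' k * renewal b' s' (m - k)) + s' m"
        unfolding norm_mult
        by (intro add_mono sum_mono mult_mono less.IH assms norm_ge_zero order.trans[OF norm_ge_zero assms(1)])
          (use less.prems in auto)
      also have "\<dots> = real m * renewal b' s' m"
        using renewal_rec[of m b' s'] False by simp
      finally show ?thesis using False by (simp add: norm_mult)
    qed (use assms(2)[of 0] in simp)
  qed
  then show ?thesis by simp
qed

lemma renewal_nonneg:
  fixes b s :: "nat \<Rightarrow> real"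
  assumes "\<And>k. 1 \<le> k \<Longrightarrow> 0 \<le> b k" "\<And>k. 0 \<le> s k"
  shows "0 \<le> renewal b s n"
  using norm_renewal_le[of n "\<lambda>_. 0 :: real" b "\<lambda>_. 0" s] assms
  by (intro order.trans[OF norm_ge_zero norm_renewal_le[of n "\<lambda>_. 0 :: real" b "\<lambda>_. 0" s]]) auto

lemma renewal_add:
  "renewal b (\<lambda>k. s k + t k) n = renewal b s n + renewal b t n"
  by (rule sym, rule renewal_eqI[of _ _ n])
    (auto simp: renewal_rec ring_distribs sum.distrib)

lemma renewal_cmult:
  "renewal b (\<lambda>k. c * s k) n = c * renewal b s n"
proof (rule sym, rule renewal_eqI[of _ _ n])
  fix m :: nat assume "0 < m"
  then show "of_nat m * (c * renewal b s m) = (\<Sum>k=1..m. b k * (c * renewal b s (m - k))) + c * s m"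
    using arg_cong[OF renewal_rec[of m b s], of "\<lambda>x. c * x"]
    by (simp add: ring_distribs sum_distrib_left mult_ac)
qed auto

lemma renewal_sum:
  assumes "finite J"
  shows "renewal b (\<lambda>k. \<Sum>j\<in>J. s j k) n = (\<Sum>j\<in>J. renewal b (s j) n)"
  using assms
proof (induction J)
  case empty
  show ?case using renewal_cmult[of b 0 "\<lambda>_. 0" n] by simp
next
  case (insert x F)
  then show ?case by (simp add: renewal_add)
qed

definition unit_at :: "nat \<Rightarrow> nat \<Rightarrow> 'a::zero_neq_one" where
  "unit_at j n = (if n = j then 1 else 0)"

text \<open>Linearity in the source; the solutions for \<open>unit_at j\<close> play the part of a
  Green function.\<close>

lemma renewal_superpos:
  "renewal b s n = (\<Sum>j\<le>n. s j * renewal b (unit_at j) n)"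
proof -
  have "renewal b s n = renewal b (\<lambda>k. \<Sum>j\<le>n. s j * unit_at j k) n"
    by (rule renewal_cong) (auto simp: unit_at_def if_distrib cong: if_cong)
  also have "\<dots> = (\<Sum>j\<le>n. s j * renewal b (unit_at j) n)"
    by (simp add: renewal_sum renewal_cmult)
  finally show ?thesis .
qed

lemma renewal_unit_at_less:
  assumes "n < j" shows "renewal b (unit_at j) n = 0"
  using assms
  by (intro renewal_eqI[of "\<lambda>_. 0" _ n, symmetric]) (auto simp: unit_at_def)

lemma renewal_unit_at_same:
  assumes "j > 0" shows "renewal b (unit_at j) j = 1 / of_nat j"
proof -
  have "(\<Sum>k=1..j. b k * renewal b (unit_at j) (j - k)) = 0"
    using assms by (intro sum.neutral) (auto intro!: renewal_unit_at_less)
  then show ?thesis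
    using renewal_rec[of j b "unit_at j"] assms by (simp add: unit_at_def field_simps)
qed

section \<open>Power series with bounded coefficients and their differential equation\<close>

text \<open>The summand \<open>k = 0\<close> is zero because \<open>b 0 / 0 = 0\<close>.\<close>

definition lfps :: "(nat \<Rightarrow> 'a::field_char_0) \<Rightarrow> 'a fps" where
  "lfps b = Abs_fps (\<lambda>k. b k / of_nat k)"

definition lser :: "(nat \<Rightarrow> 'a::{banach,real_normed_field,field_char_0}) \<Rightarrow> 'a \<Rightarrow> 'a" where
  "lser b = eval_fps (lfps b)"

locale bounded_coeffs =
  fixes b :: "nat \<Rightarrow> 'a::{banach,real_normed_field,field_char_0}" and D :: real
  assumes norm_b: "1 \<le> k \<Longrightarrow> norm (b k) \<le> D"
begin

lemma D_nonneg: "0 \<le> D"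
  using norm_b[of 1] order.trans[OF norm_ge_zero] by simp

lemma conv_radius_lfps: "fps_conv_radius (lfps b) \<ge> 1"
  unfolding fps_conv_radius_def
proof (rule conv_radius_geI_ex')
  fix r :: real assume r: "0 < r" "ereal r < 1"
  then have "r < 1" by simp
  have "summable (\<lambda>n. D * r ^ n)"
    using r \<open>r < 1\<close> by (intro summable_mult summable_geometric) auto
  then show "summable (\<lambda>n. fps_nth (lfps b) n * of_real r ^ n)"
  proof (rule summable_comparison_test[rotated], intro exI[of _ 1] allI impI)
    fix n :: nat assume n: "n \<ge> 1"
    have "norm (b n) / real n \<le> D"
      using norm_b[OF n] n frac_le[of D "norm (b n)" 1 "real n"] D_nonneg by simp
    then show "norm (fps_nth (lfps b) n * of_real r ^ n) \<le> D * r ^ n"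
      using mult_right_mono[of "norm (b n) / real n" D "r ^ n"] r
      by (simp add: lfps_def norm_mult norm_divide norm_power)
  qed
qed

lemma in_radius: "norm z < 1 \<Longrightarrow> norm z < fps_conv_radius (lfps b)"
  using conv_radius_lfps by (metis ereal_less(3) less_le_trans)

lemma lser_sums: "norm z < 1 \<Longrightarrow> (\<lambda>k. b k / of_nat k * z ^ k) sums lser b z"
  using sums_eval_fps[OF in_radius] by (simp add: lser_def lfps_def)

lemma lser_0: "lser b 0 = 0"
  by (simp add: lser_def eval_fps_at_0 lfps_def)

lemma lser_deriv:
  assumes "norm z < 1"
  shows "(lser b has_field_derivative eval_fps (fps_deriv (lfps b)) z) (at z within A)"
  unfolding lser_def by (rule has_field_derivative_eval_fps[OF in_radius[OF assms]])

text \<open>Controls the variation of \<open>lser b\<close> between different rays, where the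
  monotonicity along a single ray says nothing.\<close>

lemma norm_lser_deriv:
  assumes "norm z < 1"
  shows "norm (eval_fps (fps_deriv (lfps b)) z) \<le> D / (1 - norm z)"
proof -
  have "norm z < fps_conv_radius (fps_deriv (lfps b))"
    using in_radius[OF assms] fps_conv_radius_deriv less_le_trans by blast
  then have s: "(\<lambda>n. b (Suc n) * z ^ n) sums eval_fps (fps_deriv (lfps b)) z"
    using sums_eval_fps[of z "fps_deriv (lfps b)"] by (simp add: lfps_def del: of_nat_Suc)
  have g: "(\<lambda>n. D * norm z ^ n) sums (D * (1 / (1 - norm z)))"
    using assms by (intro sums_mult geometric_sums) simp
  have "norm (b (Suc n) * z ^ n) \<le> D * norm z ^ n" for n
    using norm_b[of "Suc n"] by (simp add: norm_mult norm_power mult_right_mono)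
  then have "norm (\<Sum>n. b (Suc n) * z ^ n) \<le> (\<Sum>n. D * norm z ^ n)"
    using g by (intro norm_suminf_le) (auto simp: sums_iff)
  then show ?thesis using s g by (simp add: sums_iff)
qed

end

lemma lser_of_real:
  assumes "bounded_coeffs b D" "\<bar>u\<bar> < 1"
  shows "lser (\<lambda>k. of_real (b k)) (of_real u) = (of_real (lser b u) :: complex)"
proof -
  interpret bounded_coeffs b D by fact
  interpret c: bounded_coeffs "\<lambda>k. of_real (b k) :: complex" D
    by unfold_locales (use norm_b in simp)
  have "(\<lambda>k. of_real (b k / of_nat k * u ^ k)) sums (of_real (lser b u) :: complex)"
    using lser_sums[of u] assms(2) by (simp only: sums_of_real_iff real_norm_def)
  moreover have "(\<lambda>k. of_real (b k / of_nat k * u ^ k) :: complex) sums lser (\<lambda>k. of_real (b k)) (of_real u)"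
    using c.lser_sums[of "of_real u"] assms(2) by simp
  ultimately show ?thesis using sums_unique2 by metis
qed

lemma lser_const: "norm z < 1 \<Longrightarrow> lser (\<lambda>_. c) z = - c * Ln (1 - z)"
  using bounded_coeffs.lser_sums[of "\<lambda>_. c" "norm c" z] sums_mult[OF Ln_series'[of "-z"], of "-c"]
  by (simp add: bounded_coeffs_def sums_iff divide_inverse mult_ac)

lemma lser_const_real:
  assumes "\<bar>u\<bar> < (1::real)" shows "lser (\<lambda>_. c) u = - c * ln (1 - u)"
proof -
  have "bounded_coeffs (\<lambda>_. c) \<bar>c\<bar>" by unfold_locales simp
  from lser_of_real[OF this assms] have "of_real (lser (\<lambda>_. c) u) = - of_real c * Ln (1 - of_real u)"
    using lser_const[of "of_real u" "of_real c"] assms by simp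
  also have "Ln (1 - of_real u) = of_real (ln (1 - u))"
    using Ln_of_real[of "1 - u"] assms by simp
  finally have "complex_of_real (lser (\<lambda>_. c) u) = of_real (- c * ln (1 - u))" by simp
  then show ?thesis using of_real_eq_iff by blast
qed

text \<open>Comparing Taylor coefficients at 0 on both sides of the equation gives the renewal
  recursion; the factor z aligns the indices. Convergence in the whole disc comes from holomorphy,
  so no growth estimate for the coefficients is required.\<close>

lemma holomorphic_ode_sums:
  fixes b :: "nat \<Rightarrow> complex"
  assumes b: "bounded_coeffs b D"
    and hol: "Y holomorphic_on ball 0 1"
    and ode: "\<And>z. norm z < 1 \<Longrightarrow> z * deriv Y z = z * eval_fps (fps_deriv (lfps b)) z * Y z + c * z ^ j"
    and j: "j > 0"
    and z: "norm z < 1"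
  shows "(\<lambda>n. renewal b (\<lambda>n. Y 0 * unit_at 0 n + c * unit_at j n) n * z ^ n) sums Y z"
proof -
  interpret bounded_coeffs b D by fact
  define F where "F = fps_expansion Y 0"
  have F: "Y has_fps_expansion F"
    unfolding F_def by (rule has_fps_expansion_fps_expansion[OF _ _ hol]) auto
  have rad: "fps_conv_radius (fps_deriv (lfps b)) > 0"
    using conv_radius_lfps fps_conv_radius_deriv[of "lfps b"]
    by (metis ereal_less(2) less_le_trans order.trans zero_less_one one_ereal_def)
  have 1: "(\<lambda>z. z * deriv Y z) has_fps_expansion fps_X * fps_deriv F"
    by (intro fps_expansion_intros F)
  have 2: "(\<lambda>z. z * eval_fps (fps_deriv (lfps b)) z * Y z + c * z ^ j) has_fps_expansion
       fps_X * fps_deriv (lfps b) * F + fps_const c * fps_X ^ j"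
    by (intro fps_expansion_intros F eval_fps_has_fps_expansion rad)
  have "eventually (\<lambda>z. z \<in> ball (0::complex) 1) (nhds 0)"
    by (rule eventually_nhds_in_open) auto
  then have "eventually (\<lambda>z. z * deriv Y z = z * eval_fps (fps_deriv (lfps b)) z * Y z + c * z ^ j) (nhds 0)"
    by eventually_elim (use ode in auto)
  then have "fps_X * fps_deriv F = fps_X * fps_deriv (lfps b) * F + fps_const c * fps_X ^ j"
    using 1 2 has_fps_expansion_cong fps_expansion_unique_complex by metis
  then have rec: "fps_nth (fps_X * fps_deriv F) n =
      fps_nth (fps_X * fps_deriv (lfps b) * F + fps_const c * fps_X ^ j) n" for n
    by simp
  have co: "fps_nth (fps_X * fps_deriv (lfps b)) k = (if k = 0 then 0 else b k)" for k
    by (cases k) (simp_all add: lfps_def del: of_nat_Suc)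
  have "fps_nth F n = renewal b (\<lambda>n. Y 0 * unit_at 0 n + c * unit_at j n) n" for n
  proof (rule renewal_eqI[of _ _ n])
    show "fps_nth F 0 = Y 0 * unit_at 0 0 + c * unit_at j 0"
      using j by (simp add: F_def fps_expansion_def unit_at_def)
    fix m :: nat assume m: "0 < m"
    have "of_nat m * fps_nth F m = fps_nth (fps_X * fps_deriv F) m"
      using m by simp
    also have "\<dots> = (\<Sum>i=0..m. (if i = 0 then 0 else b i) * fps_nth F (m - i)) + c * unit_at j m"
      unfolding rec fps_add_nth fps_mult_nth[of "fps_X * fps_deriv (lfps b)" F] co
        fps_mult_left_const_nth fps_X_power_nth by (simp add: unit_at_def)
    also have "(\<Sum>i=0..m. (if i = 0 then 0 else b i) * fps_nth F (m - i)) =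
        (\<Sum>i=1..m. b i * fps_nth F (m - i))"
      by (rule sum.mono_neutral_cong_right) auto
    finally show "of_nat m * fps_nth F m = (\<Sum>i=1..m. b i * fps_nth F (m - i))
       + (Y 0 * unit_at 0 m + c * unit_at j m)"
      using m by (simp add: unit_at_def)
  qed simp
  moreover have "(\<lambda>n. fps_nth F n * z ^ n) sums Y z"
    using hol z by (intro has_fps_expansion_imp_sums_complex[OF F, of 1]) (auto simp: one_ereal_def)
  ultimately show ?thesis by simp
qed

section \<open>Nonnegative coefficients\<close>

text \<open>\<open>prim b j z\<close> is the integral of \<open>u\<^sup>j\<^sup>-\<^sup>1 exp (- lser b u)\<close> from \<open>0\<close> to \<open>z\<close>, meaningful for \<open>norm z < 1\<close>.\<close>

definition prim :: "(nat \<Rightarrow> complex) \<Rightarrow> nat \<Rightarrow> complex \<Rightarrow> complex" where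
  "prim b j = (SOME g. g 0 = 0 \<and>
     (\<forall>z\<in>ball 0 1. (g has_field_derivative z ^ (j - 1) * exp (- lser b z)) (at z)))"

lemma prim_spec:
  assumes "bounded_coeffs b D"
  shows "prim b j 0 = 0"
    and "norm z < 1 \<Longrightarrow> (prim b j has_field_derivative z ^ (j - 1) * exp (- lser b z)) (at z)"
proof -
  interpret bounded_coeffs b D by fact
  have "lser b holomorphic_on ball 0 1"
    unfolding holomorphic_on_def
  proof
    fix z :: complex assume "z \<in> ball 0 1"
    then have "norm z < 1" by simp
    from lser_deriv[OF this] show "lser b field_differentiable at z within ball 0 1"
      using field_differentiable_def by blast
  qed
  then have hol: "(\<lambda>z. z ^ (j - 1) * exp (- lser b z)) holomorphic_on ball 0 1"
    by (intro holomorphic_intros)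
  obtain g where g: "\<And>z. z \<in> ball 0 1 \<Longrightarrow>
      (g has_field_derivative z ^ (j - 1) * exp (- lser b z)) (at z within ball 0 1)"
    by (rule holomorphic_convex_primitive'[OF convex_ball open_ball hol]) blast
  then have "(g has_field_derivative z ^ (j - 1) * exp (- lser b z)) (at z)" if "z \<in> ball 0 1" for z
    using g[OF that] by (simp only: at_within_open[OF that open_ball])
  then have "((\<lambda>z. g z - g 0) has_field_derivative z ^ (j - 1) * exp (- lser b z)) (at z)"
    if "z \<in> ball 0 1" for z
    using DERIV_diff[OF _ DERIV_const, of g _ z UNIV "g 0"] that by simp
  then have "\<exists>g. g 0 = 0 \<and>
     (\<forall>z\<in>ball 0 1. (g has_field_derivative z ^ (j - 1) * exp (- lser b z)) (at z))"
    by (intro exI[of _ "\<lambda>z. g z - g 0"]) simp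
  from someI_ex[OF this]
  show "prim b j 0 = 0"
    and "norm z < 1 \<Longrightarrow> (prim b j has_field_derivative z ^ (j - 1) * exp (- lser b z)) (at z)"
    unfolding prim_def[symmetric] by auto
qed

lemma prim_ray_deriv:
  assumes "bounded_coeffs b D" "\<bar>s\<bar> < 1" "norm \<omega> = 1"
  shows "((\<lambda>s. prim b j (of_real s * \<omega>)) has_vector_derivative
     \<omega> * ((of_real s * \<omega>) ^ (j - 1) * exp (- lser b (of_real s * \<omega>)))) (at s within A)"
proof -
  have "((\<lambda>s. of_real s * \<omega>) has_vector_derivative \<omega>) (at s within A)"
    by (auto intro!: derivative_eq_intros)
  moreover have "(prim b j has_field_derivative
      (of_real s * \<omega>) ^ (j - 1) * exp (- lser b (of_real s * \<omega>))) (at (of_real s * \<omega>))"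
    by (rule prim_spec(2)[OF assms(1)]) (use assms in \<open>simp add: norm_mult\<close>)
  then have "(prim b j has_field_derivative
      (of_real s * \<omega>) ^ (j - 1) * exp (- lser b (of_real s * \<omega>)))
      (at (of_real s * \<omega>) within (\<lambda>s. of_real s * \<omega>) ` A)"
    by (rule has_field_derivative_at_within)
  ultimately show ?thesis
    using field_vector_diff_chain_within[of "\<lambda>s. of_real s * \<omega>" \<omega> s A "prim b j"
      "(of_real s * \<omega>) ^ (j - 1) * exp (- lser b (of_real s * \<omega>))"]
    unfolding o_def by blast
qed

lemma norm_prim_ray_deriv:
  assumes "norm \<omega> = 1" "0 \<le> s"
  shows "norm (\<omega> * ((of_real s * \<omega>) ^ (j - 1) * exp (- lser b (of_real s * \<omega>))))
    = s ^ (j - 1) * exp (- Re (lser b (of_real s * \<omega>)))"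
  using assms by (simp add: norm_mult norm_power)

lemma prim_ray_continuous:
  assumes "bounded_coeffs b D" "A \<subseteq> {-1<..<1}" "norm \<omega> = 1"
  shows "continuous_on A (\<lambda>s. prim b j (of_real s * \<omega>))"
proof (rule continuous_on_vector_derivative)
  fix s assume "s \<in> A"
  then have "s \<in> {-1<..<1}" using assms(2) by blast
  then have "\<bar>s\<bar> < 1" by (simp add: abs_less_iff)
  then show "((\<lambda>s. prim b j (of_real s * \<omega>)) has_vector_derivative
     \<omega> * ((of_real s * \<omega>) ^ (j - 1) * exp (- lser b (of_real s * \<omega>)))) (at s within A)"
    by (rule prim_ray_deriv[OF assms(1) _ assms(3)])
qed

text \<open>The bound is integrated explicitly. It involves \<open>sqrt s\<close> because one half
  of s^(j-1) is spent in \<open>moment_bound\<close> on a polynomial factor, and the other half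
  still yields the gain 1/j.\<close>

lemma norm_diff_le_sqrt_power:
  fixes f :: "real \<Rightarrow> 'a::real_normed_vector"
  assumes v: "0 \<le> v" "v \<le> 1" and j: "1 \<le> j" and A: "0 \<le> A"
    and cont: "continuous_on {0..v} f"
    and deriv: "\<And>s. 0 < s \<Longrightarrow> s < v \<Longrightarrow> (f has_vector_derivative f' s) (at s)"
    and bound: "\<And>s. 0 < s \<Longrightarrow> s < v \<Longrightarrow> norm (f' s) \<le> A * sqrt s ^ (j - 1)"
  shows "norm (f v - f 0) \<le> 2 * A / j"
proof (cases "v = 0")
  case False
  let ?G = "\<lambda>s. A * (2 / (real j + 1)) * sqrt s ^ (j + 1)"
  have "norm (f v - f 0) \<le> ?G v - ?G 0"
  proof (rule differentiable_bound_general[OF _ cont _ deriv])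
    show "0 < v" using v False by simp
    show "continuous_on {0..v} ?G" by (intro continuous_intros)
    fix s :: real assume s: "0 < s" "s < v"
    have "(?G has_real_derivative A * sqrt s ^ (j - 1)) (at s)"
    proof -
      have "((\<lambda>s. sqrt s ^ (j + 1)) has_real_derivative
          real (j + 1) * (inverse (sqrt s) / 2 * sqrt s ^ (j + 1 - Suc 0))) (at s)"
        by (intro DERIV_power DERIV_real_sqrt s)
      then have "(?G has_real_derivative A * (2 / (real j + 1)) *
          (real (j + 1) * (inverse (sqrt s) / 2 * sqrt s ^ (j + 1 - Suc 0)))) (at s)"
        by (rule DERIV_cmult)
      also have "sqrt s ^ (j + 1 - Suc 0) = sqrt s * sqrt s ^ (j - 1)"
        using j by (simp add: power_eq_if)
      also have "A * (2 / (real j + 1)) * (real (j + 1) * (inverse (sqrt s) / 2 *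
          (sqrt s * sqrt s ^ (j - 1)))) = A * sqrt s ^ (j - 1)"
        using s by (simp add: divide_simps)
      finally show ?thesis .
    qed
    then show "(?G has_vector_derivative A * sqrt s ^ (j - 1)) (at s)"
      by (simp add: has_real_derivative_iff_has_vector_derivative)
  qed (use bound in auto)
  also have "\<dots> \<le> A * (2 / (real j + 1))"
  proof -
    have "sqrt v ^ (j + 1) \<le> 1" using v by (intro power_le_one) auto
    then have "A * (2 / (real j + 1)) * sqrt v ^ (j + 1) \<le> A * (2 / (real j + 1))"
      using A by (intro mult_left_le) auto
    then show ?thesis by simp
  qed
  also have "\<dots> \<le> A * (2 / real j)"
    using A j by (intro mult_left_mono divide_left_mono) auto
  finally show ?thesis by (simp add: mult.commute)
qed (use A in simp)

text \<open>The maximum of (1 + y)^q exp((1 - y)/2) is (2q)^q exp(1 - q), attained at 1 + y = 2q;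
  the factor exp(- q) is dropped.\<close>

definition moment_const :: "real \<Rightarrow> real" where
  "moment_const q = exp (1 + q * ln (2 * q))"

text \<open>Split s^(j-1) into two equal halves. With y = j (1 - s), one half is at most exp((1 -
  y)/2), which beats any power of 1 + y; the other is kept for integration.\<close>

lemma moment_bound:
  assumes q: "0 < q" and s: "0 \<le> s" "s \<le> 1" and j: "1 \<le> j"
  shows "(1 + real j * (1 - s)) powr q * s ^ (j - 1) \<le> moment_const q * sqrt s ^ (j - 1)"
proof -
  define y where "y = real j * (1 - s)"
  have y: "0 \<le> y" using s by (simp add: y_def)
  have "sqrt s \<le> exp (- (1 - s) / 2)"
  proof -
    have "s \<le> exp (- (1 - s))" using exp_ge_add_one_self[of "- (1 - s)"] by simp
    also have "\<dots> = (exp (- (1 - s) / 2))\<^sup>2" by (simp add: exp_double[symmetric])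
    finally show ?thesis by (intro real_le_lsqrt) (use s in auto)
  qed
  then have "sqrt s ^ (j - 1) \<le> exp (- (1 - s) / 2) ^ (j - 1)"
    using s by (intro power_mono) auto
  also have "\<dots> = exp (- (real j - 1) * (1 - s) / 2)"
    using j by (simp add: exp_of_nat_mult[symmetric] of_nat_diff algebra_simps)
  also have "\<dots> \<le> exp ((1 - y) / 2)"
    using s by (simp add: y_def field_simps)
  finally have 1: "sqrt s ^ (j - 1) \<le> exp ((1 - y) / 2)" .
  \<comment> \<open>The scaling by 2q makes the linear term cancel y/2 exactly after multiplication
    by q.\<close>
  have "ln ((1 + y) / (2 * q)) \<le> (1 + y) / (2 * q) - 1"
    using q y by (intro ln_le_minus_one) auto
  then have "q * ln (1 + y) \<le> q * ((1 + y) / (2 * q) - 1 + ln (2 * q))"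
    using q y by (intro mult_left_mono) (auto simp: ln_div)
  also have "\<dots> = (1 + y) / 2 - q + q * ln (2 * q)"
    using q by (simp add: field_simps)
  finally have "q * ln (1 + y) + (1 - y) / 2 \<le> 1 + q * ln (2 * q)"
    using q by (simp add: field_simps)
  then have "exp (q * ln (1 + y)) * exp ((1 - y) / 2) \<le> moment_const q"
    unfolding moment_const_def exp_add[symmetric] by simp
  then have 2: "(1 + y) powr q * exp ((1 - y) / 2) \<le> moment_const q"
    using y by (simp add: powr_def)
  have "(1 + y) powr q * s ^ (j - 1) = (1 + y) powr q * sqrt s ^ (j - 1) * sqrt s ^ (j - 1)"
    using s by (simp add: power_mult_distrib[symmetric])
  also have "\<dots> \<le> (1 + y) powr q * exp ((1 - y) / 2) * sqrt s ^ (j - 1)"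
    using 1 s by (intro mult_right_mono mult_left_mono) auto
  also have "\<dots> \<le> moment_const q * sqrt s ^ (j - 1)"
    using 2 s by (intro mult_right_mono) auto
  finally show ?thesis by (simp add: y_def)
qed

text \<open>The radius belonging to index n: up to constants, the \<open>gf\<close> defined below
  takes at \<open>cutoff n\<close> the size of the sum of its first n coefficients, see
  \<open>sum_renewal_0_le\<close> and \<open>gf_le_sum_renewal\<close>.\<close>

abbreviation cutoff :: "nat \<Rightarrow> real" where
  "cutoff n \<equiv> 1 - 1 / real n"

text \<open>Interpreted twice in the locale \<open>weights\<close>: for the full coefficients, where
  \<open>gf\<close> is P, and for the excess over \<delta>, where \<open>gf\<close> is W.\<close>

locale nonneg_coeffs =
  fixes b :: "nat \<Rightarrow> real" and D :: real
  assumes b_bounds: "1 \<le> k \<Longrightarrow> 0 \<le> b k" "1 \<le> k \<Longrightarrow> b k \<le> D" and D_ge_1: "1 \<le> D"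
begin

abbreviation cb :: "nat \<Rightarrow> complex" where "cb \<equiv> \<lambda>k. of_real (b k)"

sublocale bounded_coeffs b D
  by unfold_locales (use b_bounds in auto)

sublocale c: bounded_coeffs cb D
  by unfold_locales (use b_bounds in auto)

definition gf :: "real \<Rightarrow> real" where
  "gf u = exp (lser b u)"

lemma gf_pos: "gf u > 0"
  by (simp add: gf_def)

lemma gf_0: "gf 0 = 1"
  by (simp add: gf_def lser_0)

lemma lser_cb_of_real: "\<bar>u\<bar> < 1 \<Longrightarrow> lser cb (of_real u) = of_real (lser b u)"
  by (rule lser_of_real[OF bounded_coeffs_axioms])

lemma lser_diff_mono:
  assumes "0 \<le> u" "u \<le> v" "v < 1"
  shows "lser b u \<le> lser b v"
    and "lser b v - lser b u \<le> D * (ln (1 - u) - ln (1 - v))"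
proof -
  have s: "(\<lambda>k. b k / of_nat k * v ^ k - b k / of_nat k * u ^ k) sums (lser b v - lser b u)"
    using assms by (intro sums_diff lser_sums) auto
  interpret k: bounded_coeffs "\<lambda>_. D" D
    by unfold_locales (use D_nonneg in auto)
  have t: "(\<lambda>k. D / of_nat k * v ^ k - D / of_nat k * u ^ k) sums
      (lser (\<lambda>_. D) v - lser (\<lambda>_. D) u)"
    using assms by (intro sums_diff k.lser_sums) auto
  have pw: "u ^ k \<le> v ^ k" for k
    using assms by (simp add: power_mono)
  have "0 \<le> b k / of_nat k * v ^ k - b k / of_nat k * u ^ k" for k
  proof (cases "k = 0")
    case False
    then have "0 \<le> b k / of_nat k" using b_bounds(1)[of k] by simp
    from mult_left_mono[OF pw this] show ?thesis by simp
  qed simp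
  from sums_le[OF this sums_zero s] show "lser b u \<le> lser b v" by simp
  have "b k / of_nat k * v ^ k - b k / of_nat k * u ^ k \<le>
     D / of_nat k * v ^ k - D / of_nat k * u ^ k" for k
  proof (cases "k = 0")
    case False
    then have "b k / of_nat k \<le> D / of_nat k"
      using b_bounds(2)[of k] by (intro divide_right_mono) auto
    moreover have "0 \<le> v ^ k - u ^ k" using pw[of k] by simp
    ultimately have "b k / of_nat k * (v ^ k - u ^ k) \<le> D / of_nat k * (v ^ k - u ^ k)"
      by (rule mult_right_mono)
    then show ?thesis by (simp only: right_diff_distrib)
  qed simp
  from sums_le[OF this s t]
  have le: "lser b v - lser b u \<le> lser (\<lambda>_. D) v - lser (\<lambda>_. D) u" .
  have "lser (\<lambda>_. D) v = - D * ln (1 - v)" "lser (\<lambda>_. D) u = - D * ln (1 - u)"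
    using assms by (intro lser_const_real; simp)+
  with le show "lser b v - lser b u \<le> D * (ln (1 - u) - ln (1 - v))"
    by (simp add: right_diff_distrib)
qed

lemma gf_mono: "0 \<le> u \<Longrightarrow> u \<le> v \<Longrightarrow> v < 1 \<Longrightarrow> gf u \<le> gf v"
  using lser_diff_mono(1) by (simp add: gf_def)

text \<open>Termwise comparison with the constant coefficient D, whose series is a logarithm. Growth
  is therefore polynomial in 1/(1 - u), and changing the radius within a bounded factor of 1 - u
  costs only a constant.\<close>

lemma gf_growth:
  assumes "0 \<le> u" "u \<le> v" "v < 1"
  shows "gf v \<le> ((1 - u) / (1 - v)) powr D * gf u"
proof -
  have "gf v = exp (lser b v - lser b u) * gf u"
    by (simp add: gf_def exp_diff)
  also have "\<dots> \<le> exp (D * (ln (1 - u) - ln (1 - v))) * gf u"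
    using lser_diff_mono(2)[OF assms] gf_pos[of u] by (intro mult_right_mono) auto
  also have "exp (D * (ln (1 - u) - ln (1 - v))) = ((1 - u) / (1 - v)) powr D"
    using assms by (simp add: powr_def ln_div)
  finally show ?thesis .
qed

text \<open>Termwise: the increment of s^k along the ray has a nonnegative coefficient, and Re
  (\<omega>^k) \<le> 1.\<close>

lemma Re_lser_ray:
  assumes "0 \<le> s" "s \<le> r" "r < 1" "norm \<omega> = 1"
  shows "Re (lser cb (of_real r * \<omega>)) - Re (lser cb (of_real s * \<omega>)) \<le> lser b r - lser b s"
proof -
  have 1: "(\<lambda>k. b k / of_nat k * r ^ k - b k / of_nat k * s ^ k) sums (lser b r - lser b s)"
    using assms by (intro sums_diff lser_sums) auto
  have "(\<lambda>k. cb k / of_nat k * (of_real r * \<omega>) ^ k - cb k / of_nat k * (of_real s * \<omega>) ^ k) sums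
     (lser cb (of_real r * \<omega>) - lser cb (of_real s * \<omega>))"
    using assms by (intro sums_diff c.lser_sums) (auto simp: norm_mult)
  from sums_Re[OF this]
  have 2: "(\<lambda>k. Re (cb k / of_nat k * (of_real r * \<omega>) ^ k - cb k / of_nat k * (of_real s * \<omega>) ^ k)) sums
     (Re (lser cb (of_real r * \<omega>)) - Re (lser cb (of_real s * \<omega>)))"
    by simp
  have le: "Re (cb k / of_nat k * (of_real r * \<omega>) ^ k - cb k / of_nat k * (of_real s * \<omega>) ^ k)
      \<le> b k / of_nat k * r ^ k - b k / of_nat k * s ^ k" for k
  proof (cases "k = 0")
    case False
    have "cb k / of_nat k * (of_real r * \<omega>) ^ k - cb k / of_nat k * (of_real s * \<omega>) ^ k =
       of_real (b k / of_nat k * (r ^ k - s ^ k)) * \<omega> ^ k"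
      by (simp add: power_mult_distrib algebra_simps)
    then have "Re (cb k / of_nat k * (of_real r * \<omega>) ^ k - cb k / of_nat k * (of_real s * \<omega>) ^ k)
       = b k / of_nat k * (r ^ k - s ^ k) * Re (\<omega> ^ k)"
      by simp
    also have "\<dots> \<le> b k / of_nat k * (r ^ k - s ^ k) * 1"
    proof (rule mult_left_mono)
      show "Re (\<omega> ^ k) \<le> 1"
        using complex_Re_le_cmod[of "\<omega> ^ k"] assms(4) by (simp add: norm_power)
      show "0 \<le> b k / of_nat k * (r ^ k - s ^ k)"
        using False b_bounds(1)[of k] assms by (intro mult_nonneg_nonneg) (auto simp: power_mono)
    qed
    finally show ?thesis by (simp add: right_diff_distrib)
  qed simp
  show ?thesis by (rule sums_le[OF le 2 1])
qed

lemma norm_exp_lser_ray: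
  assumes "0 \<le> s" "s \<le> r" "r < 1" "norm \<omega> = 1"
  shows "norm (exp (lser cb (of_real r * \<omega>))) * exp (- Re (lser cb (of_real s * \<omega>))) \<le> gf r / gf s"
  using Re_lser_ray[OF assms] by (simp add: gf_def exp_add[symmetric] exp_diff[symmetric])

text \<open>Above \<open>cutoff j\<close> this is monotonicity; below it, \<open>gf_growth\<close>
  loses a power of j (1 - s), which the moment estimates absorb.\<close>

lemma inverse_gf_le:
  assumes "0 \<le> s" "s < 1" "1 \<le> j"
  shows "1 / gf s \<le> (1 + real j * (1 - s)) powr D / gf (cutoff j)"
proof (cases "cutoff j \<le> s")
  case True
  then have "gf (cutoff j) \<le> gf s" using assms by (intro gf_mono) auto
  moreover have "1 \<le> (1 + real j * (1 - s)) powr D"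
    using assms D_nonneg by (intro ge_one_powr_ge_zero) auto
  ultimately show ?thesis
    using gf_pos by (intro frac_le) auto
next
  case False
  then have "gf (cutoff j) \<le> ((1 - s) / (1 - cutoff j)) powr D * gf s"
    using assms by (intro gf_growth) auto
  also have "(1 - s) / (1 - cutoff j) = real j * (1 - s)"
    using assms by simp
  also have "(real j * (1 - s)) powr D \<le> (1 + real j * (1 - s)) powr D"
    using assms D_nonneg by (intro powr_mono2) auto
  finally show ?thesis
    using gf_pos[of s] gf_pos[of "cutoff j"] by (simp add: field_simps)
qed

text \<open>The exponent 2 D collects D from the weight in \<open>weighted_moment\<close> and D from
  \<open>inverse_gf_le\<close>.\<close>

definition K :: real where "K = moment_const (2 * D)"

lemma K_pos: "K > 0" by (simp add: K_def moment_const_def)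

text \<open>The weight leaves room for the factor that comes from (1 - z)^\<delta> along a ray in
  \<open>V_bound_far\<close>.\<close>

lemma weighted_moment:
  assumes "0 \<le> s" "s < 1" "1 \<le> j"
  shows "(1 + real j * (1 - s)) powr D * s ^ (j - 1) / gf s \<le> K / gf (cutoff j) * sqrt s ^ (j - 1)"
proof -
  let ?y = "1 + real j * (1 - s)"
  have "?y powr D * s ^ (j - 1) * (1 / gf s) \<le> ?y powr D * s ^ (j - 1) * (?y powr D / gf (cutoff j))"
    using assms by (intro mult_left_mono inverse_gf_le) auto
  also have "\<dots> = ?y powr (2 * D) * s ^ (j - 1) / gf (cutoff j)"
    unfolding mult_2 powr_add by simp
  also have "\<dots> \<le> K * sqrt s ^ (j - 1) / gf (cutoff j)"
    unfolding K_def using assms D_ge_1 gf_pos[of "cutoff j"]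
    by (intro divide_right_mono moment_bound) auto
  finally show ?thesis by simp
qed

lemma moment_gf:
  assumes "0 \<le> s" "s < 1" "1 \<le> j"
  shows "s ^ (j - 1) / gf s \<le> K / gf (cutoff j) * sqrt s ^ (j - 1)"
proof -
  have "1 \<le> (1 + real j * (1 - s)) powr D"
    using assms D_nonneg by (intro ge_one_powr_ge_zero) auto
  then have "1 * (s ^ (j - 1) / gf s) \<le> (1 + real j * (1 - s)) powr D * (s ^ (j - 1) / gf s)"
    using assms gf_pos[of s] by (intro mult_right_mono) auto
  with weighted_moment[OF assms] show ?thesis by simp
qed

text \<open>The power u^(j-1) concentrates where 1 - u is of order 1/j, so the integral is about 1/j
  times the integrand's factor \<open>1 / gf\<close> at \<open>cutoff j\<close>, uniformly in the
  upper limit.\<close>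

lemma norm_prim_real_le:
  assumes "0 \<le> x" "x < 1" "1 \<le> j"
  shows "norm (prim cb j (of_real x)) \<le> 2 * K / (real j * gf (cutoff j))"
proof -
  let ?f = "\<lambda>s. prim cb j (of_real s * 1)"
  have "norm (?f x - ?f 0) \<le> 2 * (K / gf (cutoff j)) / j"
  proof (rule norm_diff_le_sqrt_power[where
        f' = "\<lambda>s. 1 * ((of_real s * 1) ^ (j - 1) * exp (- lser cb (of_real s * 1)))"])
    show "continuous_on {0..x} ?f"
      using assms by (intro prim_ray_continuous[OF c.bounded_coeffs_axioms]) auto
    fix s assume s: "0 < s" "s < x"
    show "(?f has_vector_derivative 1 * ((of_real s * 1) ^ (j - 1) * exp (- lser cb (of_real s * 1)))) (at s)"
      using s assms by (intro prim_ray_deriv[OF c.bounded_coeffs_axioms]) auto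
    have "norm (1 * ((of_real s * 1) ^ (j - 1) * exp (- lser cb (of_real s * 1)))) = s ^ (j - 1) / gf s"
      using norm_prim_ray_deriv[of 1 s j cb] s assms
      by (simp add: lser_cb_of_real gf_def exp_minus divide_inverse)
    also have "\<dots> \<le> K / gf (cutoff j) * sqrt s ^ (j - 1)"
      using s assms by (intro moment_gf) auto
    finally show "norm (1 * ((of_real s * 1) ^ (j - 1) * exp (- lser cb (of_real s * 1))) :: complex)
        \<le> K / gf (cutoff j) * sqrt s ^ (j - 1)" .
  qed (use assms K_pos gf_pos[of "cutoff j"] in auto)
  then show ?thesis
    using prim_spec(1)[OF c.bounded_coeffs_axioms] by (simp add: mult.commute)
qed

section \<open>Unit solutions: generating functions, partial sums, pointwise bounds\<close>

abbreviation rn :: "nat \<Rightarrow> nat \<Rightarrow> real" where "rn j \<equiv> renewal b (unit_at j)"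

text \<open>Variation of constants. One formula serves all uses: T = 1, c = 0 for P, T = 0, c = 1
  for a single source, and c = -1 with T the truncated integral for V.\<close>

lemma exp_lser_ode_sums:
  assumes j: "1 \<le> j" and z: "norm z < 1"
  shows "(\<lambda>n. renewal cb (\<lambda>n. T * unit_at 0 n + c * unit_at j n) n * z ^ n) sums
    (exp (lser cb z) * (T + c * prim cb j z))"
proof -
  let ?Y = "\<lambda>z. exp (lser cb z) * (T + c * prim cb j z)"
  let ?\<alpha> = "\<lambda>z. eval_fps (fps_deriv (lfps cb)) z"
  have d: "(?Y has_field_derivative ?\<alpha> z * ?Y z + c * z ^ (j - 1)) (at z)" if "norm z < 1" for z
  proof -
    have "(?Y has_field_derivative exp (lser cb z) * ?\<alpha> z * (T + c * prim cb j z) +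
        (0 + c * (z ^ (j - 1) * exp (- lser cb z))) * exp (lser cb z)) (at z)"
      by (intro DERIV_mult DERIV_add DERIV_const DERIV_cmult DERIV_chain2[OF DERIV_exp]
          c.lser_deriv that prim_spec(2)[OF c.bounded_coeffs_axioms])
    also have "exp (lser cb z) * ?\<alpha> z * (T + c * prim cb j z) +
        (0 + c * (z ^ (j - 1) * exp (- lser cb z))) * exp (lser cb z) = ?\<alpha> z * ?Y z + c * z ^ (j - 1)"
      by (simp add: exp_minus)
    finally show ?thesis .
  qed
  have "?Y holomorphic_on ball 0 1"
    unfolding holomorphic_on_open[OF open_ball] using d by (intro ballI exI) simp
  moreover have "z * deriv ?Y z = z * ?\<alpha> z * ?Y z + c * z ^ j" if "norm z < 1" for z
  proof -
    have "z * deriv ?Y z = z * (?\<alpha> z * ?Y z + c * z ^ (j - 1))"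
      using DERIV_imp_deriv[OF d[OF that]] by simp
    also have "\<dots> = z * ?\<alpha> z * ?Y z + c * (z * z ^ (j - 1))"
      by (simp add: ring_distribs)
    also have "z * z ^ (j - 1) = z ^ j"
      using j by (cases j) auto
    finally show ?thesis .
  qed
  ultimately have "(\<lambda>n. renewal cb (\<lambda>n. ?Y 0 * unit_at 0 n + c * unit_at j n) n * z ^ n) sums ?Y z"
    using j z by (intro holomorphic_ode_sums[OF c.bounded_coeffs_axioms]) auto
  moreover have "?Y 0 = T"
    by (simp add: c.lser_0 prim_spec(1)[OF c.bounded_coeffs_axioms])
  ultimately show ?thesis by simp
qed

lemma renewal_cb: "renewal cb (unit_at j) n = of_real (rn j n)"
  unfolding renewal_of_real[symmetric] by (rule renewal_cong) (auto simp: unit_at_def)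

lemma renewal_unit_nonneg: "0 \<le> rn j n"
  by (rule renewal_nonneg) (use b_bounds in \<open>auto simp: unit_at_def\<close>)

lemma gf_sums:
  assumes "\<bar>u\<bar> < 1"
  shows "(\<lambda>n. rn 0 n * u ^ n) sums gf u"
proof -
  have "(\<lambda>n. renewal cb (unit_at 0) n * of_real u ^ n) sums exp (lser cb (of_real u))"
    using exp_lser_ode_sums[of 1 "of_real u" 1 0] assms by simp
  then have "(\<lambda>n. of_real (rn 0 n * u ^ n)) sums (of_real (gf u) :: complex)"
    using assms by (simp add: renewal_cb lser_cb_of_real gf_def exp_of_real)
  then show ?thesis by (simp only: sums_of_real_iff)
qed

lemma renewal_unit_sums:
  assumes "0 \<le> u" "u < 1" "1 \<le> j"
  shows "summable (\<lambda>n. rn j n * u ^ n)"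
    and "(\<Sum>n. rn j n * u ^ n) \<le> gf u * (2 * K / (real j * gf (cutoff j)))"
proof -
  let ?S = "exp (lser cb (of_real u)) * prim cb j (of_real u)"
  have "(\<lambda>n. renewal cb (unit_at j) n * of_real u ^ n) sums ?S"
    using exp_lser_ode_sums[of j "of_real u" 0 1] assms by simp
  from sums_Re[OF this] have *: "(\<lambda>n. rn j n * u ^ n) sums Re ?S"
    by (simp add: renewal_cb flip: of_real_power of_real_mult)
  then show "summable (\<lambda>n. rn j n * u ^ n)" by (rule sums_summable)
  have "Re ?S \<le> norm ?S" by (rule complex_Re_le_cmod)
  also have "\<dots> \<le> gf u * (2 * K / (real j * gf (cutoff j)))"
    unfolding norm_mult using assms norm_prim_real_le[OF assms] gf_pos[of u]
    by (intro mult_mono) (auto simp: lser_cb_of_real gf_def exp_of_real)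
  finally show "(\<Sum>n. rn j n * u ^ n) \<le> gf u * (2 * K / (real j * gf (cutoff j)))"
    using * by (simp add: sums_iff)
qed

text \<open>At 1 - 1/(2n), Bernoulli's inequality keeps all powers up to n above 1/2. At
  \<open>cutoff n\<close> itself this fails for n = 1, where the radius is 0.\<close>

lemma partial_sum_le:
  assumes v: "\<And>m. 0 \<le> v m" and n: "1 \<le> n"
    and summ: "summable (\<lambda>m. v m * (1 - 1 / (2 * real n)) ^ m)"
  shows "(\<Sum>m\<le>n. v m) \<le> 2 * (\<Sum>m. v m * (1 - 1 / (2 * real n)) ^ m)"
proof -
  let ?r = "1 - 1 / (2 * real n)"
  have r: "0 \<le> ?r" "?r \<le> 1" using n by (auto simp: field_simps)
  have "1 / 2 \<le> ?r ^ n"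
    using Bernoulli_inequality[of "- 1 / (2 * real n)" n] n by (simp add: field_simps)
  then have half: "1 / 2 \<le> ?r ^ m" if "m \<le> n" for m
    using power_decreasing[OF that r] by linarith
  have "(\<Sum>m\<le>n. v m * (1 / 2)) \<le> (\<Sum>m\<le>n. v m * ?r ^ m)"
    using half v by (intro sum_mono mult_left_mono) auto
  also have "\<dots> \<le> (\<Sum>m. v m * ?r ^ m)"
    using summ v r by (intro sum_le_suminf) auto
  finally show ?thesis by (simp flip: sum_divide_distrib)
qed

lemma gf_double:
  assumes "1 \<le> n"
  shows "gf (1 - 1 / (2 * real n)) \<le> 2 powr D * gf (cutoff n)"
proof -
  have "gf (1 - 1 / (2 * real n)) \<le> ((1 - cutoff n) / (1 - (1 - 1 / (2 * real n)))) powr D * gf (cutoff n)"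
    using assms by (intro gf_growth) (auto simp: field_simps)
  also have "(1 - cutoff n) / (1 - (1 - 1 / (2 * real n))) = 2"
    using assms by simp
  finally show ?thesis .
qed

lemma sum_renewal_0_le:
  assumes "1 \<le> n"
  shows "(\<Sum>m\<le>n. rn 0 m) \<le> 2 * 2 powr D * gf (cutoff n)"
proof -
  let ?r = "1 - 1 / (2 * real n)"
  have r: "0 \<le> ?r" "?r < 1" using assms by (auto simp: field_simps)
  then have s: "(\<lambda>m. rn 0 m * ?r ^ m) sums gf ?r" by (intro gf_sums) simp
  have "(\<Sum>m\<le>n. rn 0 m) \<le> 2 * gf ?r"
    using partial_sum_le[OF renewal_unit_nonneg assms sums_summable[OF s]] s by (simp add: sums_iff)
  with gf_double[OF assms] show ?thesis by simp
qed

lemma sum_renewal_le: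
  assumes "1 \<le> n" "1 \<le> j"
  shows "(\<Sum>m\<le>n. rn j m) \<le> 4 * K * 2 powr D * gf (cutoff n) / (real j * gf (cutoff j))"
proof -
  let ?r = "1 - 1 / (2 * real n)"
  have r: "0 \<le> ?r" "?r < 1" using assms by (auto simp: field_simps)
  have "(\<Sum>m\<le>n. rn j m) \<le> 2 * (\<Sum>m. rn j m * ?r ^ m)"
    by (rule partial_sum_le[OF renewal_unit_nonneg assms(1) renewal_unit_sums(1)[OF r assms(2)]])
  also have "\<dots> \<le> 2 * (gf ?r * (2 * K / (real j * gf (cutoff j))))"
    using renewal_unit_sums(2)[OF r assms(2)] by simp
  also have "\<dots> \<le> 2 * ((2 powr D * gf (cutoff n)) * (2 * K / (real j * gf (cutoff j))))"
    using gf_double[OF assms(1)] K_pos gf_pos[of "cutoff j"]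
    by (intro mult_left_mono mult_right_mono) auto
  finally show ?thesis by (simp add: mult_ac)
qed

text \<open>Replacing the coefficients by D turns the recursion into an average over earlier values,
  so bounds for partial sums become pointwise bounds. For j < n the source contributes nothing at
  n.\<close>

lemma renewal_unit_le_sum:
  assumes "j < n"
  shows "real n * rn j n \<le> D * (\<Sum>m<n. rn j m)"
proof -
  have "real n * rn j n = (\<Sum>k=1..n. b k * rn j (n - k))"
    using renewal_rec[of n b "unit_at j"] assms by (simp add: unit_at_def)
  also have "\<dots> \<le> (\<Sum>k=1..n. D * rn j (n - k))"
    using b_bounds renewal_unit_nonneg by (intro sum_mono mult_right_mono) auto
  also have "\<dots> = D * (\<Sum>m<n. rn j m)"
    unfolding sum_distrib_left[symmetric]
    by (intro arg_cong2[of _ _ _ _ "(*)"] refl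
        sum.reindex_bij_witness[of _ "\<lambda>m. n - m" "\<lambda>k. n - k"]) auto
  finally show ?thesis .
qed

lemma renewal_0_le:
  assumes "1 \<le> n"
  shows "real n * rn 0 n \<le> 2 * D * 2 powr D * gf (cutoff n)"
proof -
  have "real n * rn 0 n \<le> D * (\<Sum>m<n. rn 0 m)"
    using assms by (intro renewal_unit_le_sum) simp
  also have "\<dots> \<le> D * (\<Sum>m\<le>n. rn 0 m)"
    using D_nonneg renewal_unit_nonneg by (intro mult_left_mono sum_mono2) auto
  also have "\<dots> \<le> D * (2 * 2 powr D * gf (cutoff n))"
    using D_nonneg by (intro mult_left_mono sum_renewal_0_le assms)
  finally show ?thesis by (simp add: mult_ac)
qed

lemma renewal_unit_le:
  assumes "1 \<le> j" "j < n"
  shows "real n * rn j n \<le> 4 * D * K * 2 powr D * gf (cutoff n) / (real j * gf (cutoff j))"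
proof -
  have "real n * rn j n \<le> D * (\<Sum>m<n. rn j m)"
    using assms by (intro renewal_unit_le_sum) simp
  also have "\<dots> \<le> D * (\<Sum>m\<le>n. rn j m)"
    using D_nonneg renewal_unit_nonneg by (intro mult_left_mono sum_mono2) auto
  also have "\<dots> \<le> D * (4 * K * 2 powr D * gf (cutoff n) / (real j * gf (cutoff j)))"
    using D_nonneg assms by (intro mult_left_mono sum_renewal_le) auto
  finally show ?thesis by (simp add: mult_ac)
qed

text \<open>Passing from \<open>u\<close> to \<open>sqrt u\<close> gains the factor \<open>sqrt u ^ M\<close> in the tail and costs only \<open>2 powr D\<close>.\<close>

lemma gf_tail:
  assumes "0 \<le> u" "u < 1"
  shows "summable (\<lambda>m. rn 0 (m + M) * u ^ (m + M))"
    and "(\<Sum>m. rn 0 (m + M) * u ^ (m + M)) \<le> 2 powr D * sqrt u ^ M * gf u"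
proof -
  let ?w = "rn 0"
  have su: "0 \<le> sqrt u" "sqrt u < 1" "u \<le> sqrt u"
    using assms by (auto simp: sqrt_le_D real_le_rsqrt power2_eq_square mult_left_le)
  have s1: "(\<lambda>m. ?w m * u ^ m) sums gf u" using assms by (intro gf_sums) auto
  have s2: "(\<lambda>m. ?w m * sqrt u ^ m) sums gf (sqrt u)" using su by (intro gf_sums) auto
  show 1: "summable (\<lambda>m. ?w (m + M) * u ^ (m + M))"
    using sums_summable[OF s1] by (subst summable_iff_shift)
  have 2: "summable (\<lambda>m. ?w (m + M) * sqrt u ^ (m + M))"
    using sums_summable[OF s2] by (subst summable_iff_shift)
  have "(\<Sum>m. ?w (m + M) * u ^ (m + M)) \<le> (\<Sum>m. sqrt u ^ M * (?w (m + M) * sqrt u ^ (m + M)))"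
  proof (rule suminf_le[OF _ 1 summable_mult[OF 2]])
    fix m
    have "u ^ (m + M) = sqrt u ^ (m + M) * sqrt u ^ (m + M)"
      using assms by (simp add: power_mult_distrib[symmetric])
    also have "\<dots> \<le> sqrt u ^ M * sqrt u ^ (m + M)"
      using su by (intro mult_right_mono power_decreasing) auto
    finally have "?w (m + M) * u ^ (m + M) \<le> ?w (m + M) * (sqrt u ^ M * sqrt u ^ (m + M))"
      using renewal_unit_nonneg by (intro mult_left_mono) auto
    then show "?w (m + M) * u ^ (m + M) \<le> sqrt u ^ M * (?w (m + M) * sqrt u ^ (m + M))"
      by (simp add: mult_ac)
  qed
  also have "\<dots> = sqrt u ^ M * (\<Sum>m. ?w (m + M) * sqrt u ^ (m + M))"
    by (rule suminf_mult[OF 2])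
  also have "(\<Sum>m. ?w (m + M) * sqrt u ^ (m + M)) \<le> (\<Sum>m. ?w m * sqrt u ^ m)"
    using suminf_split_initial_segment[OF sums_summable[OF s2], of M] su
      sum_nonneg[of "{..<M}" "\<lambda>m. ?w m * sqrt u ^ m"] renewal_unit_nonneg by simp
  also have "\<dots> = gf (sqrt u)" using s2 by (simp add: sums_iff)
  also have "gf (sqrt u) \<le> ((1 - u) / (1 - sqrt u)) powr D * gf u"
    using assms su by (intro gf_growth) auto
  also have "(1 - u) / (1 - sqrt u) = 1 + sqrt u"
  proof -
    have "1 - u = (1 - sqrt u) * (1 + sqrt u)" using assms by (simp add: algebra_simps)
    then show ?thesis using su by simp
  qed
  also have "(1 + sqrt u) powr D \<le> 2 powr D"
    using su D_nonneg by (intro powr_mono2) auto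
  finally show "(\<Sum>m. ?w (m + M) * u ^ (m + M)) \<le> 2 powr D * sqrt u ^ M * gf u"
    using su gf_pos[of u] by (simp add: mult_ac mult_left_mono mult_right_mono)
qed

definition Klow :: real where "Klow = 2 * (2 * (D + 1) * ln 2) powr D"

lemma Klow_pos: "Klow > 0"
  using D_ge_1 by (simp add: Klow_def)

text \<open>At r = exp(- l/n) the part of the series from n on is at most half of the whole: l = 2
  (D + 1) ln 2 solves 2^D exp(- l/2) = 1/2 for the factor in \<open>gf_tail\<close>. Moving from r
  to \<open>cutoff n\<close> costs l^D, hence the form of \<open>Klow\<close>.\<close>

lemma gf_le_sum_renewal:
  assumes n: "1 \<le> n"
  shows "gf (cutoff n) \<le> Klow * (\<Sum>m<n. rn 0 m)"
proof -
  let ?w = "rn 0"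
  define l where "l = 2 * (D + 1) * ln 2"
  have l: "l \<ge> 1"
  proof -
    have "1 \<le> 2 * (2::real) * ln 2" using ln2_ge_two_thirds by simp
    also have "\<dots> \<le> l" unfolding l_def using D_ge_1 by (intro mult_right_mono) auto
    finally show ?thesis .
  qed
  define r where "r = exp (- l / real n)"
  have r: "0 < r" "r < 1" using l n by (auto simp: r_def)
  have s: "(\<lambda>m. ?w m * r ^ m) sums gf r" using r by (intro gf_sums) auto
  have "sqrt r ^ n = exp (- l / 2)"
  proof -
    have "r = (exp (- l / (2 * real n)))\<^sup>2"
      unfolding r_def using n by (simp add: exp_double[symmetric])
    then have "sqrt r = exp (- l / (2 * real n))" by simp
    then show ?thesis using n by (simp add: exp_of_nat_mult[symmetric])
  qed
  also have "\<dots> = 2 powr - (D + 1)"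
    by (simp add: powr_def l_def field_simps)
  finally have "2 powr D * sqrt r ^ n * gf r = gf r / 2"
    by (simp add: powr_add[symmetric] powr_minus_divide flip: mult.assoc)
  then have tail: "(\<Sum>m. ?w (m + n) * r ^ (m + n)) \<le> gf r / 2"
    using gf_tail(2)[OF less_imp_le[OF r(1)] r(2), of n] by linarith
  have "gf r = (\<Sum>m. ?w (m + n) * r ^ (m + n)) + (\<Sum>m<n. ?w m * r ^ m)"
    using suminf_split_initial_segment[OF sums_summable[OF s], of n] s by (simp add: sums_iff)
  also have "(\<Sum>m<n. ?w m * r ^ m) \<le> (\<Sum>m<n. ?w m)"
    using r renewal_unit_nonneg by (intro sum_mono mult_left_le power_le_one) auto
  finally have 1: "gf r \<le> 2 * (\<Sum>m<n. ?w m)" using tail by simp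
  have "gf (cutoff n) \<le> l powr D * gf r"
  proof (cases "cutoff n \<le> r")
    case True
    then have "1 * gf (cutoff n) \<le> l powr D * gf r"
      using n r l D_nonneg gf_pos by (intro mult_mono gf_mono ge_one_powr_ge_zero) (auto simp: less_imp_le)
    then show ?thesis by simp
  next
    case False
    then have "gf (cutoff n) \<le> ((1 - r) / (1 - cutoff n)) powr D * gf r"
      using r n by (intro gf_growth) auto
    also have "((1 - r) / (1 - cutoff n)) powr D \<le> l powr D"
    proof (rule powr_mono2)
      have "1 - r \<le> l / real n" using exp_ge_add_one_self[of "- l / real n"] by (simp add: r_def)
      then show "(1 - r) / (1 - cutoff n) \<le> l" using n by (simp add: field_simps)
    qed (use D_nonneg r n in auto)
    finally show ?thesis using gf_pos[of r] by (simp add: mult_right_mono)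
  qed
  also have "\<dots> \<le> l powr D * (2 * (\<Sum>m<n. ?w m))"
    using 1 by (intro mult_left_mono) auto
  finally show ?thesis by (simp add: Klow_def l_def mult_ac)
qed

end

section \<open>Estimates on circles\<close>

lemma fourier_coeff:
  fixes f :: "complex \<Rightarrow> complex" and r :: real
  assumes hol: "f holomorphic_on ball 0 1" and r: "0 < r" "r < 1"
    and F: "f has_fps_expansion F"
  shows "((\<lambda>t. f (of_real r * cis (2 * pi * t)) * cnj (cis (2 * pi * t) ^ m)) has_integral
           fps_nth F m * of_real r ^ m) {0..1}"
proof -
  let ?u = "\<lambda>t. of_real r * cis (2 * pi * t)"
  have cont: "continuous_on (cball 0 r) f"
    using hol by (rule holomorphic_on_imp_continuous_on[OF holomorphic_on_subset]) (use r in auto)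
  have hol': "f holomorphic_on ball 0 r"
    using hol by (rule holomorphic_on_subset) (use r in auto)
  have "((\<lambda>u. f u / (u - 0) ^ Suc m) has_contour_integral (2 * pi * \<i>) / fact m * (deriv ^^ m) f 0)
      (circlepath 0 r)"
    by (rule Cauchy_has_contour_integral_higher_derivative_circlepath[OF cont hol']) (use r in simp)
  then have "((\<lambda>t. f (circlepath 0 r t) / (circlepath 0 r t) ^ Suc m *
      (2 * pi * \<i> * r * exp (2 * of_real pi * \<i> * t))) has_integral
      (2 * pi * \<i>) / fact m * (deriv ^^ m) f 0) {0..1}"
    unfolding has_contour_integral vector_derivative_circlepath by simp
  then have "((\<lambda>t. (f (circlepath 0 r t) / (circlepath 0 r t) ^ Suc m *
      (2 * pi * \<i> * r * exp (2 * of_real pi * \<i> * t))) * (of_real r ^ m / (2 * pi * \<i>))) has_integral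
      ((2 * pi * \<i>) / fact m * (deriv ^^ m) f 0) * (of_real r ^ m / (2 * pi * \<i>))) {0..1}"
    by (rule has_integral_mult_left)
  also have "((2 * pi * \<i>) / fact m * (deriv ^^ m) f 0) * (of_real r ^ m / (2 * pi * \<i>)) =
      fps_nth F m * of_real r ^ m"
    unfolding fps_nth_fps_expansion[OF F] by (simp add: field_simps)
  also have "(\<lambda>t. (f (circlepath 0 r t) / (circlepath 0 r t) ^ Suc m *
      (2 * pi * \<i> * r * exp (2 * of_real pi * \<i> * t))) * (of_real r ^ m / (2 * pi * \<i>))) =
      (\<lambda>t. f (?u t) * cnj (cis (2 * pi * t) ^ m))"
  proof
    fix t :: real
    have e: "exp (2 * of_real pi * \<i> * t) = cis (2 * pi * t)"
      by (simp add: cis_conv_exp mult_ac)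
    have c: "cnj (cis (2 * pi * t) ^ m) = inverse (cis (2 * pi * t) ^ m)"
      by (simp only: complex_cnj_power cis_cnj power_inverse flip: cis_inverse)
    have cp: "circlepath 0 r t = ?u t" by (simp add: circlepath e)
    show "(f (circlepath 0 r t) / (circlepath 0 r t) ^ Suc m *
      (2 * pi * \<i> * r * exp (2 * of_real pi * \<i> * t))) * (of_real r ^ m / (2 * pi * \<i>)) =
      f (?u t) * cnj (cis (2 * pi * t) ^ m)"
      unfolding cp e c using r by (simp add: power_mult_distrib field_simps)
  qed
  finally show ?thesis .
qed

text \<open>Integrate |f - q|^2 \<ge> 0 over the circle, where q is the Taylor polynomial of degree
  N. Working with a majorant \<open>g\<close> of |f|^2 avoids having to integrate |f|^2
  itself.\<close>

lemma bessel_circle: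
  fixes f :: "complex \<Rightarrow> complex" and r I :: real
  assumes hol: "f holomorphic_on ball 0 1" and r: "0 < r" "r < 1"
    and F: "f has_fps_expansion F"
    and g: "(g has_integral I) {0..1}"
    and bound: "\<And>t. 0 \<le> t \<Longrightarrow> t \<le> 1 \<Longrightarrow> (norm (f (of_real r * cis (2 * pi * t))))\<^sup>2 \<le> g t"
  shows "(\<Sum>m\<le>N. (norm (fps_nth F m) * r ^ m)\<^sup>2) \<le> I"
proof -
  define q where "q = (\<lambda>z. \<Sum>m\<le>N. fps_nth F m * z ^ m)"
  define G where "G = (\<Sum>m\<le>N. fps_const (fps_nth F m) * fps_X ^ m)"
  let ?u = "\<lambda>t. of_real r * cis (2 * pi * t)"
  have q: "q has_fps_expansion G"
    unfolding q_def G_def by (intro fps_expansion_intros)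
  have G: "fps_nth G m = fps_nth F m" if "m \<le> N" for m
    using that by (simp add: G_def fps_sum_nth fps_X_power_nth if_distrib cong: if_cong)
  have qhol: "q holomorphic_on ball 0 1" unfolding q_def by (intro holomorphic_intros)
  define C where "C = (\<Sum>m\<le>N. (norm (fps_nth F m) * r ^ m)\<^sup>2)"
  \<comment> \<open>The inner product with \<open>q\<close> sees only the first N + 1 coefficients,
    so one computation covers both f against q and q against itself.\<close>
  have main: "((\<lambda>t. h (?u t) * cnj (q (?u t))) has_integral of_real C) {0..1}"
    if h: "h holomorphic_on ball 0 1" "h has_fps_expansion H" "\<And>m. m \<le> N \<Longrightarrow> fps_nth H m = fps_nth F m"
    for h H
  proof -
    have "((\<lambda>t. \<Sum>m\<le>N. h (?u t) * cnj (cis (2 * pi * t) ^ m) * (cnj (fps_nth F m) * of_real r ^ m)) has_integral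
        (\<Sum>m\<le>N. fps_nth H m * of_real r ^ m * (cnj (fps_nth F m) * of_real r ^ m))) {0..1}"
      by (intro has_integral_sum has_integral_mult_left fourier_coeff h r) simp
    also have "(\<Sum>m\<le>N. fps_nth H m * of_real r ^ m * (cnj (fps_nth F m) * of_real r ^ m)) = of_real C"
      unfolding C_def of_real_sum
    proof (rule sum.cong[OF refl])
      fix m assume "m \<in> {..N}"
      then have "fps_nth H m * of_real r ^ m * (cnj (fps_nth F m) * of_real r ^ m) =
          (fps_nth F m * cnj (fps_nth F m)) * (of_real r ^ m)\<^sup>2"
        by (simp add: h(3) power2_eq_square)
      then show "fps_nth H m * of_real r ^ m * (cnj (fps_nth F m) * of_real r ^ m) =
          of_real ((norm (fps_nth F m) * r ^ m)\<^sup>2)"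
        by (simp add: complex_norm_square[symmetric] power_mult_distrib)
    qed
    also have "(\<lambda>t. \<Sum>m\<le>N. h (?u t) * cnj (cis (2 * pi * t) ^ m) * (cnj (fps_nth F m) * of_real r ^ m))
      = (\<lambda>t. h (?u t) * cnj (q (?u t)))"
      by (simp add: q_def power_mult_distrib sum_distrib_left mult_ac)
    finally show ?thesis .
  qed
  have 1: "((\<lambda>t. Re (f (?u t) * cnj (q (?u t)))) has_integral C) {0..1}"
    using has_integral_Re[OF main[OF hol F refl]] by simp
  have 2: "((\<lambda>t. Re (q (?u t) * cnj (q (?u t)))) has_integral C) {0..1}"
    using has_integral_Re[OF main[OF qhol q G]] by simp
  have "((\<lambda>t. g t - 2 * Re (f (?u t) * cnj (q (?u t))) + Re (q (?u t) * cnj (q (?u t)))) has_integral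
      I - 2 * C + C) {0..1}"
    by (intro has_integral_add has_integral_diff has_integral_mult_right g 1 2)
  moreover have "0 \<le> g t - 2 * Re (f (?u t) * cnj (q (?u t))) + Re (q (?u t) * cnj (q (?u t)))"
    if "t \<in> {0..1}" for t
  proof -
    let ?a = "f (?u t)" and ?b = "q (?u t)"
    have "0 \<le> (norm (?a - ?b))\<^sup>2" by simp
    also have "\<dots> = (norm ?a)\<^sup>2 - 2 * Re (?a * cnj ?b) + Re (?b * cnj ?b)"
      unfolding cmod_power2 by (simp add: power2_eq_square algebra_simps)
    finally show ?thesis using bound[of t] that by simp
  qed
  ultimately have "0 \<le> I - 2 * C + C" by (rule has_integral_nonneg)
  then show ?thesis by (simp add: C_def)
qed

text \<open>Up to pi/3 the derivative cos - 1/2 is nonnegative; beyond, sin x \<ge> sqrt 3 / 2 \<ge>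
  0.8, while x/2 \<le> pi/4 < 0.8.\<close>

lemma sin_ge_half: 
  assumes "0 \<le> x" "x \<le> pi / 2" shows "x / 2 \<le> sin x"
proof (cases "x \<le> pi / 3")
  case True
  have "sin 0 - 0 / 2 \<le> sin x - x / 2"
  proof (rule DERIV_nonneg_imp_nondecreasing[OF assms(1)])
    fix y assume y: "0 \<le> y" "y \<le> x"
    have "cos (pi / 3) \<le> cos y"
      using y True by (intro cos_monotone_0_pi_le) auto
    then have "0 \<le> cos y - 1 / 2" by (simp add: cos_60)
    moreover have "((\<lambda>x. sin x - x / 2) has_real_derivative cos y - 1 / 2) (at y)"
      by (auto intro!: derivative_eq_intros)
    ultimately show "\<exists>d. ((\<lambda>x. sin x - x / 2) has_real_derivative d) (at y) \<and> 0 \<le> d" by blast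
  qed
  then show ?thesis by simp
next
  case False
  have "sqrt 3 / 2 \<le> sin x"
    using sin_monotone_2pi_le[of "pi / 3" x] False assms by (simp add: sin_60)
  moreover have "1.6 \<le> sqrt 3" by (rule real_le_rsqrt) (simp add: power2_eq_square)
  moreover have "pi < 3.2" using pi_approx by simp
  ultimately show ?thesis using assms by simp
qed

lemma dist_cis_ge:
  assumes "0 \<le> t" "t \<le> 1"
  shows "min t (1 - t) \<le> norm (1 - cis (2 * pi * t))"
proof -
  have eq: "norm (1 - cis (2 * pi * t)) = 2 * \<bar>sin (pi * t)\<bar>"
    using dist_exp_i_1[of "2 * pi * t"] by (simp add: cis_conv_exp norm_minus_commute mult.assoc)
  have half: "s \<le> 2 * \<bar>sin (pi * s)\<bar>" if "0 \<le> s" "s \<le> 1 / 2" for s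
  proof -
    have "pi * s / 2 \<le> sin (pi * s)"
      using that by (intro sin_ge_half) (auto simp: field_simps)
    moreover have "1 * s \<le> pi * s" using that pi_ge_two by (intro mult_right_mono) auto
    ultimately show ?thesis by linarith
  qed
  show ?thesis
  proof (cases "t \<le> 1 / 2")
    case True
    then show ?thesis using half[of t] assms eq by simp
  next
    case False
    have "sin (pi * (1 - t)) = sin (pi * t)"
      by (simp add: right_diff_distrib)
    then show ?thesis using half[of "1 - t"] False assms eq by simp
  qed
qed

text \<open>Two bumps, because the point 1 of the circle is reached at both ends of the parameter
  interval.\<close>

lemma has_integral_lorentzian:
  fixes c :: real
  assumes "c > 0"
  shows "((\<lambda>t. 1 / (1 + (c * t)\<^sup>2) + 1 / (1 + (c * (1 - t))\<^sup>2)) has_integral 2 * arctan c / c) {0..1}"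
proof -
  have "((\<lambda>t. 1 / (1 + (c * t)\<^sup>2) + 1 / (1 + (c * (1 - t))\<^sup>2)) has_integral
     (arctan (c * 1) / c - arctan (c * (1 - 1)) / c) - (arctan (c * 0) / c - arctan (c * (1 - 0)) / c)) {0..1}"
  proof (rule fundamental_theorem_of_calculus)
    fix t :: real
    have "((\<lambda>t. arctan (c * t) / c - arctan (c * (1 - t)) / c) has_real_derivative
        inverse (1 + (c * t)\<^sup>2) * (c * 1) / c - inverse (1 + (c * (1 - t))\<^sup>2) * (c * (0 - 1)) / c) (at t within {0..1})"
      by (intro DERIV_diff DERIV_cdivide DERIV_chain2[OF DERIV_arctan] DERIV_cmult DERIV_ident DERIV_const)
    also have "inverse (1 + (c * t)\<^sup>2) * (c * 1) / c - inverse (1 + (c * (1 - t))\<^sup>2) * (c * (0 - 1)) / c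
       = 1 / (1 + (c * t)\<^sup>2) + 1 / (1 + (c * (1 - t))\<^sup>2)"
      using assms by (simp add: divide_simps)
    finally show "((\<lambda>t. arctan (c * t) / c - arctan (c * (1 - t)) / c) has_vector_derivative
        1 / (1 + (c * t)\<^sup>2) + 1 / (1 + (c * (1 - t))\<^sup>2)) (at t within {0..1})"
      by (simp add: has_real_derivative_iff_has_vector_derivative)
  qed simp
  then show ?thesis by (simp add: field_simps)
qed

section \<open>Splitting off the singular factor (1 - z)^(- \<delta>)\<close>

locale weights =
  fixes a :: "nat \<Rightarrow> real" and \<delta> D :: real
  assumes \<delta>: "0 < \<delta>" "\<delta> \<le> 1" and a_bounds: "1 \<le> k \<Longrightarrow> \<delta> \<le> a k" "1 \<le> k \<Longrightarrow> a k \<le> D"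
    and D1: "1 \<le> D"
begin

abbreviation excess :: "nat \<Rightarrow> real" where "excess \<equiv> \<lambda>k. a k - \<delta>"

sublocale P: nonneg_coeffs a D
  by unfold_locales (use a_bounds D1 \<delta> in \<open>auto intro: order.trans[of 0 \<delta>]\<close>)

sublocale W: nonneg_coeffs excess D
  by unfold_locales (use a_bounds D1 \<delta> in \<open>force+\<close>)

abbreviation E :: "complex \<Rightarrow> complex" where "E z \<equiv> exp (lser P.cb z)"
abbreviation Q :: "nat \<Rightarrow> complex \<Rightarrow> complex" where "Q j \<equiv> prim P.cb j"

lemma lser_split:
  assumes "norm z < 1"
  shows "lser P.cb z = lser W.cb z - of_real \<delta> * Ln (1 - z)"
proof -
  interpret k: bounded_coeffs "\<lambda>_. of_real \<delta> :: complex" \<delta>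
    by unfold_locales (use \<delta> in simp)
  have "(\<lambda>k. W.cb k / of_nat k * z ^ k + of_real \<delta> / of_nat k * z ^ k) sums
      (lser W.cb z + lser (\<lambda>_. of_real \<delta>) z)"
    by (intro sums_add W.c.lser_sums k.lser_sums assms)
  moreover have "(\<lambda>k. W.cb k / of_nat k * z ^ k + of_real \<delta> / of_nat k * z ^ k) =
      (\<lambda>k. P.cb k / of_nat k * z ^ k)"
    by (simp add: diff_divide_distrib left_diff_distrib)
  ultimately have "lser W.cb z + lser (\<lambda>_. of_real \<delta>) z = lser P.cb z"
    using P.c.lser_sums[OF assms] sums_unique2 by metis
  then show ?thesis using lser_const[OF assms, of "of_real \<delta>"] by simp
qed

lemma Re_lser_split:
  assumes "norm z < 1"
  shows "Re (lser P.cb z) = Re (lser W.cb z) - \<delta> * ln (norm (1 - z))"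
proof -
  have "1 - z \<noteq> 0" using assms by auto
  then show ?thesis unfolding lser_split[OF assms] by simp
qed

lemma gf_split:
  assumes "0 \<le> u" "u < 1"
  shows "P.gf u = W.gf u * (1 - u) powr (- \<delta>)"
proof -
  have "norm (1 - complex_of_real u) = 1 - u"
    using assms norm_of_real[of "1 - u", where 'a = complex] by simp
  then have "lser a u = lser excess u - \<delta> * ln (1 - u)"
    using Re_lser_split[of "of_real u"] P.lser_cb_of_real[of u] W.lser_cb_of_real[of u] assms
    by simp
  then show ?thesis
    using assms by (simp add: P.gf_def W.gf_def powr_def exp_add[symmetric])
qed

lemma gf_cutoff: "1 \<le> j \<Longrightarrow> P.gf (cutoff j) = W.gf (cutoff j) * real j powr \<delta>"
  by (subst gf_split) (auto simp: powr_minus powr_divide)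

text \<open>The left side is |P(r w) / P(s w)|. Monotonicity along the ray is applied to W only; the
  factor from 1 - z is kept exactly, which preserves the decay away from z = 1.\<close>

lemma E_ratio:
  assumes "0 \<le> s" "s \<le> r" "r < 1" "norm w = 1"
  shows "norm (E (of_real r * w)) * exp (- Re (lser P.cb (of_real s * w))) \<le>
    W.gf r / W.gf s * (norm (1 - of_real s * w) / norm (1 - of_real r * w)) powr \<delta>"
proof -
  have n: "norm (of_real r * w) < 1" "norm (of_real s * w) < 1"
    using assms by (auto simp: norm_mult)
  then have nz: "norm (1 - of_real r * w) > 0" "norm (1 - of_real s * w) > 0" by auto
  have "norm (E (of_real r * w)) * exp (- Re (lser P.cb (of_real s * w))) =
    exp (Re (lser W.cb (of_real r * w)) - Re (lser W.cb (of_real s * w))) *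
    exp (\<delta> * (ln (norm (1 - of_real s * w)) - ln (norm (1 - of_real r * w))))"
    using n by (simp add: Re_lser_split exp_add[symmetric] algebra_simps)
  also have "exp (\<delta> * (ln (norm (1 - of_real s * w)) - ln (norm (1 - of_real r * w)))) =
     (norm (1 - of_real s * w) / norm (1 - of_real r * w)) powr \<delta>"
    using nz by (simp add: powr_def ln_div)
  also have "exp (Re (lser W.cb (of_real r * w)) - Re (lser W.cb (of_real s * w))) \<le> W.gf r / W.gf s"
    using W.Re_lser_ray[OF assms] by (simp add: W.gf_def exp_diff[symmetric])
  finally show ?thesis by (simp add: mult_right_mono)
qed

lemma dist_ray:
  fixes w :: complex
  assumes "norm w = 1" "0 \<le> s" "s \<le> 1"
  shows "norm (1 - of_real s * w) \<le> norm (1 - w) + (1 - s)"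
    and "1 - s \<le> norm (1 - of_real s * w)"
    and "norm (1 - w) \<le> 2 * norm (1 - of_real s * w)"
proof -
  have d: "norm (w - of_real s * w) = 1 - s"
  proof -
    have "w - of_real s * w = of_real (1 - s) * w" by (simp add: algebra_simps)
    also have "norm \<dots> = 1 - s" using assms by (simp only: norm_mult norm_of_real) simp
    finally show ?thesis .
  qed
  show "norm (1 - of_real s * w) \<le> norm (1 - w) + (1 - s)"
    using norm_triangle_ineq[of "1 - w" "w - of_real s * w"] d by simp
  show 1: "1 - s \<le> norm (1 - of_real s * w)"
    using norm_triangle_ineq2[of 1 "of_real s * w"] assms by (simp add: norm_mult)
  show "norm (1 - w) \<le> 2 * norm (1 - of_real s * w)"
    using norm_triangle_ineq4[of "1 - of_real s * w" "w - of_real s * w"] d 1 by simp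
qed

lemma V_bound_far:
  assumes j: "1 \<le> j" and x: "0 \<le> x" "x < 1" and r: "0 \<le> r" "r < 1"
    and w: "norm w = 1" and far: "1 / real j \<le> norm (1 - w)"
  shows "norm (E (of_real r * w) * (Q j (of_real x) - Q j (of_real r * w))) \<le>
    8 * W.K * W.gf r / (real j * W.gf (cutoff j))"
proof -
  let ?z = "of_real r * w"
  let ?\<eta> = "norm (1 - w)" and ?Wj = "W.gf (cutoff j)"
  have Wpos: "0 < ?Wj" "0 < W.gf r" by (rule W.gf_pos)+
  have "0 < 1 / real j" using j by simp
  then have "0 < ?\<eta>" using far by linarith
  then have \<eta>: "0 < ?\<eta>" "1 / ?\<eta> \<le> real j"
    using far j by (auto simp: field_simps)
  have dr: "?\<eta> / 2 \<le> norm (1 - ?z)"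
    using dist_ray(3)[of w r] w r by simp
  have dr0: "0 < norm (1 - ?z)" using dr \<eta> by linarith
  have "norm (E ?z) \<le> W.gf r * (1 / norm (1 - ?z)) powr \<delta>"
    using E_ratio[of 0 r w] r w by (simp add: P.c.lser_0 W.gf_0)
  also have "(1 / norm (1 - ?z)) powr \<delta> \<le> (2 * real j) powr \<delta>"
  proof (rule powr_mono2)
    have "1 / norm (1 - ?z) \<le> 1 / (?\<eta> / 2)"
      using dr \<eta> dr0 by (intro divide_left_mono mult_pos_pos) auto
    also have "\<dots> \<le> 2 * real j" using \<eta> by simp
    finally show "1 / norm (1 - ?z) \<le> 2 * real j" .
  qed (use \<delta> in auto)
  also have "(2 * real j) powr \<delta> = 2 powr \<delta> * real j powr \<delta>"
    by (simp add: powr_mult)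
  also have "2 powr \<delta> * real j powr \<delta> \<le> 2 powr 1 * real j powr \<delta>"
    using \<delta> by (intro mult_right_mono powr_mono) auto
  finally have E: "norm (E ?z) \<le> W.gf r * (2 * real j powr \<delta>)"
    using Wpos by simp
  have "norm (E ?z * Q j (of_real x)) \<le>
     (W.gf r * (2 * real j powr \<delta>)) * (2 * P.K / (real j * P.gf (cutoff j)))"
    unfolding norm_mult using E Wpos by (intro mult_mono P.norm_prim_real_le x j) auto
  also have "\<dots> = 4 * W.K * W.gf r / (real j * ?Wj)"
    unfolding gf_cutoff[OF j] using j by (simp add: field_simps)
  finally have 1: "norm (E ?z * Q j (of_real x)) \<le> 4 * W.K * W.gf r / (real j * ?Wj)" .
  let ?A = "2 * W.gf r * W.K / ?Wj"
  let ?f = "\<lambda>s. E ?z * Q j (of_real s * w)"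
  let ?f' = "\<lambda>s. E ?z *
    (w * ((of_real s * w) ^ (j - 1) * exp (- lser P.cb (of_real s * w))))"
  have "norm (?f r - ?f 0) \<le> 2 * ?A / j"
  proof (rule norm_diff_le_sqrt_power[where f' = ?f'])
    show "continuous_on {0..r} ?f"
      using r w by (intro continuous_intros prim_ray_continuous[OF P.c.bounded_coeffs_axioms]) auto
    fix s assume s: "0 < s" "s < r"
    show "(?f has_vector_derivative ?f' s) (at s)"
      using s r w by (intro has_vector_derivative_mult_right prim_ray_deriv[OF P.c.bounded_coeffs_axioms]) auto
    \<comment> \<open>Since 1 - w is at least 1/j in modulus, the quotient grows at most linearly in
      j (1 - s), which is what the weight in \<open>weighted_moment\<close> can absorb.\<close>
    have R: "(norm (1 - of_real s * w) / norm (1 - ?z)) powr \<delta> \<le>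
        2 * (1 + real j * (1 - s)) powr D"
    proof -
      have "norm (1 - of_real s * w) / norm (1 - ?z) \<le> (?\<eta> + (1 - s)) / (?\<eta> / 2)"
        using dr \<eta> s r w by (intro frac_le dist_ray) auto
      also have "\<dots> = 2 * (1 + 1 / ?\<eta> * (1 - s))" using \<eta> by (simp add: field_simps)
      also have "\<dots> \<le> 2 * (1 + real j * (1 - s))"
        using \<eta> s r by (intro mult_left_mono add_left_mono mult_right_mono) auto
      finally have "(norm (1 - of_real s * w) / norm (1 - ?z)) powr \<delta> \<le>
         (2 * (1 + real j * (1 - s))) powr \<delta>"
        using \<delta> by (intro powr_mono2) auto
      also have "\<dots> = 2 powr \<delta> * (1 + real j * (1 - s)) powr \<delta>"
        using s r by (subst powr_mult) auto
      also have "\<dots> \<le> 2 powr 1 * (1 + real j * (1 - s)) powr D"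
        using \<delta> D1 s r by (intro mult_mono powr_mono) auto
      finally show ?thesis by simp
    qed
    have "norm (?f' s) = norm (E ?z) * exp (- Re (lser P.cb (of_real s * w))) * s ^ (j - 1)"
      unfolding norm_mult[of "E ?z"] using norm_prim_ray_deriv[OF w, of s j P.cb] s by simp
    also have "\<dots> \<le> W.gf r / W.gf s *
       (norm (1 - of_real s * w) / norm (1 - ?z)) powr \<delta> * s ^ (j - 1)"
      using s r w by (intro mult_right_mono E_ratio) auto
    also have "\<dots> \<le> W.gf r / W.gf s * (2 * (1 + real j * (1 - s)) powr D) * s ^ (j - 1)"
      using R s Wpos W.gf_pos[of s] by (intro mult_right_mono mult_left_mono) auto
    also have "\<dots> = 2 * W.gf r * ((1 + real j * (1 - s)) powr D * s ^ (j - 1) / W.gf s)"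
      by simp
    also have "\<dots> \<le> 2 * W.gf r * (W.K / ?Wj * sqrt s ^ (j - 1))"
      using s r j Wpos by (intro mult_left_mono W.weighted_moment) auto
    finally show "norm (?f' s) \<le> ?A * sqrt s ^ (j - 1)"
      by simp
  qed (use j r Wpos W.K_pos in auto)
  then have 2: "norm (E ?z * Q j ?z) \<le> 4 * W.K * W.gf r / (real j * ?Wj)"
    using prim_spec(1)[OF P.c.bounded_coeffs_axioms] by (simp add: mult_ac)
  have "norm (E ?z * (Q j (of_real x) - Q j ?z)) \<le>
     norm (E ?z * Q j (of_real x)) + norm (E ?z * Q j ?z)"
    unfolding right_diff_distrib by (rule norm_triangle_ineq4)
  also have "\<dots> \<le> 4 * W.K * W.gf r / (real j * ?Wj) + 4 * W.K * W.gf r / (real j * ?Wj)"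
    by (intro add_mono 1 2)
  also have "\<dots> = 8 * W.K * W.gf r / (real j * ?Wj)"
    by (simp flip: add_divide_distrib)
  finally show ?thesis .
qed

text \<open>The path from \<open>r w\<close> to \<open>x\<close> runs inwards along the ray to \<open>s0 w\<close>, across to \<open>s0\<close> and outwards
  along the real axis, with \<open>s0 = 1 - k\<close>; on each leg the integrand is controlled and the length is
  at most \<open>k\<close>.\<close>

lemma V_bound_near:
  assumes j: "1 \<le> j" and r: "cutoff j \<le> r" "r < 1" and x: "r \<le> x" "x < 1"
    and w: "norm w = 1" and near: "norm (1 - w) \<le> 1 / real j"
  defines "k \<equiv> max (norm (1 - w)) (1 - r)"
  shows "norm (E (of_real r * w) * (Q j (of_real x) - Q j (of_real r * w))) \<le>
    12 * exp D * k * W.gf r / W.gf (cutoff j)"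
proof -
  let ?\<eta> = "norm (1 - w)" and ?Wj = "W.gf (cutoff j)"
  have k: "0 < k" "?\<eta> \<le> k" "1 - r \<le> k" "k \<le> 1 / real j"
    using r near by (auto simp: k_def)
  have "1 / real j \<le> 1" using j by simp
  define s0 where "s0 = 1 - k"
  let ?z = "of_real r * w" and ?y = "of_real s0 * w"
  have s0: "0 \<le> s0" "s0 \<le> r" "s0 < 1" "cutoff j \<le> s0" "s0 \<le> x"
    using k \<open>1 / real j \<le> 1\<close> r x by (auto simp: s0_def)
  have r0: "0 \<le> r" using s0 by simp
  have "cutoff j \<ge> 0" using j by simp
  then have W: "?Wj \<le> W.gf s0" "0 < ?Wj" "0 < W.gf s0" "0 < W.gf r"
    using s0 by (auto intro: W.gf_mono W.gf_pos)
  have dr: "k / 2 \<le> norm (1 - ?z)"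
    using dist_ray(2,3)[of w r] w r r0 k by (auto simp: k_def max_def)
  have ray: "norm (E ?z) * exp (- Re (lser P.cb (of_real s * w))) \<le> 4 * W.gf r / ?Wj"
    if "s0 \<le> s" "s \<le> r" for s
  proof -
    have "norm (1 - of_real s * w) / norm (1 - ?z) \<le> (2 * k) / (k / 2)"
    proof (rule frac_le)
      have "norm (1 - of_real s * w) \<le> ?\<eta> + (1 - s)"
        using w that r s0 by (intro dist_ray) auto
      then show "norm (1 - of_real s * w) \<le> 2 * k"
        using k that by (simp add: s0_def)
    qed (use dr k in auto)
    also have "\<dots> = 4" using k by simp
    finally have "(norm (1 - of_real s * w) / norm (1 - ?z)) powr \<delta> \<le> 4 powr \<delta>"
      using \<delta> by (intro powr_mono2) auto
    also have "4 powr \<delta> \<le> 4 powr 1" using \<delta> by (intro powr_mono) auto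
    finally have 1: "(norm (1 - of_real s * w) / norm (1 - ?z)) powr \<delta> \<le> 4" by simp
    have "?Wj \<le> W.gf s" using \<open>0 \<le> cutoff j\<close> s0 that r by (intro W.gf_mono) auto
    have "norm (E ?z) * exp (- Re (lser P.cb (of_real s * w))) \<le>
      W.gf r / W.gf s * (norm (1 - of_real s * w) / norm (1 - ?z)) powr \<delta>"
      using that s0 r w by (intro E_ratio) auto
    also have "\<dots> \<le> W.gf r / ?Wj * 4"
      using 1 W \<open>?Wj \<le> W.gf s\<close> by (intro mult_mono divide_left_mono) (auto intro: W.gf_pos)
    also have "\<dots> = 4 * W.gf r / ?Wj" by (simp only: times_divide_eq_left mult.commute)
    finally show ?thesis .
  qed
  have Qd: "(Q j has_field_derivative z ^ (j - 1) * exp (- lser P.cb z)) (at z within S)" if "norm z < 1" for z S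
    using prim_spec(2)[OF P.c.bounded_coeffs_axioms that] by (rule has_field_derivative_at_within)
  have seg1: "norm (E ?z * Q j ?y - E ?z * Q j ?z)
     \<le> 4 * W.gf r / ?Wj * norm (of_real s0 * w - of_real r * w)"
  proof (rule field_differentiable_bound[of "(\<lambda>s. of_real s * w) ` {s0..r}"])
    have "(\<lambda>s. of_real s * w) ` {s0..r} = (\<lambda>s. s *\<^sub>R w) ` {s0..r}"
      by (simp add: scaleR_conv_of_real)
    then show "convex ((\<lambda>s. of_real s * w) ` {s0..r})"
      by (simp only:) (intro convex_linear_image bounded_linear.linear bounded_linear_scaleR_left convex_real_interval)
  next
    fix z assume "z \<in> (\<lambda>s. of_real s * w) ` {s0..r}"
    then obtain s where s: "z = of_real s * w" "s0 \<le> s" "s \<le> r" unfolding image_iff by force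
    have nz: "norm z = s" using s s0 w by (simp add: norm_mult)
    show "((\<lambda>z. E ?z * Q j z) has_field_derivative
        E ?z * (z ^ (j - 1) * exp (- lser P.cb z))) (at z within (\<lambda>s. of_real s * w) ` {s0..r})"
      using nz s r by (intro DERIV_cmult Qd) auto
    have "norm (E ?z * (z ^ (j - 1) * exp (- lser P.cb z))) =
       norm (E ?z) * exp (- Re (lser P.cb z)) * s ^ (j - 1)"
      by (simp add: norm_mult norm_power nz)
    also have "\<dots> \<le> 4 * W.gf r / ?Wj * 1"
      unfolding s(1) using s s0 r W by (intro mult_mono ray power_le_one) auto
    finally show "norm (E ?z * (z ^ (j - 1) * exp (- lser P.cb z))) \<le> 4 * W.gf r / ?Wj" by simp
  qed (use s0 in auto)
  have seg2: "norm (E ?y * Q j (of_real s0) - E ?y * Q j ?y)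
     \<le> exp D * norm (of_real s0 - of_real s0 * w)"
  proof (rule field_differentiable_bound[of "closed_segment (of_real s0) ?y"])
    fix z assume z: "z \<in> closed_segment (of_real s0) ?y"
    have "closed_segment (of_real s0) ?y \<subseteq> cball 0 s0"
      using s0 w by (intro closed_segment_subset convex_cball) (auto simp: norm_mult)
    then have nz: "norm z \<le> s0" using z by auto
    show "((\<lambda>z. E ?y * Q j z) has_field_derivative
        E ?y * (z ^ (j - 1) * exp (- lser P.cb z)))
        (at z within closed_segment (of_real s0) ?y)"
      using nz s0 by (intro DERIV_cmult Qd) auto
    \<comment> \<open>Between the rays the derivative is at most D/k, and the distance is at most k.
      Hence \<open>lser\<close> varies by at most D, which is where exp D comes from.\<close>
    have "norm (lser P.cb ?y - lser P.cb z) \<le> D / k * norm (of_real s0 * w - z)"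
    proof (rule field_differentiable_bound[of "cball 0 s0"])
      fix u :: complex assume u: "u \<in> cball 0 s0"
      then have nu: "norm u \<le> s0" by simp
      show "(lser P.cb has_field_derivative eval_fps (fps_deriv (lfps P.cb)) u) (at u within cball 0 s0)"
        using nu s0 by (intro P.c.lser_deriv) simp
      have "norm (eval_fps (fps_deriv (lfps P.cb)) u) \<le> D / (1 - norm u)"
        using nu s0 by (intro P.c.norm_lser_deriv) simp
      also have "\<dots> \<le> D / k"
        using nu s0 k D1 by (intro divide_left_mono) (auto simp: s0_def)
      finally show "norm (eval_fps (fps_deriv (lfps P.cb)) u) \<le> D / k" .
    qed (use nz s0 w in \<open>auto simp: norm_mult\<close>)
    moreover have "norm (of_real s0 * w - z) \<le> k"
    proof -
      have "norm (of_real s0 * w - z) \<le> norm (of_real s0 * w - of_real s0)"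
        using segment_bound(2)[OF z] by (simp add: norm_minus_commute)
      also have "of_real s0 * w - of_real s0 = of_real s0 * (w - 1)" by (simp add: algebra_simps)
      also have "norm \<dots> = s0 * ?\<eta>" using s0 by (simp add: norm_mult norm_minus_commute)
      also have "\<dots> \<le> 1 * k" using s0 k by (intro mult_mono) auto
      finally show ?thesis by simp
    qed
    then have "D / k * norm (of_real s0 * w - z) \<le> D / k * k"
      using k D1 by (intro mult_left_mono) auto
    ultimately have L: "norm (lser P.cb ?y - lser P.cb z) \<le> D"
      using k by simp
    have "norm (E ?y * (z ^ (j - 1) * exp (- lser P.cb z))) =
        norm (exp (lser P.cb ?y - lser P.cb z)) * norm z ^ (j - 1)"
    proof -
      have "exp (lser P.cb ?y - lser P.cb z) =
          E ?y * exp (- lser P.cb z)"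
        by (simp add: exp_diff exp_minus divide_inverse)
      then show ?thesis by (simp only: norm_mult norm_power mult_ac)
    qed
    also have "\<dots> \<le> exp D * 1"
    proof (rule mult_mono)
      show "norm (exp (lser P.cb ?y - lser P.cb z)) \<le> exp D"
        using L complex_Re_le_cmod[of "lser P.cb ?y - lser P.cb z"]
        unfolding norm_exp_eq_Re by simp
    qed (use nz s0 in \<open>auto intro: power_le_one\<close>)
    finally show "norm (E ?y * (z ^ (j - 1) * exp (- lser P.cb z))) \<le> exp D" by simp
  qed auto
  have seg3: "norm (E ?y * Q j (of_real x) - E ?y * Q j (of_real s0))
     \<le> 1 * norm (of_real x - of_real s0 :: complex)"
  proof (rule field_differentiable_bound[of "complex_of_real ` {s0..x}"])
    show "convex (complex_of_real ` {s0..x})"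
      by (intro convex_linear_image bounded_linear.linear bounded_linear_of_real convex_real_interval)
    fix z assume "z \<in> complex_of_real ` {s0..x}"
    then obtain s where s: "z = of_real s" "s0 \<le> s" "s \<le> x" by auto
    show "((\<lambda>z. E ?y * Q j z) has_field_derivative
        E ?y * (z ^ (j - 1) * exp (- lser P.cb z))) (at z within complex_of_real ` {s0..x})"
      using s s0 x by (intro DERIV_cmult Qd) auto
    have "norm (E ?y) \<le> P.gf s0"
      using P.norm_exp_lser_ray[of 0 s0 w] s0 w by (simp add: P.c.lser_0 P.gf_0)
    also have "\<dots> \<le> P.gf s" using s s0 x by (intro P.gf_mono) auto
    finally have 1: "norm (E ?y) \<le> P.gf s" .
    have "norm (E ?y * (z ^ (j - 1) * exp (- lser P.cb z))) =
       norm (E ?y) * s ^ (j - 1) / P.gf s"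
      using s s0 x by (simp add: norm_mult norm_power P.lser_cb_of_real P.gf_def exp_minus divide_inverse
          norm_inverse exp_of_real)
    also have "\<dots> \<le> P.gf s * 1 / P.gf s"
      using s s0 x 1 P.gf_pos[of s] by (intro divide_right_mono mult_mono power_le_one) auto
    finally show "norm (E ?y * (z ^ (j - 1) * exp (- lser P.cb z))) \<le> 1"
      using P.gf_pos[of s] by simp
  qed (use s0 in auto)
  have n1: "norm (of_real s0 * w - of_real r * w) \<le> k"
  proof -
    have "of_real s0 * w - of_real r * w = of_real (s0 - r) * w" by (simp add: algebra_simps)
    then show ?thesis using w s0 r by (simp only: norm_mult norm_of_real) (simp add: s0_def)
  qed
  have n2: "norm (of_real s0 - of_real s0 * w) \<le> k"
  proof -
    have "of_real s0 - of_real s0 * w = of_real s0 * (1 - w)" by (simp add: algebra_simps)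
    also have "norm \<dots> = s0 * ?\<eta>" using s0 by (simp add: norm_mult)
    also have "\<dots> \<le> 1 * k" using s0 k by (intro mult_mono) auto
    finally show ?thesis by simp
  qed
  have n3: "norm (of_real x - of_real s0 :: complex) \<le> k"
    using s0 x norm_of_real[of "x - s0", where 'a = complex] by (simp add: s0_def)
  have "norm (E ?y * (Q j (of_real x) - Q j ?y)) \<le>
    norm (E ?y * Q j (of_real x) - E ?y * Q j (of_real s0)) +
    norm (E ?y * Q j (of_real s0) - E ?y * Q j ?y)"
    using norm_triangle_ineq[of "E ?y * Q j (of_real x) - E ?y * Q j (of_real s0)"
      "E ?y * Q j (of_real s0) - E ?y * Q j ?y"]
    by (simp add: algebra_simps)
  also have "\<dots> \<le> 1 * k + exp D * k"
    using n2 n3 by (intro add_mono order.trans[OF seg3] order.trans[OF seg2] mult_left_mono) auto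
  also have "\<dots> \<le> 2 * exp D * k" using k D1 by (simp add: mult_right_mono)
  finally have 23: "norm (E ?y * (Q j (of_real x) - Q j ?y)) \<le> 2 * exp D * k" .
  \<comment> \<open>The legs beyond \<open>s0 w\<close> were estimated with P evaluated there; the
    ray bound at s = s0 transports that estimate to the endpoint \<open>r w\<close>.\<close>
  have "norm (E ?z * (Q j (of_real x) - Q j ?y)) =
     norm (E ?z) * exp (- Re (lser P.cb ?y)) *
     norm (E ?y * (Q j (of_real x) - Q j ?y))"
    by (simp add: norm_mult exp_minus)
  also have "\<dots> \<le> 4 * W.gf r / ?Wj * (2 * exp D * k)"
    using W s0 23 by (intro mult_mono ray) auto
  finally have b: "norm (E ?z * (Q j (of_real x) - Q j ?y)) \<le>
     4 * W.gf r / ?Wj * (2 * exp D * k)" .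
  have a: "norm (E ?z * Q j ?y - E ?z * Q j ?z)
     \<le> 4 * W.gf r / ?Wj * (exp D * k)"
  proof -
    have "1 * k \<le> exp D * k" using k D1 by (intro mult_right_mono) auto
    then show ?thesis
      using n1 W by (intro order.trans[OF seg1] mult_left_mono) auto
  qed
  have "norm (E ?z * (Q j (of_real x) - Q j ?z)) \<le>
     norm (E ?z * (Q j (of_real x) - Q j ?y)) +
     norm (E ?z * Q j ?y - E ?z * Q j ?z)"
    using norm_triangle_ineq[of "E ?z * (Q j (of_real x) - Q j ?y)"
      "E ?z * Q j ?y - E ?z * Q j ?z"]
    by (simp add: algebra_simps)
  also have "\<dots> \<le> 4 * W.gf r / ?Wj * (2 * exp D * k) + 4 * W.gf r / ?Wj * (exp D * k)"
    by (intro add_mono a b)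
  also have "\<dots> = 12 * exp D * k * W.gf r / ?Wj" by (simp add: field_simps)
  finally show ?thesis .
qed

end

section \<open>Estimates for the renewal solutions\<close>

text \<open>Dividing the generating function by 1 - z adds 1 to every coefficient of the recursion
  and sums the sources. The source at 0 enters only through the initial value.\<close>

lemma renewal_partial_sum:
  fixes b s :: "nat \<Rightarrow> 'a::real_normed_field"
  defines "R \<equiv> \<lambda>n. \<Sum>i\<le>n. renewal b s i"
  shows "of_nat n * R n = (\<Sum>m<n. R m) + (\<Sum>k=1..n. b k * R (n - k)) + (\<Sum>i=1..n. s i)"
proof (induction n)
  case (Suc n)
  have R: "R (Suc m) = R m + renewal b s (Suc m)" for m by (simp add: R_def)
  have "(\<Sum>k=1..Suc n. b k * R (Suc n - k)) =
      (\<Sum>k=1..n. b k * R (Suc n - k)) + b (Suc n) * R 0" by simp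
  also have "(\<Sum>k=1..n. b k * R (Suc n - k)) =
      (\<Sum>k=1..n. b k * R (n - k) + b k * renewal b s (Suc n - k))"
    by (rule sum.cong[OF refl]) (auto simp: Suc_diff_le R ring_distribs)
  also have "\<dots> = (\<Sum>k=1..n. b k * R (n - k)) + (\<Sum>k=1..n. b k * renewal b s (Suc n - k))"
    by (rule sum.distrib)
  also have "b (Suc n) * R 0 = b (Suc n) * renewal b s (Suc n - Suc n)" by (simp add: R_def)
  finally have 1: "(\<Sum>k=1..Suc n. b k * R (Suc n - k)) = (\<Sum>k=1..n. b k * R (n - k)) +
      (\<Sum>k=1..Suc n. b k * renewal b s (Suc n - k))"
    by simp
  have "of_nat (Suc n) * R (Suc n) = of_nat n * R n + R n + of_nat (Suc n) * renewal b s (Suc n)"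
    by (simp add: R ring_distribs)
  also have "of_nat (Suc n) * renewal b s (Suc n) = (\<Sum>k=1..Suc n. b k * renewal b s (Suc n - k)) + s (Suc n)"
    by (rule renewal_rec) simp
  finally show ?case using 1 Suc.IH by simp
qed simp

text \<open>Comparison with the integral of u^(\<delta> - 1) by the mean value theorem on unit
  intervals; on the first one, only continuity is used at 0.\<close>

lemma sum_powr_le:
  fixes \<delta> :: real
  assumes "0 < \<delta>" "\<delta> \<le> 1"
  shows "(\<Sum>i=1..j. real i powr (\<delta> - 1)) \<le> real j powr \<delta> / \<delta>"
proof (induction j)
  case (Suc j)
  have "real (Suc j) powr (\<delta> - 1) \<le> (real (Suc j) powr \<delta> - real j powr \<delta>) / \<delta>"
  proof -
    have "((\<lambda>u. u powr \<delta>) has_real_derivative \<delta> * u powr (\<delta> - 1)) (at u)" if "real j < u" for u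
      using that by (auto intro!: derivative_eq_intros)
    moreover have "continuous_on {real j..real (Suc j)} (\<lambda>u. u powr \<delta>)"
      using assms by (intro continuous_on_powr') (auto intro!: continuous_intros)
    ultimately obtain u where u: "real j < u" "u < real (Suc j)"
      "real (Suc j) powr \<delta> - real j powr \<delta> = (real (Suc j) - real j) * (\<delta> * u powr (\<delta> - 1))"
      using MVT[of "real j" "real (Suc j)" "\<lambda>u. u powr \<delta>"] by (metis DERIV_unique lessI of_nat_less_iff real_differentiable_def)
    have "real (Suc j) powr (\<delta> - 1) \<le> u powr (\<delta> - 1)"
      using u assms by (intro powr_mono2') auto
    then show ?thesis using u assms by (simp add: field_simps)
  qed
  then show ?case using Suc.IH by (simp add: diff_divide_distrib)
qed (use assms in simp)

text \<open>Each term is at most 2 / sqrt s - 2 / sqrt (s + 1), so the sum telescopes.\<close>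

lemma sum_sqrt_tail_le:
  assumes "1 \<le> j" "j \<le> n"
  shows "(\<Sum>s=j..<n. 1 / (real (Suc s) * sqrt (real s))) \<le> 2 / sqrt (real j)"
proof -
  have "(\<Sum>s=j..<n. 1 / (real (Suc s) * sqrt (real s))) \<le>
      (\<Sum>s=j..<n. (- 2 / sqrt (real (Suc s))) - (- 2 / sqrt (real s)))"
  proof (rule sum_mono)
    fix s assume "s \<in> {j..<n}"
    then have s: "0 < real s" using assms by simp
    let ?x = "sqrt (real s)" and ?y = "sqrt (real (Suc s))"
    have xy: "0 < ?x" "?x \<le> ?y" "?y * ?y = ?x * ?x + 1" "real (Suc s) = ?y * ?y" using s by auto
    have "(?y - ?x) * (?y + ?x) = 1" using xy by (simp add: algebra_simps)
    moreover have "(?y - ?x) * (?y + ?x) \<le> (?y - ?x) * (2 * ?y)"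
      using xy by (intro mult_left_mono) auto
    ultimately have "1 \<le> 2 * ?y * (?y - ?x)" by (simp add: mult_ac)
    then have "1 / (?y * ?y * ?x) \<le> 2 * ?y * (?y - ?x) / (?y * ?y * ?x)"
      using xy by (intro divide_right_mono) auto
    also have "\<dots> = (- 2 / ?y) - (- 2 / ?x)"
    proof -
      have *: "2 * y * (y - x) / (y * y * x) = (- 2 / y) - (- 2 / x)" if "0 < x" "0 < y" for x y :: real
        using that by (simp add: field_simps)
      show ?thesis by (rule *) (use xy in auto)
    qed
    finally show "1 / (real (Suc s) * ?x) \<le> (- 2 / ?y) - (- 2 / ?x)" using xy(4) by simp
  qed
  also have "\<dots> = (- 2 / sqrt (real n)) - (- 2 / sqrt (real j))"
    by (rule sum_Suc_diff') (use assms in simp)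
  also have "\<dots> \<le> 2 / sqrt (real j)" by simp
  finally show ?thesis .
qed

section \<open>Partial sums of V, and V itself\<close>

context weights
begin

abbreviation Wc :: "nat \<Rightarrow> real" where "Wc j \<equiv> W.gf (cutoff j)"

definition V :: "nat \<Rightarrow> real \<Rightarrow> nat \<Rightarrow> complex" where
  "V j x = renewal P.cb (\<lambda>k. Q j (of_real x) * unit_at 0 k - unit_at j k)"

definition VV :: "nat \<Rightarrow> real \<Rightarrow> nat \<Rightarrow> complex" where
  "VV j x s = (\<Sum>i\<le>s. V j x i)"

lemma V_eq: "V j x i = Q j (of_real x) * renewal P.cb (unit_at 0) i - renewal P.cb (unit_at j) i"
proof -
  have "V j x i = renewal P.cb (\<lambda>k. Q j (of_real x) * unit_at 0 k + (-1) * unit_at j k) i"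
    by (simp add: V_def)
  then show ?thesis unfolding renewal_add renewal_cmult by simp
qed

lemma V_sums:
  assumes "1 \<le> j" "norm z < 1"
  shows "(\<lambda>n. V j x n * z ^ n) sums (E z * (Q j (of_real x) - Q j z))"
  using P.exp_lser_ode_sums[OF assms, of "Q j (of_real x)" "-1"] by (simp add: V_def)

text \<open>The constants 8 and 12 of \<open>V_bound_far\<close> and \<open>V_bound_near\<close>,
  doubled by the division by 1 - z, because |1 - r w| is at least half of |1 - w| and of max (|1 -
  w|, 1 - r).\<close>

definition CV :: real where "CV = 16 * W.K + 24 * exp D"

lemma CV_pos: "0 < CV" using W.K_pos by (simp add: CV_def add_pos_pos)

text \<open>With y = j |1 - w|, the far estimate gives 1/y and the near one a constant. Both squares
  are below 2 / (1 + y^2) in their ranges, and that majorant has an explicit integral of order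
  1/j.\<close>

lemma V_quotient_bound:
  assumes j: "1 \<le> j" and r: "cutoff j \<le> r" "r < 1" and x: "r \<le> x" "x < 1"
    and w: "norm w = 1"
  shows "(norm (E (of_real r * w) * (Q j (of_real x) - Q j (of_real r * w)) / (1 - of_real r * w)))\<^sup>2
    \<le> 2 * (CV * (W.gf r / Wc j))\<^sup>2 / (1 + (real j * norm (1 - w))\<^sup>2)"
proof -
  let ?\<eta> = "norm (1 - w)" and ?q = "W.gf r / Wc j"
  let ?N = "norm (E (of_real r * w) * (Q j (of_real x) - Q j (of_real r * w)))"
  let ?d = "norm (1 - of_real r * w)"
  have "0 \<le> cutoff j" using j by simp
  then have r0: "0 \<le> r" using r by linarith
  have q: "0 < ?q" using W.gf_pos by simp
  have eq: "norm (E (of_real r * w) * (Q j (of_real x) - Q j (of_real r * w)) / (1 - of_real r * w)) = ?N / ?d"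
    by (simp add: norm_divide)
  note dr = dist_ray(2,3)[of w r, OF w r0 less_imp_le[OF r(2)]]
  have d: "0 < ?d" using dr r by linarith
  show ?thesis
  proof (cases "1 / real j \<le> ?\<eta>")
    case True
    then have 1: "1 \<le> real j * ?\<eta>" using j by (simp add: field_simps)
    have "0 < 1 / real j" using j by simp
    then have \<eta>: "0 < ?\<eta>" using True by linarith
    have "?N \<le> 8 * W.K * W.gf r / (real j * Wc j)"
      using True r r0 x by (intro V_bound_far j w) auto
    then have "?N / ?d \<le> (8 * W.K * W.gf r / (real j * Wc j)) / (?\<eta> / 2)"
      using dr \<eta> W.K_pos W.gf_pos[of r] W.gf_pos[of "cutoff j"] by (intro frac_le) auto
    also have "\<dots> = 16 * W.K * ?q / (real j * ?\<eta>)"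
      by (simp add: field_simps)
    also have "\<dots> \<le> CV * ?q / (real j * ?\<eta>)"
      using q 1 by (intro divide_right_mono mult_right_mono) (auto simp: CV_def)
    finally have "(?N / ?d)\<^sup>2 \<le> (CV * ?q / (real j * ?\<eta>))\<^sup>2"
      by (intro power_mono) auto
    also have "\<dots> = (CV * ?q)\<^sup>2 / (real j * ?\<eta>)\<^sup>2" by (rule power_divide)
    also have "\<dots> \<le> (CV * ?q)\<^sup>2 / ((1 + (real j * ?\<eta>)\<^sup>2) / 2)"
    proof (rule divide_left_mono)
      have "1\<^sup>2 \<le> (real j * ?\<eta>)\<^sup>2" using 1 by (intro power_mono) auto
      then show "(1 + (real j * ?\<eta>)\<^sup>2) / 2 \<le> (real j * ?\<eta>)\<^sup>2" by simp
      show "0 < (real j * ?\<eta>)\<^sup>2 * ((1 + (real j * ?\<eta>)\<^sup>2) / 2)"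
        using \<open>1\<^sup>2 \<le> _\<close> j \<eta> by (intro mult_pos_pos) (auto simp: add_pos_nonneg)
    qed simp
    also have "\<dots> = 2 * (CV * ?q)\<^sup>2 / (1 + (real j * ?\<eta>)\<^sup>2)"
      by (simp add: mult.commute)
    finally show ?thesis unfolding eq .
  next
    case False
    then have near: "?\<eta> \<le> 1 / real j" by simp
    then have 1: "real j * ?\<eta> \<le> 1" using j by (simp add: field_simps)
    define \<kappa> where "\<kappa> = max ?\<eta> (1 - r)"
    have \<kappa>: "0 < \<kappa>" "\<kappa> / 2 \<le> ?d" using r dr by (auto simp: \<kappa>_def max_def)
    have "?N \<le> 12 * exp D * \<kappa> * W.gf r / Wc j"
      unfolding \<kappa>_def by (rule V_bound_near[OF j r x w near])
    then have "?N / ?d \<le> (12 * exp D * \<kappa> * W.gf r / Wc j) / (\<kappa> / 2)"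
      using \<kappa> W.gf_pos[of r] W.gf_pos[of "cutoff j"] by (intro frac_le) auto
    also have "\<dots> = 24 * exp D * ?q"
      using \<kappa> by (simp add: field_simps)
    also have "\<dots> \<le> CV * ?q"
      using q W.K_pos by (intro mult_right_mono) (auto simp: CV_def)
    finally have "(?N / ?d)\<^sup>2 \<le> (CV * ?q)\<^sup>2"
      by (intro power_mono) auto
    also have "\<dots> = (CV * ?q)\<^sup>2 / 1" by simp
    also have "\<dots> \<le> (CV * ?q)\<^sup>2 / ((1 + (real j * ?\<eta>)\<^sup>2) / 2)"
    proof (rule divide_left_mono)
      have "(real j * ?\<eta>)\<^sup>2 \<le> 1\<^sup>2" using 1 by (intro power_mono) auto
      then show "(1 + (real j * ?\<eta>)\<^sup>2) / 2 \<le> 1" by simp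
    qed (auto simp: add_pos_nonneg)
    also have "\<dots> = 2 * (CV * ?q)\<^sup>2 / (1 + (real j * ?\<eta>)\<^sup>2)"
      by (simp add: mult.commute)
    finally show ?thesis unfolding eq .
  qed
qed

text \<open>32 = 8 * 4: the Lorentzian integral gives 8 after arctan \<le> 2, and undoing r^m \<ge>
  1/2 in the squares gives 4. The power of 2 comes from \<open>gf_double\<close>.\<close>

definition CB :: real where "CB = 32 * CV\<^sup>2 * (2 powr D)\<^sup>2"

text \<open>Bessel's inequality for V(z) / (1 - z) at radius 1 - 1/(2N), where powers up to N stay
  above 1/2. The factor 1/j reflects that the mass lies on an arc of length about 1/j around
  1.\<close>

lemma VV_square_sum:
  assumes j: "1 \<le> j" "j \<le> N" and x: "1 - 1 / (2 * real N) \<le> x" "x < 1"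
  shows "(\<Sum>m\<le>N. (norm (VV j x m))\<^sup>2) \<le> CB * (Wc N / Wc j)\<^sup>2 / real j"
proof -
  define r where "r = 1 - 1 / (2 * real N)"
  have N: "1 \<le> N" using j by simp
  have r: "0 < r" "r < 1" "r \<le> x" using N x by (auto simp: r_def field_simps)
  have jr: "cutoff j \<le> r"
    using j by (auto simp: r_def field_simps)
  let ?q = "W.gf r / Wc j"
  let ?f = "\<lambda>z. E z * (Q j (of_real x) - Q j z) / (1 - z)"
  define F where "F = Abs_fps (V j x) * Abs_fps (\<lambda>_. 1)"
  have nF: "fps_nth F m = VV j x m" for m
    by (simp add: F_def fps_mult_nth VV_def atLeast0AtMost)
  have ev: "eventually (\<lambda>z. z \<in> ball (0::complex) 1) (nhds 0)"
    by (rule eventually_nhds_in_open) auto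
  have "(\<lambda>z. E z * (Q j (of_real x) - Q j z)) has_fps_expansion Abs_fps (V j x)"
    by (rule has_fps_expansionI, use ev in eventually_elim) (use V_sums[OF j(1)] in simp)
  moreover have "(\<lambda>z. 1 / (1 - z)) has_fps_expansion (Abs_fps (\<lambda>_. 1) :: complex fps)"
    by (rule has_fps_expansionI, use ev in eventually_elim) (use geometric_sums in simp)
  ultimately have "(\<lambda>z. E z * (Q j (of_real x) - Q j z) * (1 / (1 - z))) has_fps_expansion F"
    unfolding F_def by (rule has_fps_expansion_mult)
  then have F: "?f has_fps_expansion F" by simp
  have hol1: "lser P.cb holomorphic_on ball 0 1"
    unfolding holomorphic_on_open[OF open_ball] using P.c.lser_deriv[where A = UNIV] by (intro ballI exI) simp
  have hol2: "Q j holomorphic_on ball 0 1"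
    unfolding holomorphic_on_open[OF open_ball] using prim_spec(2)[OF P.c.bounded_coeffs_axioms]
    by (intro ballI exI) simp
  have hol: "?f holomorphic_on ball 0 1"
    by (intro holomorphic_intros hol1 hol2) auto
  let ?L = "\<lambda>t. 1 / (1 + (real j * t)\<^sup>2) + 1 / (1 + (real j * (1 - t))\<^sup>2)"
  have g: "((\<lambda>t. 2 * (CV * ?q)\<^sup>2 * ?L t) has_integral 2 * (CV * ?q)\<^sup>2 * (2 * arctan (real j) / real j)) {0..1}"
    using j by (intro has_integral_mult_right has_integral_lorentzian) simp
  have bd: "(norm (?f (of_real r * cis (2 * pi * t))))\<^sup>2 \<le> 2 * (CV * ?q)\<^sup>2 * ?L t"
    if t: "0 \<le> t" "t \<le> 1" for t
  proof -
    let ?\<eta> = "norm (1 - cis (2 * pi * t))"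
    have "(norm (?f (of_real r * cis (2 * pi * t))))\<^sup>2 \<le> 2 * (CV * ?q)\<^sup>2 / (1 + (real j * ?\<eta>)\<^sup>2)"
      using r x by (intro V_quotient_bound[OF j(1) jr]) auto
    also have "\<dots> = 2 * (CV * ?q)\<^sup>2 * (1 / (1 + (real j * ?\<eta>)\<^sup>2))" by simp
    also have "\<dots> \<le> 2 * (CV * ?q)\<^sup>2 * ?L t"
    proof (rule mult_left_mono)
      have le: "1 / (1 + (real j * ?\<eta>)\<^sup>2) \<le> 1 / (1 + (real j * s)\<^sup>2)" if "0 \<le> s" "s \<le> ?\<eta>" for s
        using that by (intro divide_left_mono add_left_mono power_mono mult_left_mono mult_pos_pos)
          (auto simp: add_pos_nonneg)
      have nn: "0 \<le> 1 / (1 + (real j * s)\<^sup>2)" for s by simp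
      have "min t (1 - t) \<le> ?\<eta>" by (rule dist_cis_ge[OF t])
      then consider "t \<le> ?\<eta>" | "1 - t \<le> ?\<eta>" by linarith
      then show "1 / (1 + (real j * ?\<eta>)\<^sup>2) \<le> ?L t"
        using le[of t] le[of "1 - t"] nn[of t] nn[of "1 - t"] t by cases linarith+
    qed simp
    finally show ?thesis .
  qed
  have "(\<Sum>m\<le>N. (norm (VV j x m) * r ^ m)\<^sup>2) \<le> 2 * (CV * ?q)\<^sup>2 * (2 * arctan (real j) / real j)"
    using bessel_circle[OF hol r(1,2) F g bd, of N] unfolding nF .
  also have "\<dots> \<le> 2 * (CV * ?q)\<^sup>2 * (2 * 2 / real j)"
  proof -
    have "arctan (real j) \<le> 2" using arctan_ubound[of "real j"] pi_less_4 by linarith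
    then show ?thesis using j by (intro mult_left_mono divide_right_mono) auto
  qed
  finally have B: "(\<Sum>m\<le>N. (norm (VV j x m) * r ^ m)\<^sup>2) \<le> 8 * (CV * ?q)\<^sup>2 / real j" by simp
  have half: "1 / 2 \<le> r ^ m" if "m \<le> N" for m
  proof -
    have "1 / 2 \<le> r ^ N"
      using Bernoulli_inequality[of "- 1 / (2 * real N)" N] N by (simp add: field_simps r_def)
    then show ?thesis using power_decreasing[OF that, of r] r by linarith
  qed
  have "(\<Sum>m\<le>N. (norm (VV j x m))\<^sup>2 / 4) \<le> (\<Sum>m\<le>N. (norm (VV j x m) * r ^ m)\<^sup>2)"
  proof (rule sum_mono)
    fix m assume "m \<in> {..N}"
    then have "(norm (VV j x m) * (1 / 2))\<^sup>2 \<le> (norm (VV j x m) * r ^ m)\<^sup>2"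
      using half by (intro power_mono mult_left_mono) auto
    then show "(norm (VV j x m))\<^sup>2 / 4 \<le> (norm (VV j x m) * r ^ m)\<^sup>2"
      by (simp add: power_mult_distrib power_divide)
  qed
  with B have "(\<Sum>m\<le>N. (norm (VV j x m))\<^sup>2) \<le> 32 * (CV * ?q)\<^sup>2 / real j"
    by (simp flip: sum_divide_distrib)
  also have "\<dots> \<le> 32 * (CV * (2 powr D * (Wc N / Wc j)))\<^sup>2 / real j"
  proof -
    have "?q \<le> 2 powr D * Wc N / Wc j"
      unfolding r_def using W.gf_double[OF N] W.gf_pos[of "cutoff j"] by (intro divide_right_mono) auto
    then show ?thesis
      using CV_pos W.gf_pos[of r] W.gf_pos[of "cutoff j"]
      by (intro divide_right_mono mult_left_mono power_mono) auto
  qed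
  also have "\<dots> = CB * (Wc N / Wc j)\<^sup>2 / real j"
    by (simp add: CB_def power_mult_distrib power_divide)
  finally show ?thesis .
qed

lemma norm_Q_real_le: "1 \<le> j \<Longrightarrow> 0 \<le> x \<Longrightarrow> x < 1 \<Longrightarrow>
    norm (Q j (of_real x)) \<le> 2 * W.K / (real j * (Wc j * real j powr \<delta>))"
  using P.norm_prim_real_le[of x j] by (simp add: gf_cutoff)

definition CS :: real where "CS = (D + 1) * sqrt CB + 1"

lemma CB_pos: "0 < CB" using CV_pos by (simp add: CB_def)

lemma CS_pos: "0 < CS" using D1 CB_pos by (simp add: CS_def add_pos_pos)

text \<open>The recursion of \<open>renewal_partial_sum\<close> bounds s |VV_s| by D + 1 times the
  sum of the earlier moduli plus 1, the source at j. Cauchy-Schwarz brings in the mean-square bound;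
  the 1 is absorbed because W and s have not decreased since j.\<close>

lemma norm_VV_le:
  assumes j: "1 \<le> j" "j \<le> s" and x: "1 - 1 / (2 * real s) \<le> x" "x < 1"
  shows "norm (VV j x s) \<le> CS * Wc s / (Wc j * sqrt (real j * real s))"
proof -
  have s: "1 \<le> s" using j by simp
  let ?q = "Wc s / Wc j"
  have "0 \<le> cutoff j" "cutoff j \<le> cutoff s" using j by (auto simp: frac_le)
  then have q: "1 \<le> ?q" using W.gf_mono[of "cutoff j" "cutoff s"] W.gf_pos[of "cutoff j"] s by simp
  define M where "M = (\<Sum>m<s. norm (VV j x m))"
  have "M\<^sup>2 = (\<Sum>m<s. 1 * norm (VV j x m))\<^sup>2" by (simp add: M_def)
  also have "\<dots> \<le> (\<Sum>m<s. 1\<^sup>2) * (\<Sum>m<s. (norm (VV j x m))\<^sup>2)"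
    by (rule Cauchy_Schwarz_ineq_sum)
  also have "\<dots> \<le> real s * (\<Sum>m\<le>s. (norm (VV j x m))\<^sup>2)"
    by (auto intro!: mult_left_mono sum_mono2)
  also have "\<dots> \<le> real s * (CB * ?q\<^sup>2 / real j)"
    by (intro mult_left_mono VV_square_sum j x) simp
  finally have "M \<le> sqrt (real s * (CB * ?q\<^sup>2 / real j))"
    by (rule real_le_rsqrt)
  also have "\<dots> = sqrt CB * ?q * (sqrt (real s) / sqrt (real j))"
    by (simp add: real_sqrt_mult real_sqrt_divide abs_of_pos[OF W.gf_pos])
  finally have M: "M \<le> sqrt CB * ?q * (sqrt (real s) / sqrt (real j))" .
  have "of_nat s * VV j x s = (\<Sum>m<s. VV j x m) + (\<Sum>k=1..s. P.cb k * VV j x (s - k)) +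
      (\<Sum>i=1..s. Q j (of_real x) * unit_at 0 i - unit_at j i)"
    unfolding VV_def V_def by (rule renewal_partial_sum)
  also have "(\<Sum>i=1..s. Q j (of_real x) * unit_at 0 i - unit_at j i) = (\<Sum>i=1..s. if j = i then - 1 else 0)"
    by (rule sum.cong) (auto simp: unit_at_def)
  also have "\<dots> = -1" using j by simp
  finally have "real s * norm (VV j x s) = norm ((\<Sum>m<s. VV j x m) + (\<Sum>k=1..s. P.cb k * VV j x (s - k)) + - 1)"
    by (metis norm_mult norm_of_nat)
  also have "\<dots> \<le> M + D * M + 1"
  proof (intro order.trans[OF norm_triangle_ineq] add_mono)
    show "norm (\<Sum>m<s. VV j x m) \<le> M" unfolding M_def by (rule norm_sum)
    have "norm (\<Sum>k=1..s. P.cb k * VV j x (s - k)) \<le> (\<Sum>k=1..s. D * norm (VV j x (s - k)))"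
      using P.c.norm_b by (intro sum_norm_le) (auto simp: norm_mult intro!: mult_right_mono)
    also have "\<dots> = D * (\<Sum>k=1..s. norm (VV j x (s - k)))" by (simp add: sum_distrib_left)
    also have "(\<Sum>k=1..s. norm (VV j x (s - k))) = M"
      unfolding M_def by (rule sum.reindex_bij_witness[of _ "\<lambda>m. s - m" "\<lambda>k. s - k"]) auto
    finally show "norm (\<Sum>k=1..s. P.cb k * VV j x (s - k)) \<le> D * M" .
  qed simp
  also have "\<dots> \<le> (D + 1) * (sqrt CB * ?q * (sqrt (real s) / sqrt (real j))) + ?q * (sqrt (real s) / sqrt (real j))"
  proof -
    have "1 * 1 \<le> ?q * (sqrt (real s) / sqrt (real j))"
      using q j by (intro mult_mono) auto
    moreover have "(D + 1) * M \<le> (D + 1) * (sqrt CB * ?q * (sqrt (real s) / sqrt (real j)))"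
      using M D1 by (intro mult_left_mono) auto
    ultimately show ?thesis by (simp add: ring_distribs)
  qed
  also have "\<dots> = real s * (CS * ?q / (sqrt (real j) * sqrt (real s)))"
  proof -
    have "real s = sqrt (real s) * sqrt (real s)" by simp
    then have eq: "sqrt (real s) / sqrt (real j) = real s / (sqrt (real j) * sqrt (real s))"
      using s j by (simp add: field_simps)
    have A: "(D + 1) * (sqrt CB * ?q * y) + ?q * y = CS * ?q * y" for y
      by (simp only: CS_def) algebra
    show ?thesis unfolding A eq by simp
  qed
  finally have "norm (VV j x s) \<le> CS * ?q / (sqrt (real j) * sqrt (real s))"
    by (rule mult_left_le_imp_le) (use s in simp)
  then show ?thesis by (simp add: real_sqrt_mult)
qed

text \<open>Before index j the unit source is not yet active, so \<open>V\<close> is a multiple of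
  the coefficients of P and their partial sums are known.\<close>

lemma VV_below:
  assumes j: "1 \<le> j" and i: "1 \<le> i" "i \<le> j" and x: "0 \<le> x" "x < 1"
  shows "norm (VV j x (i - 1)) \<le> 4 * W.K * 2 powr D * (real i powr \<delta> * Wc i) /
     (real j * (Wc j * real j powr \<delta>))"
proof -
  have "VV j x (i - 1) = (\<Sum>m\<le>i - 1. Q j (of_real x) * of_real (renewal a (unit_at 0) m))"
    unfolding VV_def using i
    by (intro sum.cong) (auto simp: V_eq P.renewal_cb renewal_unit_at_less)
  also have "\<dots> = Q j (of_real x) * of_real (\<Sum>m\<le>i - 1. renewal a (unit_at 0) m)"
    by (simp add: sum_distrib_left)
  also have "norm \<dots> = norm (Q j (of_real x)) * (\<Sum>m\<le>i - 1. renewal a (unit_at 0) m)"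
    unfolding norm_mult norm_of_real using P.renewal_unit_nonneg by (simp add: sum_nonneg)
  also have "\<dots> \<le> 2 * W.K / (real j * (Wc j * real j powr \<delta>)) * (2 * 2 powr D * P.gf (cutoff i))"
  proof (rule mult_mono)
    show "norm (Q j (of_real x)) \<le> 2 * W.K / (real j * (Wc j * real j powr \<delta>))"
      by (rule norm_Q_real_le[OF j x])
    have "(\<Sum>m\<le>i - 1. renewal a (unit_at 0) m) \<le> (\<Sum>m\<le>i. renewal a (unit_at 0) m)"
      using P.renewal_unit_nonneg by (intro sum_mono2) auto
    also have "\<dots> \<le> 2 * 2 powr D * P.gf (cutoff i)" by (rule P.sum_renewal_0_le[OF i(1)])
    finally show "(\<Sum>m\<le>i - 1. renewal a (unit_at 0) m) \<le> 2 * 2 powr D * P.gf (cutoff i)" .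
  qed (use P.renewal_unit_nonneg W.K_pos W.gf_pos[of "cutoff j"] in \<open>auto intro!: sum_nonneg divide_nonneg_nonneg mult_nonneg_nonneg\<close>)
  also have "P.gf (cutoff i) = Wc i * real i powr \<delta>" by (rule gf_cutoff[OF i(1)])
  finally show ?thesis by (simp add: mult_ac)
qed

definition CQ :: real where "CQ = 4 * W.K * 2 powr D / \<delta> + 2 * CS"

text \<open>The weights 1 / (i W) are the Green function bound of the excess recursion, so this is
  the total effect of the partial sums as sources. Up to j the terms are of size i^(\<delta> - 1),
  with sum of order j^\<delta>, which cancels; beyond j they decay like s^(-3/2).\<close>

lemma VV_weighted_sum:
  assumes j: "1 \<le> j" "j \<le> n" and x: "1 - 1 / (2 * real n) \<le> x" "x < 1"
  shows "(\<Sum>i=1..<n. norm (VV j x (i - 1)) / (real i * Wc i)) \<le> CQ / (real j * Wc j)"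
proof -
  let ?Wj = "Wc j"
  let ?g = "\<lambda>i. norm (VV j x (i - 1)) / (real i * Wc i)"
  have n: "1 \<le> n" using j by simp
  have "0 \<le> 1 - 1 / (2 * real n)" using n by (simp add: field_simps)
  then have x0: "0 \<le> x" using x by linarith
  have g0: "0 \<le> ?g i" for i using W.gf_pos[of "cutoff i"] by simp
  have "(\<Sum>i=1..<n. ?g i) \<le> (\<Sum>i=1..j. ?g i) + (\<Sum>s=j..<n. ?g (Suc s))"
  proof -
    have "(\<Sum>i=1..<n. ?g i) \<le> (\<Sum>i\<in>{1..j} \<union> Suc ` {j..<n}. ?g i)"
      using g0 j by (intro sum_mono2) (auto simp: image_Suc_atLeastLessThan)
    also have "\<dots> = (\<Sum>i=1..j. ?g i) + (\<Sum>i\<in>Suc ` {j..<n}. ?g i)"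
      by (rule sum.union_disjoint) auto
    also have "(\<Sum>i\<in>Suc ` {j..<n}. ?g i) = (\<Sum>s=j..<n. ?g (Suc s))"
      by (subst sum.reindex) auto
    finally show ?thesis .
  qed
  also have "(\<Sum>i=1..j. ?g i) \<le> (4 * W.K * 2 powr D / \<delta>) / (real j * ?Wj)"
  proof -
    let ?c = "4 * W.K * 2 powr D / (real j * (?Wj * real j powr \<delta>))"
    have "(\<Sum>i=1..j. ?g i) \<le> (\<Sum>i=1..j. ?c * real i powr (\<delta> - 1))"
    proof (rule sum_mono)
      fix i assume i: "i \<in> {1..j}"
      have "?g i \<le> (4 * W.K * 2 powr D * (real i powr \<delta> * Wc i) / (real j * (?Wj * real j powr \<delta>))) / (real i * Wc i)"
        using W.gf_pos[of "cutoff i"] i by (intro divide_right_mono VV_below j x0 x) auto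
      also have "\<dots> = ?c * (real i powr \<delta> / real i)"
        using W.gf_pos[of "cutoff i"] by (simp add: field_simps)
      also have "real i powr \<delta> / real i = real i powr (\<delta> - 1)"
        using i by (simp add: powr_diff)
      finally show "?g i \<le> ?c * real i powr (\<delta> - 1)" .
    qed
    also have "\<dots> = ?c * (\<Sum>i=1..j. real i powr (\<delta> - 1))" by (simp add: sum_distrib_left)
    also have "\<dots> \<le> ?c * (real j powr \<delta> / \<delta>)"
      using W.K_pos W.gf_pos[of "cutoff j"] by (intro mult_left_mono sum_powr_le \<delta>) auto
    also have "\<dots> = (4 * W.K * 2 powr D / \<delta>) / (real j * ?Wj)"
      using j by (simp add: field_simps)
    finally show ?thesis .
  qed
  also have "(\<Sum>s=j..<n. ?g (Suc s)) \<le> (2 * CS) / (real j * ?Wj)"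
  proof -
    let ?c = "CS / (?Wj * sqrt (real j))"
    have c0: "0 \<le> ?c" using CS_pos W.gf_pos[of "cutoff j"] by simp
    have "(\<Sum>s=j..<n. ?g (Suc s)) \<le> (\<Sum>s=j..<n. ?c * (1 / (real (Suc s) * sqrt (real s))))"
    proof (rule sum_mono)
      fix s assume s: "s \<in> {j..<n}"
      then have s1: "1 \<le> s" using j by simp
      have "1 - 1 / (2 * real s) \<le> 1 - 1 / (2 * real n)" using s s1 by (simp add: frac_le)
      then have "norm (VV j x s) \<le> CS * Wc s / (?Wj * sqrt (real j * real s))"
        using s x by (intro norm_VV_le j) auto
      also have "\<dots> \<le> CS * Wc (Suc s) / (?Wj * sqrt (real j * real s))"
      proof -
        have "1 / real (Suc s) \<le> 1 / real s" using s1 by (intro divide_left_mono) auto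
        then have "Wc s \<le> Wc (Suc s)"
          using s1 by (intro W.gf_mono) auto
        then show ?thesis using CS_pos W.gf_pos[of "cutoff j"]
          by (intro divide_right_mono mult_left_mono) auto
      qed
      finally have A: "norm (VV j x s) \<le> CS * Wc (Suc s) / (?Wj * sqrt (real j * real s))" .
      have "?g (Suc s) = norm (VV j x s) / (real (Suc s) * Wc (Suc s))"
        by (simp only: diff_Suc_1)
      also have "\<dots> \<le> (CS * Wc (Suc s) / (?Wj * sqrt (real j * real s))) / (real (Suc s) * Wc (Suc s))"
        using W.gf_pos[of "cutoff (Suc s)"] by (intro divide_right_mono A) (simp del: of_nat_Suc)
      also have "\<dots> = ?c * (1 / (real (Suc s) * sqrt (real s)))"
        using W.gf_pos[of "cutoff (Suc s)"] by (simp add: real_sqrt_mult field_simps del: of_nat_Suc)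
      finally show "?g (Suc s) \<le> ?c * (1 / (real (Suc s) * sqrt (real s)))" .
    qed
    also have "\<dots> = ?c * (\<Sum>s=j..<n. 1 / (real (Suc s) * sqrt (real s)))" by (simp add: sum_distrib_left)
    also have "\<dots> \<le> ?c * (2 / sqrt (real j))"
      by (intro mult_left_mono sum_sqrt_tail_le j c0)
    also have "\<dots> = (2 * CS) / (real j * ?Wj)"
      using j by (simp add: field_simps)
    finally show ?thesis .
  qed
  finally show ?thesis by (simp add: CQ_def add_divide_distrib)
qed

text \<open>A source at the final index n has the Green function 1/n, outside the range of
  \<open>renewal_unit_le\<close>, and is treated separately. For j = n the index n - 1 lies before
  the unit source.\<close>

lemma norm_VV_last:
  assumes j: "1 \<le> j" "j \<le> n" and x: "1 - 1 / (2 * real n) \<le> x" "x < 1"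
  shows "norm (VV j x (n - 1)) \<le> (4 * W.K * 2 powr D + CS) * Wc n / (real j * Wc j)"
proof (cases "j = n")
  case True
  have "0 \<le> 1 - 1 / (2 * real n)" using j by (simp add: field_simps)
  then have x0: "0 \<le> x" using x by linarith
  have "norm (VV j x (n - 1)) \<le> 4 * W.K * 2 powr D * (real n powr \<delta> * Wc n) /
     (real j * (Wc j * real j powr \<delta>))"
    using j True x0 x by (intro VV_below) auto
  also have "\<dots> = 4 * W.K * 2 powr D * Wc n / (real j * Wc j)"
    using True j by (simp add: field_simps)
  also have "\<dots> \<le> (4 * W.K * 2 powr D + CS) * Wc n / (real j * Wc j)"
    using CS_pos W.gf_pos[of "cutoff j"] W.gf_pos[of "cutoff n"]
    by (intro divide_right_mono mult_right_mono) auto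
  finally show ?thesis .
next
  case False
  let ?s = "n - 1"
  have s: "j \<le> ?s" "1 \<le> ?s" "real ?s \<le> real n" using False j by auto
  have "1 - 1 / (2 * real ?s) \<le> 1 - 1 / (2 * real n)" using s j by (simp add: frac_le)
  then have "norm (VV j x ?s) \<le> CS * Wc ?s / (Wc j * sqrt (real j * real ?s))"
    using s x by (intro norm_VV_le j) auto
  also have "\<dots> \<le> ((4 * W.K * 2 powr D + CS) * Wc n) / (Wc j * real j)"
  proof (rule frac_le)
    have "1 / real n \<le> 1 / real ?s" using s by (intro divide_left_mono) auto
    then have "Wc ?s \<le> Wc n" using s j by (intro W.gf_mono) auto
    then show "CS * Wc ?s \<le> (4 * W.K * 2 powr D + CS) * Wc n"
      using CS_pos W.K_pos W.gf_pos by (intro mult_mono) (auto intro: less_imp_le)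
    have "real j \<le> sqrt (real j * real ?s)"
      using s by (intro real_le_rsqrt) (simp only: power2_eq_square, intro mult_left_mono, auto)
    then show "Wc j * real j \<le> Wc j * sqrt (real j * real ?s)"
      using W.gf_pos[of "cutoff j"] by (intro mult_left_mono) auto
  qed (use W.gf_pos[of "cutoff j"] W.gf_pos[of "cutoff n"] W.K_pos CS_pos j in \<open>auto intro!: mult_nonneg_nonneg\<close>)
  finally show ?thesis by (simp add: mult_ac)
qed

lemma V_excess_rec:
  assumes "1 \<le> j"
  shows "V j x n = renewal W.cb (\<lambda>k. if k = 0 then Q j (of_real x) else of_real \<delta> * VV j x (k - 1) - unit_at j k) n"
proof (rule renewal_eqI[of _ _ n])
  show "V j x 0 = (if 0 = 0 then Q j (of_real x) else of_real \<delta> * VV j x (0 - 1) - unit_at j 0)"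
    using assms by (simp add: V_def unit_at_def)
  fix m :: nat assume m: "0 < m"
  have "(\<Sum>k=1..m. V j x (m - k)) = VV j x (m - 1)"
    unfolding VV_def using m by (intro sum.reindex_bij_witness[of _ "\<lambda>i. m - i" "\<lambda>k. m - k"]) auto
  moreover have "of_nat m * V j x m = (\<Sum>k=1..m. P.cb k * V j x (m - k)) - unit_at j m"
    unfolding V_def using renewal_rec[OF m, of P.cb] m by (simp add: unit_at_def)
  moreover have "(\<Sum>k=1..m. P.cb k * V j x (m - k)) =
      (\<Sum>k=1..m. W.cb k * V j x (m - k)) + of_real \<delta> * (\<Sum>k=1..m. V j x (m - k))"
    by (simp add: sum_distrib_left ring_distribs flip: sum.distrib)
  ultimately show "of_nat m * V j x m = (\<Sum>k=1..m. W.cb k * V j x (m - k)) +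
     (if m = 0 then Q j (of_real x) else of_real \<delta> * VV j x (m - 1) - unit_at j m)"
    using m by simp
qed simp

text \<open>In 2 + CQ, the 2 counts the initial value and the unit source, and CQ the partial sums
  at the indices below n; the remaining terms belong to the partial sum at n.\<close>

definition CM :: real where
  "CM = 4 * D * W.K * 2 powr D * (2 + CQ) + 4 * W.K * 2 powr D + CS"

text \<open>Superposition in the excess recursion, split into the initial value, the sources below n
  and the source at n. The first two carry the growth of W through the Green function; the term
  \<open>unit_at j n\<close> is the unit source when it sits at n itself.\<close>

theorem V_bound:
  assumes j: "1 \<le> j" "j \<le> n" and x: "1 - 1 / (2 * real n) \<le> x" "x < 1"
  shows "real n * norm (V j x n) \<le> unit_at j n + CM * Wc n / (real j * Wc j)"
proof -
  let ?Wj = "Wc j" and ?Wn = "Wc n"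
  let ?c = "4 * D * W.K * 2 powr D * ?Wn"
  have n: "1 \<le> n" using j by simp
  have "0 \<le> 1 - 1 / (2 * real n)" using n by (simp add: field_simps)
  then have x0: "0 \<le> x" using x by linarith
  have pos: "0 < ?Wj" "0 < ?Wn" by (rule W.gf_pos)+
  have c0: "0 \<le> ?c" using D1 W.K_pos pos by simp
  define T where "T = norm (Q j (of_real x))"
  define s where "s = (\<lambda>k. if k = 0 then T else \<delta> * norm (VV j x (k - 1)) + unit_at j k)"
  have s0: "0 \<le> s k" for k using \<delta> by (auto simp: s_def T_def unit_at_def)
  let ?G = "\<lambda>i. renewal excess (unit_at i) n"
  have "norm (V j x n) \<le> renewal excess s n"
    unfolding V_excess_rec[OF j(1)]
  proof (rule norm_renewal_le)
    show "norm (W.cb k) \<le> excess k" if "1 \<le> k" "k \<le> n" for k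
      unfolding norm_of_real using W.b_bounds(1)[OF that(1)] by (simp only: abs_of_nonneg order.refl)
    show "norm (if k = 0 then Q j (of_real x) else of_real \<delta> * VV j x (k - 1) - unit_at j k) \<le> s k" for k
      using \<delta> norm_triangle_ineq4[of "of_real \<delta> * VV j x (k - 1)" 1]
      by (auto simp: s_def T_def unit_at_def norm_mult)
  qed
  also have "\<dots> = (\<Sum>i\<le>n. s i * ?G i)" by (rule renewal_superpos)
  also have "\<dots> = s 0 * ?G 0 + (\<Sum>i=1..<n. s i * ?G i) + s n * ?G n"
  proof -
    have "{..n} = insert 0 (insert n {1..<n})" using n by auto
    then show ?thesis using n by simp
  qed
  finally have "real n * norm (V j x n) \<le> real n * (s 0 * ?G 0 + (\<Sum>i=1..<n. s i * ?G i) + s n * ?G n)"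
    by (rule mult_left_mono) simp
  also have "\<dots> = s 0 * (real n * ?G 0) + (\<Sum>i=1..<n. s i * (real n * ?G i)) + s n * (real n * ?G n)"
    by (simp add: ring_distribs sum_distrib_left mult_ac)
  also have "real n * ?G n = 1" using renewal_unit_at_same[of n excess] n by simp
  also have "s 0 * (real n * ?G 0) \<le> ?c / (real j * ?Wj)"
  proof -
    have "1 \<le> real j powr \<delta>" using j \<delta> by (intro ge_one_powr_ge_zero) auto
    then have "real j * ?Wj \<le> real j * (?Wj * real j powr \<delta>)" using pos by (intro mult_left_mono) auto
    then have "2 * W.K / (real j * (?Wj * real j powr \<delta>)) \<le> 2 * W.K / (real j * ?Wj)"
      using W.K_pos pos j by (intro divide_left_mono) auto
    then have "T \<le> 2 * W.K / (real j * ?Wj)"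
      unfolding T_def using norm_Q_real_le[OF j(1) x0 x(2)] by linarith
    then have "T * (real n * ?G 0) \<le> 2 * W.K / (real j * ?Wj) * (2 * D * 2 powr D * ?Wn)"
      using W.renewal_unit_nonneg W.K_pos pos
      by (intro mult_mono[OF _ W.renewal_0_le[OF n]]) (auto intro!: mult_nonneg_nonneg)
    then show ?thesis by (simp add: s_def mult_ac)
  qed
  also have "(\<Sum>i=1..<n. s i * (real n * ?G i)) \<le> ?c * ((1 + CQ) / (real j * ?Wj))"
  proof -
    have "(\<Sum>i=1..<n. s i * (real n * ?G i)) \<le>
        (\<Sum>i=1..<n. ?c * (norm (VV j x (i - 1)) / (real i * Wc i) + unit_at j i / (real j * ?Wj)))"
    proof (rule sum_mono)
      fix i assume i: "i \<in> {1..<n}"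
      have "s i * (real n * ?G i) \<le> s i * (4 * D * W.K * 2 powr D * ?Wn / (real i * Wc i))"
        using i s0 by (intro mult_left_mono W.renewal_unit_le) auto
      also have "\<dots> = ?c * (s i / (real i * Wc i))" by simp
      also have "\<dots> \<le> ?c * ((norm (VV j x (i - 1)) + unit_at j i) / (real i * Wc i))"
      proof (intro mult_left_mono divide_right_mono c0)
        show "s i \<le> norm (VV j x (i - 1)) + unit_at j i"
          using i \<delta> by (auto simp: s_def mult_left_le_one_le)
      qed (use W.gf_pos[of "cutoff i"] in simp)
      also have "(norm (VV j x (i - 1)) + unit_at j i) / (real i * Wc i) =
          norm (VV j x (i - 1)) / (real i * Wc i) + unit_at j i / (real j * ?Wj)"
        by (auto simp: add_divide_distrib unit_at_def)
      finally show "s i * (real n * ?G i) \<le>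
        ?c * (norm (VV j x (i - 1)) / (real i * Wc i) + unit_at j i / (real j * ?Wj))" .
    qed
    also have "\<dots> = ?c * ((\<Sum>i=1..<n. norm (VV j x (i - 1)) / (real i * Wc i)) +
        (\<Sum>i=1..<n. unit_at j i) / (real j * ?Wj))"
      by (simp only: sum_distrib_left[symmetric] sum.distrib sum_divide_distrib)
    also have "\<dots> \<le> ?c * (CQ / (real j * ?Wj) + 1 / (real j * ?Wj))"
    proof (intro mult_left_mono add_mono divide_right_mono c0 VV_weighted_sum j x)
      show "(\<Sum>i=1..<n. unit_at j i) \<le> (1::real)"
        by (simp add: unit_at_def)
    qed (use pos in simp)
    also have "\<dots> = ?c * ((1 + CQ) / (real j * ?Wj))" by (simp add: add_divide_distrib)
    finally show ?thesis .
  qed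
  also have "s n * 1 \<le> unit_at j n + (4 * W.K * 2 powr D + CS) * ?Wn / (real j * ?Wj)"
  proof -
    have "\<delta> * norm (VV j x (n - 1)) \<le> 1 * norm (VV j x (n - 1))"
      using \<delta> by (intro mult_right_mono) auto
    then show ?thesis using norm_VV_last[OF j x] n by (simp add: s_def)
  qed
  finally have "real n * norm (V j x n) \<le> ?c / (real j * ?Wj) + ?c * ((1 + CQ) / (real j * ?Wj)) +
     (unit_at j n + (4 * W.K * 2 powr D + CS) * ?Wn / (real j * ?Wj))"
    by simp
  also have "\<dots> = unit_at j n + CM * ?Wn / (real j * ?Wj)"
  proof -
    have "?c + ?c * (1 + CQ) + (4 * W.K * 2 powr D + CS) * ?Wn = CM * ?Wn"
      unfolding CM_def by algebra
    then show ?thesis by (simp add: add_divide_distrib[symmetric] add.assoc)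
  qed
  finally show ?thesis .
qed

end

section \<open>Comparison with the exponential\<close>

lemma norm_exp_diff_le:
  fixes z w :: complex
  assumes "Re z \<le> 0" "Re w \<le> 0"
  shows "norm (exp z - exp w) \<le> norm (z - w)"
proof -
  have "norm (exp z - exp w) \<le> 1 * norm (z - w)"
  proof (rule field_differentiable_bound[of "{z. Re z \<le> 0}"])
    show "(exp has_field_derivative exp z) (at z within {z. Re z \<le> 0})" for z :: complex
      by (rule has_field_derivative_at_within[OF DERIV_exp])
  qed (use assms in \<open>auto simp: convex_halfspace_Re_le\<close>)
  then show ?thesis by simp
qed

text \<open>Comparison with an integral. The constant degenerates as \<delta> tends to 1, where
  \<open>sum_inverse_le_ln\<close> takes over.\<close>

lemma sum_powr_tail_le:
  fixes \<delta> :: real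
  assumes "0 < \<delta>" "\<delta> < 1" "1 \<le> k" "k \<le> n"
  shows "(\<Sum>j=Suc k..n. real j powr (\<delta> - 2)) \<le> real k powr (\<delta> - 1) / (1 - \<delta>)"
proof -
  have "(\<Sum>j=Suc k..n. real j powr (\<delta> - 2)) \<le> (real k powr (\<delta> - 1) - real n powr (\<delta> - 1)) / (1 - \<delta>)"
    using assms(4)
  proof (induction n rule: dec_induct)
    case (step m)
    have m: "0 < real m" using step assms by simp
    have "real (Suc m) powr (\<delta> - 2) \<le> (real m powr (\<delta> - 1) - real (Suc m) powr (\<delta> - 1)) / (1 - \<delta>)"
    proof -
      have "((\<lambda>u. u powr (\<delta> - 1)) has_real_derivative (\<delta> - 1) * u powr (\<delta> - 2)) (at u)" if "real m \<le> u" for u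
        using that m by (auto intro!: derivative_eq_intros simp: algebra_simps)
      then obtain u where u: "real m < u" "u < real (Suc m)"
        "real (Suc m) powr (\<delta> - 1) - real m powr (\<delta> - 1) = (real (Suc m) - real m) * ((\<delta> - 1) * u powr (\<delta> - 2))"
        using MVT2[of "real m" "real (Suc m)" "\<lambda>u. u powr (\<delta> - 1)" "\<lambda>u. (\<delta> - 1) * u powr (\<delta> - 2)"] by auto
      have "real (Suc m) powr (\<delta> - 2) \<le> u powr (\<delta> - 2)"
        using u m assms by (intro powr_mono2') auto
      also have "\<dots> = (real m powr (\<delta> - 1) - real (Suc m) powr (\<delta> - 1)) / (1 - \<delta>)"
        using u(3) assms by (simp add: field_simps)
      finally show ?thesis .
    qed
    then show ?case using step by (simp add: diff_divide_distrib)
  qed simp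
  also have "\<dots> \<le> real k powr (\<delta> - 1) / (1 - \<delta>)"
    using assms by (intro divide_right_mono) auto
  finally show ?thesis .
qed

lemma sum_inverse_le_ln:
  assumes "1 \<le> k" "k \<le> n"
  shows "(\<Sum>j=Suc k..n. 1 / real j) \<le> ln (real n / real k)"
  using assms(2)
proof (induction n rule: dec_induct)
  case base
  then show ?case using assms by simp
next
  case (step m)
  have m: "0 < real m" using step assms by simp
  have "ln (real m / real (Suc m)) \<le> real m / real (Suc m) - 1"
    using m by (intro ln_le_minus_one) simp
  also have "\<dots> = - (1 / real (Suc m))" using m by (simp add: field_simps)
  finally have "1 / real (Suc m) \<le> ln (real (Suc m)) - ln (real m)"
    using m by (simp add: ln_div)
  then show ?case using step assms m by (simp add: ln_div)
qed

section \<open>Lower bounds for the coefficients of P, and the summed weights\<close>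

context weights
begin

abbreviation tail_sum :: "nat \<Rightarrow> nat \<Rightarrow> real" where
  "tail_sum k n \<equiv> \<Sum>j=Suc k..n. real j powr (\<delta> - 2)"

abbreviation pc :: "nat \<Rightarrow> real" where "pc \<equiv> renewal a (unit_at 0)"

lemma pc_lower:
  assumes "1 \<le> n"
  shows "\<delta> * (\<Sum>m<n. pc m) \<le> real n * pc n"
proof -
  have "real n * pc n = (\<Sum>k=1..n. a k * pc (n - k))"
    using renewal_rec[of n a "unit_at 0"] assms by (simp add: unit_at_def)
  also have "\<dots> \<ge> (\<Sum>k=1..n. \<delta> * pc (n - k))"
    using a_bounds P.renewal_unit_nonneg by (intro sum_mono mult_right_mono) auto
  also have "(\<Sum>k=1..n. \<delta> * pc (n - k)) = \<delta> * (\<Sum>m<n. pc m)"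
    unfolding sum_distrib_left[symmetric]
    by (intro arg_cong2[of _ _ _ _ "(*)"] refl
        sum.reindex_bij_witness[of _ "\<lambda>m. n - m" "\<lambda>k. n - k"]) auto
  finally show ?thesis .
qed

lemma pc_pos: "0 < pc n"
proof (cases "n = 0")
  case False
  have "pc 0 \<le> (\<Sum>m<n. pc m)"
    using False P.renewal_unit_nonneg by (intro member_le_sum) auto
  then have "0 < \<delta> * (\<Sum>m<n. pc m)" using \<delta> by (simp add: unit_at_def)
  then have "0 < real n * pc n" using pc_lower[of n] False by simp
  then show ?thesis using False by (simp add: zero_less_mult_iff)
qed (simp add: unit_at_def)

text \<open>The last term of the sum is absorbed by the others through p_n \<le> n p_n \<le> D times
  the sum of the earlier ones. This produces the denominator in the theorem.\<close>

lemma pc_lower_sum: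
  assumes "1 \<le> n"
  shows "\<delta> / (1 + D) * (\<Sum>m\<le>n. pc m) \<le> real n * pc n"
proof -
  have "pc n \<le> real n * pc n" using pc_pos[of n] assms by simp
  also have "\<dots> \<le> D * (\<Sum>m<n. pc m)" using assms by (intro P.renewal_unit_le_sum) simp
  finally have "(\<Sum>m\<le>n. pc m) \<le> (1 + D) * (\<Sum>m<n. pc m)"
    by (simp add: lessThan_Suc_atMost[symmetric] ring_distribs)
  then have "\<delta> / (1 + D) * (\<Sum>m\<le>n. pc m) \<le> \<delta> / (1 + D) * ((1 + D) * (\<Sum>m<n. pc m))"
    using \<delta> D1 by (intro mult_left_mono) auto
  also have "\<dots> = \<delta> * (\<Sum>m<n. pc m)" using D1 by simp
  also have "\<dots> \<le> real n * pc n" by (rule pc_lower[OF assms])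
  finally show ?thesis .
qed

text \<open>Set against the growth W in \<open>V_bound\<close>, the extra n^\<delta> here is the
  saving n^(- \<delta>) of the theorem.\<close>

lemma pc_lower_gf:
  assumes "1 \<le> n"
  shows "\<delta> / P.Klow * (Wc n * real n powr \<delta>) \<le> real n * pc n"
proof -
  have "\<delta> / P.Klow * P.gf (cutoff n) \<le> \<delta> / P.Klow * (P.Klow * (\<Sum>m<n. pc m))"
    using P.gf_le_sum_renewal[OF assms] \<delta> P.Klow_pos by (intro mult_left_mono) auto
  also have "\<dots> = \<delta> * (\<Sum>m<n. pc m)" using P.Klow_pos by simp
  also have "\<dots> \<le> real n * pc n" by (rule pc_lower[OF assms])
  finally show ?thesis by (simp add: gf_cutoff[OF assms])
qed

definition CJ :: real where "CJ = 2 * 2 powr D + 4 * D * 2 powr D"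

lemma CJ_pos: "0 < CJ" using D1 by (simp add: CJ_def add_pos_pos)

text \<open>Split at 2k, with weight 1 / (j W) = j^(\<delta> - 1) / P at \<open>cutoff j\<close>.
  Below, the decreasing weight is taken at k and the coefficients of P sum to the order of P at
  \<open>cutoff k\<close>. Above, j - k \<ge> j/2, so \<open>renewal_0_le\<close> gives terms of
  order j^(\<delta> - 2).\<close>

lemma convolution_weight_le:
  assumes k: "1 \<le> k" "k \<le> n"
  shows "(\<Sum>j=k..n. pc (j - k) / (real j * Wc j)) \<le>
     CJ * (real k powr (\<delta> - 1) + tail_sum k n)"
proof -
  have w: "1 / (real j * Wc j) = real j powr (\<delta> - 1) / P.gf (cutoff j)" if "1 \<le> j" for j
    using that W.gf_pos[of "cutoff j"] by (simp add: gf_cutoff powr_diff)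
  let ?g = "\<lambda>j. pc (j - k) / (real j * Wc j)"
  have g0: "0 \<le> ?g j" for j
    using P.renewal_unit_nonneg W.gf_pos[of "cutoff j"] by simp
  have "(\<Sum>j=k..n. ?g j) \<le> (\<Sum>j=k..<2 * k. ?g j) + (\<Sum>j=2 * k..n. ?g j)"
  proof -
    have "(\<Sum>j=k..n. ?g j) \<le> (\<Sum>j\<in>{k..<2 * k} \<union> {2 * k..n}. ?g j)"
      using g0 by (intro sum_mono2) auto
    also have "\<dots> = (\<Sum>j=k..<2 * k. ?g j) + (\<Sum>j=2 * k..n. ?g j)"
      by (rule sum.union_disjoint) auto
    finally show ?thesis .
  qed
  also have "(\<Sum>j=k..<2 * k. ?g j) \<le> 2 * 2 powr D * real k powr (\<delta> - 1)"
  proof -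
    have "(\<Sum>j=k..<2 * k. ?g j) \<le> (\<Sum>j=k..<2 * k. pc (j - k) * (real k powr (\<delta> - 1) / P.gf (cutoff k)))"
    proof (rule sum_mono)
      fix j assume j: "j \<in> {k..<2 * k}"
      then have j1: "1 \<le> j" using k by simp
      have "1 / real j \<le> 1 / real k" using j k by (intro divide_left_mono) auto
      then have "P.gf (cutoff k) \<le> P.gf (cutoff j)" using j k j1 by (intro P.gf_mono) auto
      moreover have "real j powr (\<delta> - 1) \<le> real k powr (\<delta> - 1)"
        using j k \<delta> by (intro powr_mono2') auto
      ultimately have "1 / (real j * Wc j) \<le> real k powr (\<delta> - 1) / P.gf (cutoff k)"
        unfolding w[OF j1] using P.gf_pos by (intro frac_le) auto
      then have "pc (j - k) * (1 / (real j * Wc j)) \<le> pc (j - k) * (real k powr (\<delta> - 1) / P.gf (cutoff k))"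
        using P.renewal_unit_nonneg by (intro mult_left_mono) auto
      then show "?g j \<le> pc (j - k) * (real k powr (\<delta> - 1) / P.gf (cutoff k))" by simp
    qed
    also have "\<dots> = (\<Sum>j=k..<2 * k. pc (j - k)) * (real k powr (\<delta> - 1) / P.gf (cutoff k))"
      by (rule sum_distrib_right[symmetric])
    also have "(\<Sum>j=k..<2 * k. pc (j - k)) = (\<Sum>i<k. pc i)"
      by (rule sum.reindex_bij_witness[of _ "\<lambda>i. i + k" "\<lambda>j. j - k"]) auto
    also have "\<dots> * (real k powr (\<delta> - 1) / P.gf (cutoff k)) \<le>
        (2 * 2 powr D * P.gf (cutoff k)) * (real k powr (\<delta> - 1) / P.gf (cutoff k))"
    proof (rule mult_right_mono)
      have "(\<Sum>i<k. pc i) \<le> (\<Sum>i\<le>k. pc i)" using P.renewal_unit_nonneg by (intro sum_mono2) auto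
      with P.sum_renewal_0_le[OF k(1)] show "(\<Sum>i<k. pc i) \<le> 2 * 2 powr D * P.gf (cutoff k)" by linarith
    qed (use P.gf_pos[of "cutoff k"] in simp)
    also have "\<dots> = 2 * 2 powr D * real k powr (\<delta> - 1)"
      using P.gf_pos[of "cutoff k"] by simp
    finally show ?thesis .
  qed
  also have "(\<Sum>j=2 * k..n. ?g j) \<le> 4 * D * 2 powr D * tail_sum k n"
  proof -
    have "(\<Sum>j=2 * k..n. ?g j) \<le> (\<Sum>j=2 * k..n. 4 * D * 2 powr D * real j powr (\<delta> - 2))"
    proof (rule sum_mono)
      fix j assume j: "j \<in> {2 * k..n}"
      then have j1: "1 \<le> j" "1 \<le> j - k" "real j \<le> 2 * real (j - k)" using k by auto
      have "1 / real j \<le> 1 / real (j - k)" "1 / real (j - k) \<le> 1" "0 < 1 / real j"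
        using j1 by (auto intro!: divide_left_mono simp del: of_nat_diff)
      moreover have "P.gf (1 - s) \<le> P.gf (1 - t)" if "t \<le> s" "s \<le> 1" "0 < t" for s t
        by (rule P.gf_mono) (use that in auto)
      ultimately have mono: "P.gf (cutoff (j - k)) \<le> P.gf (cutoff j)" by blast
      have "real j * pc (j - k) \<le> 2 * (real (j - k) * pc (j - k))"
        using mult_right_mono[OF j1(3), of "pc (j - k)"] P.renewal_unit_nonneg by simp
      also have "\<dots> \<le> 2 * (2 * D * 2 powr D * P.gf (cutoff (j - k)))"
        by (intro mult_left_mono P.renewal_0_le j1) simp
      also have "\<dots> \<le> 2 * (2 * D * 2 powr D * P.gf (cutoff j))"
        using mono D1 by (intro mult_left_mono) auto
      finally have "pc (j - k) \<le> 4 * D * 2 powr D * P.gf (cutoff j) / real j"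
        using j1 by (simp add: field_simps)
      then have "pc (j - k) * (real j powr (\<delta> - 1) / P.gf (cutoff j)) \<le>
          4 * D * 2 powr D * P.gf (cutoff j) / real j * (real j powr (\<delta> - 1) / P.gf (cutoff j))"
        using P.gf_pos[of "cutoff j"] by (intro mult_right_mono) auto
      also have "\<dots> = 4 * D * 2 powr D * (real j powr (\<delta> - 1) / real j)"
        using P.gf_pos[of "cutoff j"] by simp
      also have "real j powr (\<delta> - 1) / real j = real j powr (\<delta> - 1 - 1)"
        using powr_diff[of "real j" "\<delta> - 1" 1] j1 by simp
      also have "\<delta> - 1 - 1 = \<delta> - 2" by simp
      also have "pc (j - k) * (real j powr (\<delta> - 1) / P.gf (cutoff j)) = ?g j"
        unfolding w[OF j1(1), symmetric] by simp
      finally show "?g j \<le> 4 * D * 2 powr D * real j powr (\<delta> - 2)" .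
    qed
    also have "\<dots> = 4 * D * 2 powr D * (\<Sum>j=2 * k..n. real j powr (\<delta> - 2))"
      by (rule sum_distrib_left[symmetric])
    also have "\<dots> \<le> 4 * D * 2 powr D * tail_sum k n"
      using k D1 by (intro mult_left_mono sum_mono2) auto
    finally show ?thesis .
  qed
  finally have "(\<Sum>j=k..n. ?g j) \<le> 2 * 2 powr D * real k powr (\<delta> - 1) +
      4 * D * 2 powr D * tail_sum k n" by simp
  also have "\<dots> \<le> CJ * real k powr (\<delta> - 1) + CJ * tail_sum k n"
    using D1 by (intro add_mono mult_right_mono sum_nonneg) (auto simp: CJ_def)
  finally show ?thesis by (simp add: ring_distribs)
qed

end

section \<open>Summing over the sources; the emergence of the exponential\<close>

lemma sum_triangle_swap:
  fixes g :: "nat \<Rightarrow> nat \<Rightarrow> 'a::comm_monoid_add"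
  shows "(\<Sum>j=1..n. \<Sum>k=1..j. g j k) = (\<Sum>k=1..n. \<Sum>j=k..n. g j k)"
proof -
  have "(\<Sum>j=1..n. \<Sum>k=1..j. g j k) = (\<Sum>j=1..n. \<Sum>k\<in>{k. k \<in> {1..n} \<and> k \<le> j}. g j k)"
    by (intro sum.cong) auto
  also have "\<dots> = (\<Sum>k=1..n. \<Sum>j\<in>{j. j \<in> {1..n} \<and> k \<le> j}. g j k)"
    by (rule sum.swap_restrict) auto
  also have "\<dots> = (\<Sum>k=1..n. \<Sum>j=k..n. g j k)"
    by (intro sum.cong) auto
  finally show ?thesis .
qed

text \<open>Setting f to 1 beyond n leaves the value at n unchanged and makes the quotient of the
  two generating functions the exponential of a polynomial, \<open>L\<close>.\<close>

locale weighted_mean = weights +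
  fixes f :: "nat \<Rightarrow> complex" and n :: nat
  assumes n: "1 \<le> n" and f_le: "1 \<le> k \<Longrightarrow> norm (f k) \<le> 1" and f_one: "n < k \<Longrightarrow> f k = 1"
begin

abbreviation h :: "nat \<Rightarrow> real" where "h k \<equiv> norm (f k - 1)"
abbreviation smoothed :: real where
  "smoothed \<equiv> inverse (\<Sum>m\<le>n. pc m) * (\<Sum>k=1..n. h k * pc (n - k))"
abbreviation af :: "nat \<Rightarrow> complex" where "af \<equiv> \<lambda>k. of_real (a k) * f k"
abbreviation F :: "nat \<Rightarrow> complex" where "F \<equiv> renewal af (unit_at 0)"

definition S :: "nat \<Rightarrow> complex" where
  "S m = (\<Sum>k=1..m. of_real (a k) * (f k - 1) * F (m - k))"

text \<open>The logarithm of the quotient of the generating functions of \<open>F\<close> and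
  \<open>pc\<close>; at 1 it is the exponent in the theorem.\<close>

definition L :: "complex \<Rightarrow> complex" where
  "L z = (\<Sum>k=1..n. of_real (a k) * (f k - 1) / of_nat k * z ^ k)"

definition x :: real where "x = 1 - 1 / (2 * real n)"

lemma x_bounds: "0 \<le> x" "x < 1" "1 - 1 / (2 * real n) \<le> x"
  using n by (auto simp: x_def field_simps)

text \<open>What becomes of F_n / p_n when each unit solution in \<open>F_expand\<close> is replaced
  by its comparison value \<open>Q j x\<close> times p_n.\<close>

definition mstar :: complex where
  "mstar = 1 + (\<Sum>j=1..n. S j * Q j (of_real x))"

lemma norm_a: "1 \<le> k \<Longrightarrow> norm (of_real (a k) :: complex) \<le> D"
  using P.c.norm_b by simp

lemma norm_F_le: "norm (F m) \<le> pc m"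
proof (rule norm_renewal_le)
  fix k :: nat assume k: "1 \<le> k" "k \<le> m"
  have "norm (af k) \<le> a k * 1"
    unfolding norm_mult norm_of_real using k f_le P.b_bounds(1)[of k] by (intro mult_mono) auto
  then show "norm (af k) \<le> a k" by simp
qed (simp add: unit_at_def)

lemma norm_S_le: "norm (S m) \<le> D * (\<Sum>k=1..m. h k * pc (m - k))"
  unfolding S_def sum_distrib_left
proof (rule sum_norm_le)
  fix k assume "k \<in> {1..m}"
  then have "norm (of_real (a k) :: complex) * (h k * norm (F (m - k))) \<le> D * (h k * pc (m - k))"
    using D1 by (intro mult_mono norm_a norm_F_le) auto
  then show "norm (of_real (a k) * (f k - 1) * F (m - k)) \<le> D * (h k * pc (m - k))"
    by (simp add: norm_mult mult.assoc)
qed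

lemma F_expand: "F n = of_real (pc n) + (\<Sum>j=1..n. S j * renewal P.cb (unit_at j) n)"
proof -
  let ?s = "\<lambda>k. if k = 0 then 1 else S k"
  have "F n = renewal P.cb ?s n"
  proof (rule renewal_eqI[of _ _ n])
    fix m :: nat assume m: "0 < m"
    have "of_nat m * F m = (\<Sum>k=1..m. af k * F (m - k))"
      using renewal_rec[OF m, of af] m by (simp add: unit_at_def)
    also have "\<dots> = (\<Sum>k=1..m. P.cb k * F (m - k)) + S m"
      unfolding S_def by (simp add: algebra_simps flip: sum.distrib)
    finally show "of_nat m * F m = (\<Sum>k=1..m. P.cb k * F (m - k)) + (if m = 0 then 1 else S m)"
      using m by simp
  qed (auto simp: unit_at_def)
  also have "\<dots> = (\<Sum>j\<le>n. ?s j * renewal P.cb (unit_at j) n)"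
    by (rule renewal_superpos)
  also have "\<dots> = renewal P.cb (unit_at 0) n + (\<Sum>j=1..n. S j * renewal P.cb (unit_at j) n)"
  proof -
    have "{..n} = insert 0 {1..n}" by auto
    then show ?thesis by simp
  qed
  finally show ?thesis by (simp add: P.renewal_cb)
qed

definition weighted_sum :: real where
  "weighted_sum = (\<Sum>k=1..n. h k * (real k powr (\<delta> - 1) + tail_sum k n))"

text \<open>The error is the sum of \<open>S j * V j x n\<close>. The term
  \<open>unit_at j n\<close> of \<open>V_bound\<close> selects the source at n and yields
  \<open>smoothed\<close> via \<open>pc_lower_sum\<close>; in the other, W at
  \<open>cutoff n\<close> cancels against \<open>pc_lower_gf\<close> and leaves n^(-
  \<delta>).\<close>

lemma mstar_bound:
  "norm (mstar - F n / of_real (pc n)) \<le>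
     D * (1 + D) / \<delta> * smoothed
     + D * CM * P.Klow * CJ / \<delta> * (real n powr (- \<delta>) * weighted_sum)"
proof -
  let ?p = "of_real (pc n) :: complex"
  let ?\<sigma> = "\<lambda>j. \<Sum>k=1..j. h k * pc (j - k)"
  let ?Wn = "Wc n"
  have np: "0 < real n * pc n" using n pc_pos[of n] by simp
  have CM0: "0 \<le> CM"
    using D1 W.K_pos CS_pos \<delta> by (simp add: CM_def CQ_def)
  have \<sigma>0: "0 \<le> ?\<sigma> j" for j using P.renewal_unit_nonneg by (intro sum_nonneg) auto
  have "mstar * ?p - F n = (\<Sum>j=1..n. S j * V j x n)"
    unfolding F_expand mstar_def V_eq
    by (simp add: P.renewal_cb algebra_simps sum_distrib_left sum_subtractf)
  then have "real n * norm (mstar * ?p - F n) = real n * norm (\<Sum>j=1..n. S j * V j x n)" by simp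
  also have "\<dots> \<le> real n * (\<Sum>j=1..n. norm (S j) * norm (V j x n))"
    by (intro mult_left_mono sum_norm_le) (auto simp: norm_mult)
  also have "\<dots> = (\<Sum>j=1..n. norm (S j) * (real n * norm (V j x n)))"
    by (simp add: sum_distrib_left mult_ac)
  also have "\<dots> \<le> (\<Sum>j=1..n. (D * ?\<sigma> j) * (unit_at j n + CM * ?Wn / (real j * Wc j)))"
    using D1 \<sigma>0 by (intro sum_mono mult_mono norm_S_le V_bound x_bounds) auto
  also have "\<dots> = (\<Sum>j=1..n. if j = n then D * ?\<sigma> j else 0) +
     (\<Sum>j=1..n. D * CM * ?Wn * (?\<sigma> j / (real j * Wc j)))"
    unfolding sum.distrib[symmetric] by (intro sum.cong) (auto simp: unit_at_def ring_distribs)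
  also have "(\<Sum>j=1..n. if j = n then D * ?\<sigma> j else 0) = D * ?\<sigma> n" using n by simp
  also have "(\<Sum>j=1..n. D * CM * ?Wn * (?\<sigma> j / (real j * Wc j))) =
     D * CM * ?Wn * (\<Sum>j=1..n. ?\<sigma> j / (real j * Wc j))" by (simp add: sum_distrib_left)
  also have "(\<Sum>j=1..n. ?\<sigma> j / (real j * Wc j)) =
      (\<Sum>k=1..n. h k * (\<Sum>j=k..n. pc (j - k) / (real j * Wc j)))"
    unfolding sum_divide_distrib sum_triangle_swap by (simp add: sum_distrib_left)
  also have "D * CM * ?Wn * \<dots> \<le> D * CM * ?Wn * (CJ * weighted_sum)"
  proof (rule mult_left_mono)
    have "(\<Sum>k=1..n. h k * (\<Sum>j=k..n. pc (j - k) / (real j * Wc j))) \<le>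
        (\<Sum>k=1..n. h k * (CJ * (real k powr (\<delta> - 1) + tail_sum k n)))"
      by (intro sum_mono mult_left_mono convolution_weight_le) auto
    then show "(\<Sum>k=1..n. h k * (\<Sum>j=k..n. pc (j - k) / (real j * Wc j))) \<le> CJ * weighted_sum"
      by (simp add: weighted_sum_def sum_distrib_left mult_ac)
  qed (use D1 CM0 W.gf_pos[of "cutoff n"] in simp)
  finally have main: "real n * norm (mstar * ?p - F n) \<le> D * ?\<sigma> n + D * CM * ?Wn * (CJ * weighted_sum)" by simp
  have ws0: "0 \<le> weighted_sum"
    unfolding weighted_sum_def by (intro sum_nonneg mult_nonneg_nonneg add_nonneg_nonneg) auto
  have "norm (mstar - F n / ?p) = norm (mstar * ?p - F n) / pc n"
  proof -
    have "mstar - F n / ?p = (mstar * ?p - F n) / ?p" using pc_pos[of n] by (simp add: field_simps)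
    then show ?thesis using pc_pos[of n] by (simp add: norm_divide)
  qed
  also have "\<dots> = real n * norm (mstar * ?p - F n) / (real n * pc n)" using n by simp
  also have "\<dots> \<le> (D * ?\<sigma> n + D * CM * ?Wn * (CJ * weighted_sum)) / (real n * pc n)"
    using main np by (intro divide_right_mono) auto
  also have "\<dots> = D * ?\<sigma> n / (real n * pc n) + D * CM * ?Wn * (CJ * weighted_sum) / (real n * pc n)"
    by (rule add_divide_distrib)
  also have "D * ?\<sigma> n / (real n * pc n) \<le> D * ?\<sigma> n / (\<delta> / (1 + D) * (\<Sum>m\<le>n. pc m))"
  proof (rule divide_left_mono[OF pc_lower_sum[OF n]])
    have "0 < (\<Sum>m\<le>n. pc m)" using pc_pos by (intro sum_pos) auto
    then show "0 < (real n * pc n) * (\<delta> / (1 + D) * (\<Sum>m\<le>n. pc m))" using \<delta> D1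
      by (intro mult_pos_pos[OF np] mult_pos_pos) auto
  qed (use D1 \<sigma>0 in simp)
  also have "\<dots> = D * (1 + D) / \<delta> * (inverse (\<Sum>m\<le>n. pc m) * ?\<sigma> n)"
    by (simp add: divide_inverse)
  also have "D * CM * ?Wn * (CJ * weighted_sum) / (real n * pc n) \<le>
      D * CM * ?Wn * (CJ * weighted_sum) / (\<delta> / P.Klow * (?Wn * real n powr \<delta>))"
    using np pc_pos[of n] \<delta> P.Klow_pos W.gf_pos[of "cutoff n"] n D1 CM0 CJ_pos ws0
    by (intro divide_left_mono pc_lower_gf mult_nonneg_nonneg mult_pos_pos) (auto intro: less_imp_le)
  also have "\<dots> = D * CM * P.Klow * CJ / \<delta> * (real n powr (- \<delta>) * weighted_sum)"
    using W.gf_pos[of "cutoff n"] by (simp add: powr_minus divide_inverse)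
  finally show ?thesis by simp
qed

lemma Re_L_le: "0 \<le> u \<Longrightarrow> Re (L (of_real u)) \<le> 0"
  unfolding L_def Re_sum
proof (rule sum_nonpos)
  fix k assume k: "k \<in> {1..n}" and u: "0 \<le> u"
  have "Re (f k) \<le> 1" using complex_Re_le_cmod[of "f k"] f_le[of k] k by simp
  then have "a k / real k * u ^ k * Re (f k - 1) \<le> 0"
    using k u P.b_bounds(1)[of k] by (intro mult_nonneg_nonpos) auto
  moreover have e: "of_real (a k) * (f k - 1) / of_nat k * of_real u ^ k =
      of_real (a k / real k * u ^ k) * (f k - 1)"
    by simp
  ultimately show "Re (of_real (a k) * (f k - 1) / of_nat k * of_real u ^ k) \<le> 0"
    unfolding e by (simp only: times_complex.sel Re_complex_of_real Im_complex_of_real mult_zero_left diff_0_right)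
qed

text \<open>Both exponents lie in the left half-plane, where exp is 1-Lipschitz, and 1 - x^k \<le>
  k/n cancels the denominator k.\<close>

lemma exp_L_diff:
  "norm (exp (L 1) - exp (L (of_real x))) \<le> D / real n * sum h {1..n}"
proof -
  have "norm (exp (L 1) - exp (L (of_real x))) \<le> norm (L 1 - L (of_real x))"
    using Re_L_le[of 1] Re_L_le[OF x_bounds(1)] by (intro norm_exp_diff_le) auto
  also have "L 1 - L (of_real x) = (\<Sum>k=1..n. of_real (a k) * (f k - 1) / of_nat k * (1 - of_real x ^ k))"
    by (simp add: L_def right_diff_distrib flip: sum_subtractf)
  also have "norm \<dots> \<le> (\<Sum>k=1..n. D / real n * h k)"
  proof (rule sum_norm_le)
    fix k assume k: "k \<in> {1..n}"
    have "1 - x ^ k \<le> real k * (1 - x)"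
      using Bernoulli_inequality[of "x - 1" k] x_bounds by (simp add: algebra_simps)
    also have "1 - x \<le> 1 / real n" using n by (simp add: x_def field_simps)
    finally have 1: "1 - x ^ k \<le> real k / real n" by (simp add: mult_left_mono)
    have 2: "0 \<le> 1 - x ^ k" using x_bounds by (simp add: power_le_one)
    have "1 - of_real x ^ k = (of_real (1 - x ^ k) :: complex)" by simp
    then have "norm (1 - of_real x ^ k :: complex) = 1 - x ^ k" using 2 by (simp only: norm_of_real abs_of_nonneg)
    then have "norm (of_real (a k) * (f k - 1) / of_nat k * (1 - of_real x ^ k)) =
        norm (of_real (a k) :: complex) * h k / real k * (1 - x ^ k)"
      by (simp only: norm_mult norm_divide norm_of_nat)
    also have "\<dots> \<le> D * h k / real k * (real k / real n)"
      using k 1 2 norm_a[of k] D1 by (intro mult_mono divide_right_mono) auto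
    also have "\<dots> = D / real n * h k" using k by simp
    finally show "norm (of_real (a k) * (f k - 1) / of_nat k * (1 - of_real x ^ k)) \<le> D / real n * h k" .
  qed
  also have "\<dots> = D / real n * sum h {1..n}" by (simp add: sum_distrib_left)
  finally show ?thesis .
qed

lemma norm_af: "1 \<le> k \<Longrightarrow> norm (af k) \<le> D"
  using mult_mono[OF norm_a[of k] f_le[of k]] D1 by (simp add: norm_mult)

sublocale af: bounded_coeffs af D
  by unfold_locales (rule norm_af)

lemma lser_af:
  assumes "norm z < 1"
  shows "lser af z = lser P.cb z + L z"
proof -
  have "(\<lambda>k. if k \<in> {1..n} then of_real (a k) * (f k - 1) / of_nat k * z ^ k else 0) sums L z"
    unfolding L_def by (rule sums_If_finite_set) simp
  from sums_add[OF P.c.lser_sums[OF assms] this]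
  have "(\<lambda>k. P.cb k / of_nat k * z ^ k + (if k \<in> {1..n} then of_real (a k) * (f k - 1) / of_nat k * z ^ k else 0))
     sums (lser P.cb z + L z)" .
  also have "(\<lambda>k. P.cb k / of_nat k * z ^ k + (if k \<in> {1..n} then of_real (a k) * (f k - 1) / of_nat k * z ^ k else 0))
     = (\<lambda>k. af k / of_nat k * z ^ k)"
  proof
    fix k
    consider "k = 0" | "k \<in> {1..n}" | "n < k" by fastforce
    then show "P.cb k / of_nat k * z ^ k + (if k \<in> {1..n} then of_real (a k) * (f k - 1) / of_nat k * z ^ k else 0)
       = af k / of_nat k * z ^ k"
    proof cases
      case 2
      then show ?thesis by (simp add: algebra_simps diff_divide_distrib)
    qed (auto simp: f_one)
  qed
  finally show ?thesis using af.lser_sums[OF assms] sums_unique2 by metis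
qed

lemma F_sums:
  assumes z: "norm z < 1"
  shows "(\<lambda>m. F m * z ^ m) sums exp (lser af z)"
proof -
  have d: "((\<lambda>z. exp (lser af z)) has_field_derivative exp (lser af z) * eval_fps (fps_deriv (lfps af)) z) (at z)"
    if "norm z < 1" for z
    by (intro DERIV_chain2[OF DERIV_exp] af.lser_deriv that)
  have "(\<lambda>z. exp (lser af z)) holomorphic_on ball 0 1"
    unfolding holomorphic_on_open[OF open_ball] using d by (intro ballI exI) simp
  then have "(\<lambda>m. renewal af (\<lambda>m. exp (lser af 0) * unit_at 0 m + 0 * unit_at 1 m) m * z ^ m) sums exp (lser af z)"
    by (rule holomorphic_ode_sums[OF af.bounded_coeffs_axioms _ _ _ z]) (auto simp: DERIV_imp_deriv[OF d])
  then show ?thesis by (simp add: af.lser_0)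
qed

lemma F_tail:
  assumes u: "0 \<le> u" "u < 1"
  shows "norm (exp (lser af (of_real u)) - (\<Sum>i<M. F i * of_real u ^ i)) \<le> 2 powr D * sqrt u ^ M * P.gf u"
proof -
  have s: "(\<lambda>m. F m * of_real u ^ m) sums exp (lser af (of_real u))"
    using u by (intro F_sums) simp
  have "exp (lser af (of_real u)) - (\<Sum>i<M. F i * of_real u ^ i) = (\<Sum>m. F (m + M) * of_real u ^ (m + M))"
    using suminf_split_initial_segment[OF sums_summable[OF s], of M] s by (simp add: sums_iff diff_eq_eq)
  also have "norm \<dots> \<le> (\<Sum>m. pc (m + M) * u ^ (m + M))"
  proof (rule norm_suminf_le)
    show "norm (F (m + M) * of_real u ^ (m + M)) \<le> pc (m + M) * u ^ (m + M)" for m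
      using norm_F_le[of "m + M"] u by (simp add: norm_mult norm_power mult_right_mono)
  qed (rule P.gf_tail(1)[OF u])
  also have "\<dots> \<le> 2 powr D * sqrt u ^ M * P.gf u" by (rule P.gf_tail(2)[OF u])
  finally show ?thesis .
qed

text \<open>Over all j, the sum of S_j z^(j-1) is L' times the generating function of
  \<open>F\<close>, which is P exp(L). Dividing by P and integrating would give exp(L) - 1 exactly.
  Stopping at j = n leaves, for each k, the tail of that series from n + 1 - k on; after division by
  P this makes the derivative of the difference of order \<open>sqrt u ^ n\<close>, and integration
  gains 1/n.\<close>

lemma exp_L_mstar:
  "norm (exp (L (of_real x)) - mstar) \<le> 2 * D * 2 powr D / real n * sum h {1..n}"
proof -
  let ?c = "\<lambda>k. of_real (a k) * (f k - 1)"
  let ?\<phi> = "\<lambda>z. exp (L z) - (1 + (\<Sum>j=1..n. S j * Q j z))"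
  let ?\<phi>' = "\<lambda>z. (\<Sum>k=1..n. ?c k * z ^ (k - 1)) * exp (L z) -
     (\<Sum>j=1..n. S j * (z ^ (j - 1) * exp (- lser P.cb z)))"
  let ?A = "D * 2 powr D * sum h {1..n}"
  have dL: "(L has_field_derivative (\<Sum>k=1..n. ?c k * z ^ (k - 1))) (at z)" for z
  proof -
    have "((\<lambda>z. \<Sum>k=1..n. ?c k / of_nat k * z ^ k) has_field_derivative
        (\<Sum>k=1..n. ?c k / of_nat k * (of_nat k * z ^ (k - Suc 0)))) (at z)"
      by (intro DERIV_sum DERIV_cmult) (auto intro!: derivative_eq_intros)
    also have "(\<Sum>k=1..n. ?c k / of_nat k * (of_nat k * z ^ (k - Suc 0))) = (\<Sum>k=1..n. ?c k * z ^ (k - 1))"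
      by (rule sum.cong) auto
    finally show ?thesis unfolding L_def[abs_def] .
  qed
  have d: "(?\<phi> has_field_derivative ?\<phi>' z) (at z)" if "norm z < 1" for z
  proof -
    have "(?\<phi> has_field_derivative exp (L z) * (\<Sum>k=1..n. ?c k * z ^ (k - 1)) -
       (0 + (\<Sum>j=1..n. S j * (z ^ (j - 1) * exp (- lser P.cb z))))) (at z)"
      by (intro DERIV_diff DERIV_add DERIV_const DERIV_sum DERIV_cmult DERIV_chain2[OF DERIV_exp] dL
          prim_spec(2)[OF P.c.bounded_coeffs_axioms that])
    then show ?thesis by (simp add: mult.commute)
  qed
  have vd: "((\<lambda>u. ?\<phi> (of_real u)) has_vector_derivative ?\<phi>' (of_real u)) (at u within T)"
    if "\<bar>u\<bar> < 1" for u T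
    using d[of "of_real u"] that
    by (intro has_vector_derivative_real_field) simp_all
  \<comment> \<open>The exponent is written \<open>n + 1 - 1\<close> to fit
    \<open>norm_diff_le_sqrt_power\<close> at index n + 1.\<close>
  have bound: "norm (?\<phi>' (of_real u)) \<le> ?A * sqrt u ^ (n + 1 - 1)" if u: "0 < u" "u < x" for u
  proof -
    let ?z = "of_real u :: complex"
    have u1: "0 \<le> u" "u < 1" using u x_bounds by auto
    have nz: "norm ?z < 1" using u1 by simp
    have su: "0 \<le> sqrt u" "sqrt u \<le> 1" using u1 by auto
    have eL: "exp (L ?z) = exp (lser af ?z) * exp (- lser P.cb ?z)"
      by (simp add: lser_af[OF nz] exp_add exp_minus)
    have "(\<Sum>j=1..n. S j * ?z ^ (j - 1)) = (\<Sum>j=1..n. \<Sum>k=1..j. ?c k * F (j - k) * ?z ^ (j - 1))"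
      by (simp only: S_def sum_distrib_right)
    also have "\<dots> = (\<Sum>k=1..n. \<Sum>j=k..n. ?c k * F (j - k) * ?z ^ (j - 1))"
      by (rule sum_triangle_swap)
    also have "\<dots> = (\<Sum>k=1..n. ?c k * ?z ^ (k - 1) * (\<Sum>i<n + 1 - k. F i * ?z ^ i))"
    proof (rule sum.cong[OF refl])
      fix k assume k: "k \<in> {1..n}"
      have "(\<Sum>j=k..n. ?c k * F (j - k) * ?z ^ (j - 1)) =
          (\<Sum>j=k..n. ?c k * ?z ^ (k - 1) * (F (j - k) * ?z ^ (j - k)))"
      proof (rule sum.cong[OF refl])
        fix j assume j: "j \<in> {k..n}"
        then have "j - 1 = (k - 1) + (j - k)" using k by auto
        then have "?z ^ (j - 1) = ?z ^ (k - 1) * ?z ^ (j - k)" by (simp only: power_add)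
        then show "?c k * F (j - k) * ?z ^ (j - 1) = ?c k * ?z ^ (k - 1) * (F (j - k) * ?z ^ (j - k))"
          by (simp only: mult_ac)
      qed
      also have "\<dots> = ?c k * ?z ^ (k - 1) * (\<Sum>j=k..n. F (j - k) * ?z ^ (j - k))"
        by (rule sum_distrib_left[symmetric])
      also have "(\<Sum>j=k..n. F (j - k) * ?z ^ (j - k)) = (\<Sum>i<n + 1 - k. F i * ?z ^ i)"
        by (rule sum.reindex_bij_witness[of _ "\<lambda>i. i + k" "\<lambda>j. j - k"]) auto
      finally show "(\<Sum>j=k..n. ?c k * F (j - k) * ?z ^ (j - 1)) =
          ?c k * ?z ^ (k - 1) * (\<Sum>i<n + 1 - k. F i * ?z ^ i)" .
    qed
    finally have S: "(\<Sum>j=1..n. S j * ?z ^ (j - 1)) =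
        (\<Sum>k=1..n. ?c k * ?z ^ (k - 1) * (\<Sum>i<n + 1 - k. F i * ?z ^ i))" .
    have "?\<phi>' ?z = exp (- lser P.cb ?z) * ((\<Sum>k=1..n. ?c k * ?z ^ (k - 1)) * exp (lser af ?z) -
        (\<Sum>j=1..n. S j * ?z ^ (j - 1)))"
      unfolding eL by (simp add: right_diff_distrib sum_distrib_left mult_ac)
    also have "(\<Sum>k=1..n. ?c k * ?z ^ (k - 1)) * exp (lser af ?z) - (\<Sum>j=1..n. S j * ?z ^ (j - 1)) =
        (\<Sum>k=1..n. ?c k * ?z ^ (k - 1) * (exp (lser af ?z) - (\<Sum>i<n + 1 - k. F i * ?z ^ i)))"
      unfolding S by (simp only: sum_distrib_right right_diff_distrib sum_subtractf)
    finally have eq: "?\<phi>' ?z = exp (- lser P.cb ?z) *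
        (\<Sum>k=1..n. ?c k * ?z ^ (k - 1) * (exp (lser af ?z) - (\<Sum>i<n + 1 - k. F i * ?z ^ i)))" .
    let ?R = "\<lambda>k. exp (lser af ?z) - (\<Sum>i<n + 1 - k. F i * ?z ^ i)"
    have "norm (\<Sum>k=1..n. ?c k * ?z ^ (k - 1) * ?R k)
       \<le> (\<Sum>k=1..n. D * h k * (2 powr D * sqrt u ^ n * P.gf u))"
    proof (rule sum_norm_le)
      fix k assume k: "k \<in> {1..n}"
      have "norm (?c k * ?z ^ (k - 1) * ?R k) =
         norm (of_real (a k) :: complex) * h k * (u ^ (k - 1) * norm (?R k))"
        using u1 by (simp add: norm_mult norm_power)
      also have "\<dots> \<le> D * h k * (2 powr D * sqrt u ^ n * P.gf u)"
      proof (rule mult_mono[OF mult_right_mono])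
        \<comment> \<open>Weakening u to \<open>sqrt u\<close> makes the exponents k - 1 and n + 1 -
          k add up to n for every k.\<close>
        have "u ^ (k - 1) * norm (?R k) \<le>
          sqrt u ^ (k - 1) * (2 powr D * sqrt u ^ (n + 1 - k) * P.gf u)"
        proof (intro mult_mono F_tail u1 power_mono)
          show "u \<le> sqrt u" using u1 by (intro real_le_rsqrt) (simp add: power2_eq_square mult_left_le)
        qed (use u1 in auto)
        also have "\<dots> = 2 powr D * sqrt u ^ n * P.gf u"
        proof -
          have "sqrt u ^ (k - 1) * sqrt u ^ (n + 1 - k) = sqrt u ^ n"
            using k by (simp flip: power_add)
          then show ?thesis by (simp add: mult_ac)
        qed
        finally show "u ^ (k - 1) * norm (?R k) \<le>
          2 powr D * sqrt u ^ n * P.gf u" .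
      qed (use k norm_a[of k] D1 u1 in auto)
      finally show "norm (?c k * ?z ^ (k - 1) * ?R k) \<le>
        D * h k * (2 powr D * sqrt u ^ n * P.gf u)" .
    qed
    also have "\<dots> = ?A * sqrt u ^ n * P.gf u"
      by (simp add: sum_distrib_left sum_distrib_right mult_ac)
    finally have "norm (?\<phi>' ?z) \<le> norm (exp (- lser P.cb ?z)) * (?A * sqrt u ^ n * P.gf u)"
      unfolding eq norm_mult by (intro mult_left_mono) auto
    also have "norm (exp (- lser P.cb ?z)) = 1 / P.gf u"
      using u1 by (simp add: P.lser_cb_of_real P.gf_def exp_minus divide_inverse exp_of_real norm_inverse)
    also have "1 / P.gf u * (?A * sqrt u ^ n * P.gf u) = ?A * sqrt u ^ (n + 1 - 1)"
      using P.gf_pos[of u] by simp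
    finally show ?thesis .
  qed
  have "norm (?\<phi> (of_real x) - ?\<phi> (of_real 0)) \<le> 2 * ?A / real (n + 1)"
  proof (rule norm_diff_le_sqrt_power[where f' = "\<lambda>u. ?\<phi>' (of_real u)"])
    show "continuous_on {0..x} (\<lambda>u. ?\<phi> (of_real u))"
      by (rule continuous_on_vector_derivative[OF vd]) (use x_bounds in auto)
    show "((\<lambda>u. ?\<phi> (of_real u)) has_vector_derivative ?\<phi>' (of_real u)) (at u)" if "0 < u" "u < x" for u
      using that x_bounds by (intro vd) auto
    show "0 \<le> ?A" using D1 by (intro mult_nonneg_nonneg sum_nonneg) auto
  qed (use x_bounds bound in auto)
  also have "?\<phi> (of_real 0) = 0"
  proof -
    have "L 0 = 0" by (simp add: L_def)
    then show ?thesis by (simp add: prim_spec(1)[OF P.c.bounded_coeffs_axioms])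
  qed
  also have "2 * ?A / real (n + 1) \<le> 2 * ?A / real n"
    using n D1 by (intro divide_left_mono mult_nonneg_nonneg sum_nonneg) auto
  finally show ?thesis by (simp add: mstar_def)
qed

lemma mean_bound:
  "norm (F n / of_real (pc n) - exp (L 1)) \<le>
     D * (1 + D) / \<delta> * smoothed
     + D * CM * P.Klow * CJ / \<delta> * (real n powr (- \<delta>) * weighted_sum)
     + (D + 2 * D * 2 powr D) * (1 / real n * sum h {1..n})"
proof -
  have "norm (F n / of_real (pc n) - exp (L 1)) \<le>
    norm (mstar - F n / of_real (pc n)) + norm (exp (L (of_real x)) - mstar) + norm (exp (L 1) - exp (L (of_real x)))"
    using norm_triangle_ineq[of "mstar - F n / of_real (pc n)" "exp (L (of_real x)) - mstar"]
      norm_triangle_ineq[of "exp (L (of_real x)) - F n / of_real (pc n)" "exp (L 1) - exp (L (of_real x))"]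
    by (simp add: norm_minus_commute)
  also have "\<dots> \<le> (D * (1 + D) / \<delta> * smoothed
     + D * CM * P.Klow * CJ / \<delta> * (real n powr (- \<delta>) * weighted_sum)) +
     2 * D * 2 powr D / real n * sum h {1..n} + D / real n * sum h {1..n}"
    by (intro add_mono mstar_bound exp_L_mstar exp_L_diff)
  finally show ?thesis by (simp add: ring_distribs add_divide_distrib)
qed

text \<open>Built from \<delta> and D alone, so outside the locale it is a function of these two;
  this gives the uniformity in the theorem. The conditional covers both shapes with one
  constant.\<close>

definition CT :: real where
  "CT = D * (1 + D) / \<delta> + D * CM * P.Klow * CJ / \<delta> * (1 + 1 / (if \<delta> < 1 then 1 - \<delta> else 1)) + (D + 2 * D * 2 powr D)"

lemma CT_bound:
  assumes "X1 \<ge> 0" "X2 \<ge> 0" "X3 \<ge> 0"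
    and "c2 \<le> 1 + 1 / (if \<delta> < 1 then 1 - \<delta> else 1)"
  shows "D * (1 + D) / \<delta> * X1 + D * CM * P.Klow * CJ / \<delta> * (c2 * X2) + (D + 2 * D * 2 powr D) * X3
    \<le> CT * (X1 + X2 + X3)"
proof -
  let ?e = "1 + 1 / (if \<delta> < 1 then 1 - \<delta> else 1)"
  have e: "0 \<le> ?e" by simp
  have CM0: "0 \<le> CM"
    using D1 W.K_pos CS_pos \<delta> by (simp add: CM_def CQ_def)
  define A where "A = D * (1 + D) / \<delta>"
  define B where "B = D * CM * P.Klow * CJ / \<delta>"
  define C where "C = D + 2 * D * 2 powr D"
  have A: "0 \<le> A" and B: "0 \<le> B" and C: "0 \<le> C"
    unfolding A_def B_def C_def using D1 \<delta> CM0 P.Klow_pos CJ_pos by simp_all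
  have "B * (c2 * X2) \<le> B * ?e * X2"
    using assms B by (simp only: mult.assoc) (intro mult_left_mono mult_right_mono, auto)
  then have "A * X1 + B * (c2 * X2) + C * X3 \<le> A * X1 + B * ?e * X2 + C * X3" by simp
  also have "\<dots> \<le> (A + B * ?e + C) * X1 + (A + B * ?e + C) * X2 + (A + B * ?e + C) * X3"
    using A mult_nonneg_nonneg[OF B e] C assms(1-3) by (intro add_mono mult_right_mono) linarith+
  also have "\<dots> = CT * (X1 + X2 + X3)"
    unfolding CT_def A_def[symmetric] B_def[symmetric] C_def[symmetric] by (simp only: ring_distribs)
  finally show ?thesis unfolding A_def B_def C_def .
qed

theorem mean_bound_less_1:
  assumes "\<delta> < 1"
  shows "norm (F n / of_real (pc n) - exp (L 1)) \<le> CT *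
     (smoothed
      + real n powr (- \<delta>) * (\<Sum>k=1..n. h k * real k powr (\<delta> - 1))
      + 1 / real n * sum h {1..n})"
proof -
  let ?X2 = "\<Sum>k=1..n. h k * real k powr (\<delta> - 1)"
  have "weighted_sum \<le> (\<Sum>k=1..n. h k * ((1 + 1 / (1 - \<delta>)) * real k powr (\<delta> - 1)))"
    unfolding weighted_sum_def
  proof (intro sum_mono mult_left_mono)
    fix k assume "k \<in> {1..n}"
    then show "real k powr (\<delta> - 1) + tail_sum k n \<le> (1 + 1 / (1 - \<delta>)) * real k powr (\<delta> - 1)"
      using sum_powr_tail_le[OF \<delta>(1) assms, of k n] by (simp add: ring_distribs)
  qed simp
  also have "\<dots> = (1 + 1 / (1 - \<delta>)) * ?X2" by (simp add: sum_distrib_left mult_ac)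
  finally have ws: "weighted_sum \<le> (1 + 1 / (1 - \<delta>)) * ?X2" .
  have B: "0 \<le> D * CM * P.Klow * CJ / \<delta>"
    using D1 W.K_pos CS_pos \<delta> P.Klow_pos CJ_pos by (simp add: CM_def CQ_def)
  have "norm (F n / of_real (pc n) - exp (L 1)) \<le>
     D * (1 + D) / \<delta> * smoothed
     + D * CM * P.Klow * CJ / \<delta> * ((1 + 1 / (1 - \<delta>)) * (real n powr (- \<delta>) * ?X2))
     + (D + 2 * D * 2 powr D) * (1 / real n * sum h {1..n})"
  proof (rule order.trans[OF mean_bound], intro add_mono order.refl mult_left_mono B)
    have "real n powr (- \<delta>) * weighted_sum \<le> real n powr (- \<delta>) * ((1 + 1 / (1 - \<delta>)) * ?X2)"
      using ws by (intro mult_left_mono) auto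
    then show "real n powr (- \<delta>) * weighted_sum \<le> (1 + 1 / (1 - \<delta>)) * (real n powr (- \<delta>) * ?X2)"
      by (simp only: mult_ac)
  qed
  also have "\<dots> \<le> CT * (smoothed
      + real n powr (- \<delta>) * ?X2 + 1 / real n * sum h {1..n})"
  proof (rule CT_bound)
    show "0 \<le> smoothed"
      using P.renewal_unit_nonneg by (intro mult_nonneg_nonneg sum_nonneg) (auto intro: sum_nonneg)
  qed (use assms in \<open>auto intro!: mult_nonneg_nonneg sum_nonneg divide_nonneg_nonneg\<close>)
  finally show ?thesis .
qed

text \<open>For \<delta> = 1 the tail sum is harmonic and gives the logarithm. The plain average of
  h is absorbed by the logarithmic one, which doubles the constant.\<close>

theorem mean_bound_1:
  assumes "\<delta> = 1"
  shows "norm (F n / of_real (pc n) - exp (L 1)) \<le> 2 * CT *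
     (smoothed
      + 1 / real n * (\<Sum>k=1..n. h k * (1 + ln (real n / real k))))"
proof -
  let ?X2 = "\<Sum>k=1..n. h k * (1 + ln (real n / real k))"
  let ?X1 = smoothed
  have ln0: "0 \<le> ln (real n / real k)" if "k \<in> {1..n}" for k
    using that by (intro ln_ge_zero) simp
  have ws: "weighted_sum \<le> ?X2"
    unfolding weighted_sum_def
  proof (intro sum_mono mult_left_mono)
    fix k assume k: "k \<in> {1..n}"
    have "tail_sum k n = (\<Sum>j=Suc k..n. 1 / real j)"
      using assms by (intro sum.cong) (auto simp: powr_minus divide_inverse)
    then show "real k powr (\<delta> - 1) + tail_sum k n \<le> 1 + ln (real n / real k)"
      using sum_inverse_le_ln[of k n] k assms by simp
  qed simp
  have B: "0 \<le> D * CM * P.Klow * CJ / \<delta>"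
    using D1 W.K_pos CS_pos \<delta> P.Klow_pos CJ_pos by (simp add: CM_def CQ_def)
  have X1: "0 \<le> ?X1"
    using P.renewal_unit_nonneg by (intro mult_nonneg_nonneg sum_nonneg) (auto simp: sum_nonneg)
  have X2: "0 \<le> 1 / real n * ?X2" using ln0 by (intro mult_nonneg_nonneg sum_nonneg) (auto simp: add_nonneg_nonneg)
  have X3: "sum h {1..n} \<le> ?X2"
  proof (rule sum_mono)
    fix k assume "k \<in> {1..n}"
    then have "h k * 1 \<le> h k * (1 + ln (real n / real k))" using ln0 by (intro mult_left_mono) auto
    then show "h k \<le> h k * (1 + ln (real n / real k))" by simp
  qed
  have C0: "0 \<le> D + 2 * D * 2 powr D" using D1 by simp
  have CT0: "0 \<le> CT"
  proof -
    have "0 \<le> D * (1 + D) / \<delta>" using D1 \<delta> by simp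
    also have "\<dots> \<le> CT" using CT_bound[of 1 0 0 0] by simp
    finally show ?thesis .
  qed
  have "norm (F n / of_real (pc n) - exp (L 1)) \<le>
     D * (1 + D) / \<delta> * ?X1
     + D * CM * P.Klow * CJ / \<delta> * (1 * (1 / real n * ?X2))
     + (D + 2 * D * 2 powr D) * (1 / real n * ?X2)"
  proof (rule order.trans[OF mean_bound], intro add_mono order.refl mult_left_mono B C0 X3)
    have "real n powr (- \<delta>) = 1 / real n" using assms n by (simp add: powr_minus divide_inverse)
    then show "real n powr (- \<delta>) * weighted_sum \<le> 1 * (1 / real n * ?X2)"
      using ws by (simp add: divide_right_mono)
  qed simp
  also have "\<dots> \<le> CT * (?X1 + 1 / real n * ?X2 + 1 / real n * ?X2)"
    using assms by (intro CT_bound X1 X2) simp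
  also have "\<dots> \<le> CT * (2 * (?X1 + 1 / real n * ?X2))"
    using X1 CT0 by (intro mult_left_mono) auto
  finally show ?thesis by (simp only: mult_ac)
qed

end

section \<open>Return to permutations\<close>

lemma perm_mean_eq_renewal:
  fixes g :: "nat set \<Rightarrow> (nat \<Rightarrow> nat) \<Rightarrow> 'a::{real_normed_field,field_char_0}"
  assumes g: "multiplicative n g" and m: "m \<le> n"
  shows "perm_mean g {1..m} = renewal (hat g) (unit_at 0) m"
proof (rule renewal_eqI[where N = n])
  have "g {} id = (\<Prod>C\<in>orbit id ` {}. g C (perm_restrict id C))"
    using g[unfolded multiplicative_def, THEN conjunct1, rule_format, of "{}" id]
    by (simp only: empty_subsetI permutes_id)
  then show "perm_mean g {1..0} = unit_at 0 0"
    by (simp add: perm_mean_def unit_at_def)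
  fix i :: nat assume "0 < i" "i \<le> n"
  then show "of_nat i * perm_mean g {1..i} = (\<Sum>k=1..i. hat g k * perm_mean g {1..i - k}) + unit_at 0 i"
    using perm_mean_rec(1)[OF g, of "{1..i}"] by (simp add: unit_at_def)
qed (rule m)

lemma multiplicative_mult_of_real:
  fixes f :: "nat set \<Rightarrow> (nat \<Rightarrow> nat) \<Rightarrow> complex"
  assumes "multiplicative n f" "multiplicative n d"
  shows "multiplicative n (\<lambda>A \<sigma>. f A \<sigma> * of_real (d A \<sigma>))"
  unfolding multiplicative_def
proof (intro conjI allI impI)
  fix A :: "nat set" and \<sigma> assume A: "A \<subseteq> {1..n}" "\<sigma> permutes A"
  have "f A \<sigma> = (\<Prod>C\<in>orbit \<sigma> ` A. f C (perm_restrict \<sigma> C))"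
    "d A \<sigma> = (\<Prod>C\<in>orbit \<sigma> ` A. d C (perm_restrict \<sigma> C))"
    using assms A unfolding multiplicative_def by blast+
  then show "f A \<sigma> * of_real (d A \<sigma>) =
      (\<Prod>C\<in>orbit \<sigma> ` A. f C (perm_restrict \<sigma> C) * of_real (d C (perm_restrict \<sigma> C)))"
    by (simp add: prod.distrib)
next
  fix C C' :: "nat set" and \<kappa> \<kappa>'
  assume *: "C \<subseteq> {1..n}" "C' \<subseteq> {1..n}" "\<kappa> permutes C" "cyclic_on \<kappa> C"
    "\<kappa>' permutes C'" "cyclic_on \<kappa>' C'" "card C = card C'"
  then show "f C \<kappa> * of_real (d C \<kappa>) = f C' \<kappa>' * of_real (d C' \<kappa>')"
    using hat_eq[OF assms(1)] hat_eq[OF assms(2)] by simp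
qed

lemma norm_hat_le_1:
  assumes "\<forall>A \<sigma>. A \<subseteq> {1..n} \<longrightarrow> \<sigma> permutes A \<longrightarrow> norm (f A \<sigma> :: complex) \<le> 1" "k \<le> n"
  shows "norm (hat f k) \<le> 1"
proof -
  have "cycle_of_list [1..<Suc k] permutes set [1..<Suc k]" by (rule cycle_permutes)
  moreover have "set [1..<Suc k] = {1..k}" by auto
  ultimately have "cycle_of_list [1..<Suc k] permutes {1..k}" by metis
  moreover have "{1..k} \<subseteq> {1..n}" using assms(2) by auto
  ultimately show ?thesis unfolding hat_def using assms(1) by blast
qed

lemma mean_value_eq:
  assumes f: "multiplicative n f" and d: "multiplicative n d"
  shows "mean_value n d f =
    renewal (\<lambda>k. of_real (hat d k) * hat f k) (unit_at 0) n / of_real (p d n)"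
proof -
  let ?g = "\<lambda>A \<sigma>. f A \<sigma> * of_real (d A \<sigma>)"
  have "mean_value n d f = (\<Sum>\<sigma> | \<sigma> permutes {1..n}. ?g {1..n} \<sigma>) /
      of_real (\<Sum>w | w permutes {1..n}. d {1..n} w)"
    unfolding mean_value_def nu_def by (simp add: sum_divide_distrib)
  also have "\<dots> = perm_mean ?g {1..n} / of_real (p d n)"
    by (simp add: perm_mean_def p_def)
  also have "perm_mean ?g {1..n} = renewal (hat ?g) (unit_at 0) n"
    by (rule perm_mean_eq_renewal[OF multiplicative_mult_of_real[OF f d]]) simp
  also have "hat ?g = (\<lambda>k. of_real (hat d k) * hat f k)"
    by (simp add: hat_def fun_eq_iff mult.commute)
  finally show ?thesis .
qed

lemma p_eq_renewal:
  assumes "multiplicative n d" "m \<le> n"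
  shows "p d m = renewal (hat d) (unit_at 0) m"
  using perm_mean_eq_renewal[OF assms] by (simp add: perm_mean_def p_def)

theorem theorem1:
  fixes dm dp :: real
  assumes "0 < dm" and "dm \<le> dp"
  shows "\<exists>c>0. \<forall>(n::nat) (d :: nat set \<Rightarrow> (nat \<Rightarrow> nat) \<Rightarrow> real)
                  (f :: nat set \<Rightarrow> (nat \<Rightarrow> nat) \<Rightarrow> complex).
    n \<ge> 1 \<longrightarrow>
    multiplicative n d \<longrightarrow>
    (\<forall>A \<sigma>. A \<subseteq> {1..n} \<longrightarrow> \<sigma> permutes A \<longrightarrow> 0 \<le> d A \<sigma>) \<longrightarrow>
    (\<forall>j\<in>{1..n}. dm \<le> hat d j \<and> hat d j \<le> dp) \<longrightarrow>
    multiplicative n f \<longrightarrow>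
    (\<forall>A \<sigma>. A \<subseteq> {1..n} \<longrightarrow> \<sigma> permutes A \<longrightarrow> norm (f A \<sigma>) \<le> 1) \<longrightarrow>
    (dm < 1 \<longrightarrow>
       Delta n d f \<le> c *
         (inverse (\<Sum>j=0..n. p d j) * (\<Sum>k=1..n. norm (hat f k - 1) * p d (n - k))
          + 1 / real n powr dm * (\<Sum>k=1..n. norm (hat f k - 1) * real k powr (dm - 1))
          + 1 / real n * (\<Sum>k=1..n. norm (hat f k - 1)))) \<and>
    (dm \<ge> 1 \<longrightarrow>
       Delta n d f \<le> c *
         (inverse (\<Sum>j=0..n. p d j) * (\<Sum>k=1..n. norm (hat f k - 1) * p d (n - k))
          + 1 / real n * (\<Sum>k=1..n. norm (hat f k - 1) * (1 + ln (real n / real k)))))"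
proof -
  define \<delta> where "\<delta> = min 1 dm"
  define D where "D = max 1 dp"
  \<comment> \<open>The maximum with 1 secures positivity before any hypothesis of the locale is
    available; the factor 2 is that of \<open>mean_bound_1\<close>.\<close>
  define c where "c = max 1 (2 * weighted_mean.CT \<delta> D)"
  have "c > 0" by (simp add: c_def)
  moreover have
    "(dm < 1 \<longrightarrow>
       Delta n d f \<le> c *
         (inverse (\<Sum>j=0..n. p d j) * (\<Sum>k=1..n. norm (hat f k - 1) * p d (n - k))
          + 1 / real n powr dm * (\<Sum>k=1..n. norm (hat f k - 1) * real k powr (dm - 1))
          + 1 / real n * (\<Sum>k=1..n. norm (hat f k - 1)))) \<and>
    (dm \<ge> 1 \<longrightarrow>
       Delta n d f \<le> c *
         (inverse (\<Sum>j=0..n. p d j) * (\<Sum>k=1..n. norm (hat f k - 1) * p d (n - k))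
          + 1 / real n * (\<Sum>k=1..n. norm (hat f k - 1) * (1 + ln (real n / real k)))))"
    if n: "n \<ge> 1" and d: "multiplicative n d" and dj: "\<forall>j\<in>{1..n}. dm \<le> hat d j \<and> hat d j \<le> dp"
      and f: "multiplicative n f"
      and f1: "\<forall>A \<sigma>. A \<subseteq> {1..n} \<longrightarrow> \<sigma> permutes A \<longrightarrow> norm (f A \<sigma>) \<le> 1"
    for n :: nat and d :: "nat set \<Rightarrow> (nat \<Rightarrow> nat) \<Rightarrow> real" and f :: "nat set \<Rightarrow> (nat \<Rightarrow> nat) \<Rightarrow> complex"
  proof -
    \<comment> \<open>The hypotheses speak only of lengths up to n, whereas the locale asks for
      bounds at every length. Filling in \<delta> here and 1 for \<open>f\<close> affects none of
      the quantities up to n.\<close>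
    define a where "a = (\<lambda>k. if k \<in> {1..n} then hat d k else \<delta>)"
    define f' where "f' = (\<lambda>k. if k \<in> {1..n} then hat f k else 1)"
    interpret weighted_mean a \<delta> D f' n
    proof
      show "0 < \<delta>" "\<delta> \<le> 1" "1 \<le> D" "1 \<le> n"
        using assms n by (auto simp: \<delta>_def D_def)
      show "\<delta> \<le> a k" "a k \<le> D" for k
        using dj assms by (auto simp: a_def \<delta>_def D_def intro: min.coboundedI2 max.coboundedI2)
      show "norm (f' k) \<le> 1" for k
        using norm_hat_le_1[OF f1] by (auto simp: f'_def)
      show "f' k = 1" if "n < k" for k using that by (simp add: f'_def)
    qed
    have p: "p d m = pc m" if "m \<le> n" for m
      unfolding p_eq_renewal[OF d that] by (rule renewal_cong) (use that in \<open>auto simp: a_def\<close>)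
    have F: "renewal (\<lambda>k. of_real (hat d k) * hat f k) (unit_at 0) n = F n"
      by (rule renewal_cong) (auto simp: a_def f'_def)
    have L: "(\<Sum>k=1..n. of_real (hat d k) * (hat f k - 1) / of_nat k) = L 1"
      unfolding L_def by (rule sum.cong) (auto simp: a_def f'_def)
    have Delta: "Delta n d f = norm (F n / of_real (pc n) - exp (L 1))"
      unfolding Delta_def mean_value_eq[OF f d] F L using p[of n] by simp
    have h: "norm (hat f k - 1) = h k" if "k \<in> {1..n}" for k
      using that by (simp add: f'_def)
    have s1: "inverse (\<Sum>j=0..n. p d j) * (\<Sum>k=1..n. norm (hat f k - 1) * p d (n - k)) =
       smoothed"
      using p h by (simp add: atLeast0AtMost)
    have s2: "(\<Sum>k=1..n. norm (hat f k - 1) * g k) = (\<Sum>k=1..n. h k * g k)" for g :: "nat \<Rightarrow> real"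
      using h by simp
    have s3: "(\<Sum>k=1..n. norm (hat f k - 1)) = (\<Sum>k=1..n. h k)"
      using h by simp
    have pos: "0 \<le> smoothed"
      using P.renewal_unit_nonneg by (intro mult_nonneg_nonneg sum_nonneg) (auto intro: sum_nonneg)
    have up: "y \<le> c * X" if "y \<le> b * X" "b \<le> c" "0 \<le> X" for y b X :: real
      using that mult_right_mono order.trans by blast
    show ?thesis
      unfolding s1
      unfolding s2[of "\<lambda>k. real k powr (dm - 1)"] s2[of "\<lambda>k. 1 + ln (real n / real k)"] s3 Delta
    proof (intro conjI impI)
      assume dm: "dm < 1"
      then have \<delta>: "\<delta> = dm" by (simp add: \<delta>_def)
      have CT: "CT \<le> c" unfolding c_def by linarith
      show "norm (F n / of_real (pc n) - exp (L 1)) \<le> c *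
         (smoothed
          + 1 / real n powr dm * (\<Sum>k=1..n. h k * real k powr (dm - 1))
          + 1 / real n * (\<Sum>k=1..n. h k))"
        using mean_bound_less_1[unfolded \<delta> powr_minus_divide, OF dm]
      proof (rule up)
        show "weighted_mean.CT dm D \<le> c" using CT \<delta> by simp
        show "0 \<le> smoothed
          + 1 / real n powr dm * (\<Sum>k=1..n. h k * real k powr (dm - 1))
          + 1 / real n * (\<Sum>k=1..n. h k)"
          by (intro add_nonneg_nonneg pos mult_nonneg_nonneg sum_nonneg) simp_all
      qed
    next
      assume dm: "1 \<le> dm"
      then have \<delta>: "\<delta> = 1" by (simp add: \<delta>_def)
      have CT: "2 * CT \<le> c" unfolding c_def by linarith
      show "norm (F n / of_real (pc n) - exp (L 1)) \<le> c *
         (smoothed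
          + 1 / real n * (\<Sum>k=1..n. h k * (1 + ln (real n / real k))))"
        using mean_bound_1[OF \<delta>]
      proof (rule up[OF _ CT])
        have "0 \<le> h k * (1 + ln (real n / real k))" if "k \<in> {1..n}" for k
          using that by (intro mult_nonneg_nonneg add_nonneg_nonneg ln_ge_zero) auto
        then show "0 \<le> smoothed
          + 1 / real n * (\<Sum>k=1..n. h k * (1 + ln (real n / real k)))"
          by (intro add_nonneg_nonneg pos mult_nonneg_nonneg sum_nonneg) auto
      qed
    qed
  qed
  ultimately show ?thesis by blast
qed

end
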